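(* Let $\mathscr G$ be an ample groupoid and $\mathcal O$ a $\mathscr G$-sheaf of rings. (1) If $\Gamma_c(\mathscr G,\mathcal O)$ is left primitive, then there is an orbit $\mathrm{Orb}(x)$ such that, for $f\in\Gamma_c(\mathscr G,\mathcal O)$, $f|_{\boldsymbol d^{-1}(\mathrm{Orb}(x))}=0$ implies $f=0$. (2) Suppose that there is an orbit $\mathrm{Orb}(x)$ with $B_x$ left primitive and such that, for $f\in\Gamma_c(\mathscr G,\mathcal O)$, $f|_{\boldsymbol d^{-1}(\mathrm{Orb}(x))}=0$ implies $f=0$. Then $\Gamma_c(\mathscr G,\mathcal O)$ is left primitive.
   Context: "Compact" includes Hausdorff. A groupoid $\mathscr G$ (identified with its set of arrows) has unit space $\mathscr G^{(0)}$, $\boldsymbol d(\gamma)=\gamma^{-1}\gamma$, $\boldsymbol r(\gamma)=\gamma\gamma^{-1}$. It is ample if it is a topological groupoid such that $\mathscr G^{(0)}$ is locally compact Hausdorff with a basis of compact open sets and $\boldsymbol r$ is a local homeomorphism. A bisection is a subset on which $\boldsymbol d$ and $\boldsymbol r$ are injective. For $x\in\mathscr G^{(0)}$, $\mathrm{Orb}(x)=\boldsymbol r(\boldsymbol d^{-1}(x))$ and $\mathscr G_x^x=\{g:\boldsymbol d(g)=\boldsymbol r(g)=x\}$. A $\mathscr G$-sheaf $(E,p,\alpha)$ is a space $E$, a local homeomorphism $p:E\to\mathscr G^{(0)}$ and a continuous map $\alpha:\mathscr G\times_{\boldsymbol d,p}E\to E$, $(\gamma,e)\mapsto\alpha_\gamma(e)$,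 with $\alpha_{p(e)}(e)=e$, $p(\alpha_\gamma(e))=\boldsymbol r(\gamma)$, and $\alpha_\beta(\alpha_\gamma(e))=\alpha_{\beta\gamma}(e)$ whenever defined. The stalk at $x$ is $p^{-1}(x)$. A $\mathscr G$-sheaf of rings $\mathcal O=(E,p,\alpha)$ is a $\mathscr G$-sheaf with a unital ring structure on each stalk $\mathcal O_x$ such that fiberwise addition and multiplication $E\times_{p,p}E\to E$ and the unit section $x\mapsto 1_x$ are continuous, and each $\alpha_\gamma:\mathcal O_{\boldsymbol d(\gamma)}\to\mathcal O_{\boldsymbol r(\gamma)}$ is a (unital) ring homomorphism. $\Gamma_c(\mathscr G,\mathcal O)$ is the additive group generated by all maps $f:\mathscr G\to E$ with $p\circ f=\boldsymbol r$ for which there is a compact open bisection $U$ with $f|_U$ continuous and $f=0$ off $U$. It is a ring under pointwise addition and convolution $(f*g)(\gamma)=\sum_{\beta\rho=\gamma}f(\beta)\alpha_\beta(g(\rho))$. $B_x=\mathcal O_x\rtimes\mathscr G_x^x$ is the skew group ring, with product $(b\delta)(c\eta)=b\alpha_\delta(c)\,\delta\eta$ for $b,c\in\mathcal O_x$, $\delta,\eta\in\mathscr G_x^x$. A ring $R$ is left primitive if it has a faithful simple left module; a simple left $R$-module is a module $N$ with $RN\neq 0$ whose only submodules are $0$ and $N$. *)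

theory Defs
  imports "HOL-Analysis.Analysis" "HOL-Algebra.Generated_Groups" "HOL-Algebra.Module"
begin

section \<open>Ample groupoids\<close>

text \<open>Arrows are the points of the topology; the groupoid need not fill its ground type.\<close>

record 'g top_groupoid =
  gtop :: "'g topology"
  gmult :: "'g \<Rightarrow> 'g \<Rightarrow> 'g"
  ginv :: "'g \<Rightarrow> 'g"

definition arrows :: "('g, 'm) top_groupoid_scheme \<Rightarrow> 'g set" where
  "arrows G = topspace (gtop G)"

definition gdom :: "('g, 'm) top_groupoid_scheme \<Rightarrow> 'g \<Rightarrow> 'g" where
  "gdom G \<gamma> = gmult G (ginv G \<gamma>) \<gamma>"

definition grng :: "('g, 'm) top_groupoid_scheme \<Rightarrow> 'g \<Rightarrow> 'g" where
  "grng G \<gamma> = gmult G \<gamma> (ginv G \<gamma>)"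

definition units :: "('g, 'm) top_groupoid_scheme \<Rightarrow> 'g set" where
  "units G = gdom G ` arrows G"

definition composable :: "('g, 'm) top_groupoid_scheme \<Rightarrow> ('g \<times> 'g) set" where
  "composable G = {(\<beta>, \<gamma>). \<beta> \<in> arrows G \<and> \<gamma> \<in> arrows G \<and> gdom G \<beta> = grng G \<gamma>}"

text \<open>The axioms say that the arrows form a small category, with objects identified with
  identity arrows, in which every arrow is invertible. The values of
  \<open>gmult\<close> on non-composable pairs are irrelevant.\<close>

locale groupoid =
  fixes G :: "('g, 'm) top_groupoid_scheme"
  assumes mult_closed: "(\<beta>, \<gamma>) \<in> composable G \<Longrightarrow> gmult G \<beta> \<gamma> \<in> arrows G"
    and dom_mult: "(\<beta>, \<gamma>) \<in> composable G \<Longrightarrow> gdom G (gmult G \<beta> \<gamma>) = gdom G \<gamma>"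
    and rng_mult: "(\<beta>, \<gamma>) \<in> composable G \<Longrightarrow> grng G (gmult G \<beta> \<gamma>) = grng G \<beta>"
    and mult_assoc: "(\<alpha>, \<beta>) \<in> composable G \<Longrightarrow> (\<beta>, \<gamma>) \<in> composable G \<Longrightarrow>
      gmult G (gmult G \<alpha> \<beta>) \<gamma> = gmult G \<alpha> (gmult G \<beta> \<gamma>)"
    and inv_closed: "\<gamma> \<in> arrows G \<Longrightarrow> ginv G \<gamma> \<in> arrows G"
    and dom_inv: "\<gamma> \<in> arrows G \<Longrightarrow> gdom G (ginv G \<gamma>) = grng G \<gamma>"
    and rng_inv: "\<gamma> \<in> arrows G \<Longrightarrow> grng G (ginv G \<gamma>) = gdom G \<gamma>"
    and mult_dom: "\<gamma> \<in> arrows G \<Longrightarrow> gmult G \<gamma> (gdom G \<gamma>) = \<gamma>"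
    and rng_mult_self: "\<gamma> \<in> arrows G \<Longrightarrow> gmult G (grng G \<gamma>) \<gamma> = \<gamma>"

locale topological_groupoid = groupoid +
  assumes mult_continuous: "continuous_map
      (subtopology (prod_topology (gtop G) (gtop G)) (composable G)) (gtop G)
      (\<lambda>(\<beta>, \<gamma>). gmult G \<beta> \<gamma>)"
    and inv_continuous: "continuous_map (gtop G) (gtop G) (ginv G)"

definition unit_space :: "('g, 'm) top_groupoid_scheme \<Rightarrow> 'g topology" where
  "unit_space G = subtopology (gtop G) (units G)"

definition local_homeomorphism :: "'a topology \<Rightarrow> 'b topology \<Rightarrow> ('a \<Rightarrow> 'b) \<Rightarrow> bool" where
  "local_homeomorphism X Y f \<longleftrightarrow>
     (\<forall>x\<in>topspace X. \<exists>U. openin X U \<and> x \<in> U \<and> openin Y (f ` U) \<and>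
        homeomorphic_map (subtopology X U) (subtopology Y (f ` U)) f)"

text \<open>Compact includes Hausdorff, also for subsets of a non-Hausdorff space.\<close>

definition compact_open :: "'a topology \<Rightarrow> 'a set \<Rightarrow> bool" where
  "compact_open X K \<longleftrightarrow> openin X K \<and> compactin X K \<and> Hausdorff_space (subtopology X K)"

locale ample_groupoid = topological_groupoid +
  assumes unit_space_locally_compact: "locally_compact_space (unit_space G)"
    and unit_space_Hausdorff: "Hausdorff_space (unit_space G)"
    and unit_space_basis: "openin (unit_space G) W \<Longrightarrow> x \<in> W \<Longrightarrow>
      \<exists>K. compact_open (unit_space G) K \<and> x \<in> K \<and> K \<subseteq> W"
    and rng_local_homeomorphism: "local_homeomorphism (gtop G) (unit_space G) (grng G)"

definition bisection :: "('g, 'm) top_groupoid_scheme \<Rightarrow> 'g set \<Rightarrow> bool" where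
  "bisection G U \<longleftrightarrow> U \<subseteq> arrows G \<and> inj_on (gdom G) U \<and> inj_on (grng G) U"

definition orbit :: "('g, 'm) top_groupoid_scheme \<Rightarrow> 'g \<Rightarrow> 'g set" where
  "orbit G x = grng G ` {\<gamma> \<in> arrows G. gdom G \<gamma> = x}"

definition isotropy :: "('g, 'm) top_groupoid_scheme \<Rightarrow> 'g \<Rightarrow> 'g set" where
  "isotropy G x = {\<gamma> \<in> arrows G. gdom G \<gamma> = x \<and> grng G \<gamma> = x}"


section \<open>Sheaves of rings\<close>

record ('g, 'e) gsheaf =
  etop :: "'e topology"
  proj :: "'e \<Rightarrow> 'g"
  act :: "'g \<Rightarrow> 'e \<Rightarrow> 'e"

locale groupoid_sheaf =
  fixes G :: "('g, 'm) top_groupoid_scheme" and S :: "('g, 'e, 'n) gsheaf_scheme"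
  assumes proj_local_homeomorphism: "local_homeomorphism (etop S) (unit_space G) (proj S)"
    and act_continuous: "continuous_map
      (subtopology (prod_topology (gtop G) (etop S)) {(\<gamma>, e). gdom G \<gamma> = proj S e})
      (etop S) (\<lambda>(\<gamma>, e). act S \<gamma> e)"
    and act_unit: "e \<in> topspace (etop S) \<Longrightarrow> act S (proj S e) e = e"
    and proj_act: "\<gamma> \<in> arrows G \<Longrightarrow> e \<in> topspace (etop S) \<Longrightarrow> gdom G \<gamma> = proj S e \<Longrightarrow>
      proj S (act S \<gamma> e) = grng G \<gamma>"
    and act_act: "(\<beta>, \<gamma>) \<in> composable G \<Longrightarrow> e \<in> topspace (etop S) \<Longrightarrow> gdom G \<gamma> = proj S e \<Longrightarrow>
      act S \<beta> (act S \<gamma> e) = act S (gmult G \<beta> \<gamma>) e"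

text \<open>The stalks are disjoint, so a single addition and a single multiplication on the total
  space carry the operations of all stalks; only the values at pairs of points in a common stalk
  matter.\<close>

record ('g, 'e) gsheaf_rings = "('g, 'e) gsheaf" +
  eadd :: "'e \<Rightarrow> 'e \<Rightarrow> 'e"
  emult :: "'e \<Rightarrow> 'e \<Rightarrow> 'e"
  ezero :: "'g \<Rightarrow> 'e"
  eone :: "'g \<Rightarrow> 'e"

definition stalk :: "('g, 'e, 'n) gsheaf_rings_scheme \<Rightarrow> 'g \<Rightarrow> 'e ring" where
  "stalk S x = \<lparr>carrier = {e \<in> topspace (etop S). proj S e = x},
     mult = emult S, one = eone S x, zero = ezero S x, add = eadd S\<rparr>"

definition fibre_square :: "('g, 'e, 'n) gsheaf_rings_scheme \<Rightarrow> ('e \<times> 'e) topology" where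
  "fibre_square S =
     subtopology (prod_topology (etop S) (etop S)) {(a, b). proj S a = proj S b}"

locale groupoid_sheaf_of_rings = groupoid_sheaf G S
  for G :: "('g, 'm) top_groupoid_scheme" and S :: "('g, 'e, 'n) gsheaf_rings_scheme" +
  assumes stalk_ring: "x \<in> units G \<Longrightarrow> ring (stalk S x)"
    and add_continuous: "continuous_map (fibre_square S) (etop S) (\<lambda>(a, b). eadd S a b)"
    and mult_continuous: "continuous_map (fibre_square S) (etop S) (\<lambda>(a, b). emult S a b)"
    and one_continuous: "continuous_map (unit_space G) (etop S) (eone S)"
    and act_ring_hom: "\<gamma> \<in> arrows G \<Longrightarrow>
      act S \<gamma> \<in> ring_hom (stalk S (gdom G \<gamma>)) (stalk S (grng G \<gamma>))"


section \<open>The convolution ring\<close>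

text \<open>The additive group of all, possibly discontinuous, maps from the arrows to the total space
  over the range map, written as a monoid so that \<open>generate\<close> applies.
  Maps are \<open>undefined\<close> outside the set of arrows.\<close>

definition section_group ::
    "('g, 'm) top_groupoid_scheme \<Rightarrow> ('g, 'e, 'n) gsheaf_rings_scheme \<Rightarrow> ('g \<Rightarrow> 'e) monoid" where
  "section_group G S =
     \<lparr>carrier = (\<Pi>\<^sub>E \<gamma>\<in>arrows G. carrier (stalk S (grng G \<gamma>))),
      mult = (\<lambda>f g. \<lambda>\<gamma>\<in>arrows G. f \<gamma> \<oplus>\<^bsub>stalk S (grng G \<gamma>)\<^esub> g \<gamma>),
      one = (\<lambda>\<gamma>\<in>arrows G. \<zero>\<^bsub>stalk S (grng G \<gamma>)\<^esub>)\<rparr>"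

definition Gamma_c_generators ::
    "('g, 'm) top_groupoid_scheme \<Rightarrow> ('g, 'e, 'n) gsheaf_rings_scheme \<Rightarrow> ('g \<Rightarrow> 'e) set" where
  "Gamma_c_generators G S = {f \<in> carrier (section_group G S).
     \<exists>U. compact_open (gtop G) U \<and> bisection G U \<and>
       continuous_map (subtopology (gtop G) U) (etop S) f \<and>
       (\<forall>\<gamma>\<in>arrows G - U. f \<gamma> = \<zero>\<^bsub>stalk S (grng G \<gamma>)\<^esub>)}"

text \<open>The sum runs over the nonzero terms only, since \<open>finsum\<close> is zero
  on infinite index sets. For elements of \<open>Gamma_c\<close> there are finitely many such terms.\<close>

definition convolution :: "('g, 'm) top_groupoid_scheme \<Rightarrow> ('g, 'e, 'n) gsheaf_rings_scheme \<Rightarrow>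
    ('g \<Rightarrow> 'e) \<Rightarrow> ('g \<Rightarrow> 'e) \<Rightarrow> 'g \<Rightarrow> 'e" where
  "convolution G S f g = (\<lambda>\<gamma>\<in>arrows G.
     finsum (stalk S (grng G \<gamma>))
       (\<lambda>(\<beta>, \<rho>). f \<beta> \<otimes>\<^bsub>stalk S (grng G \<gamma>)\<^esub> act S \<beta> (g \<rho>))
       {(\<beta>, \<rho>) \<in> composable G. gmult G \<beta> \<rho> = \<gamma> \<and>
         f \<beta> \<otimes>\<^bsub>stalk S (grng G \<gamma>)\<^esub> act S \<beta> (g \<rho>) \<noteq> \<zero>\<^bsub>stalk S (grng G \<gamma>)\<^esub>})"

text \<open>This ring has no identity in general: the \<open>one\<close> component is a dummy.\<close>

definition Gamma_c ::
    "('g, 'm) top_groupoid_scheme \<Rightarrow> ('g, 'e, 'n) gsheaf_rings_scheme \<Rightarrow> ('g \<Rightarrow> 'e) ring" where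
  "Gamma_c G S =
     \<lparr>carrier = generate (section_group G S) (Gamma_c_generators G S),
      mult = convolution G S,
      one = undefined,
      zero = one (section_group G S),
      add = mult (section_group G S)\<rparr>"

definition orbit_detects_zero ::
    "('g, 'm) top_groupoid_scheme \<Rightarrow> ('g, 'e, 'n) gsheaf_rings_scheme \<Rightarrow> 'g \<Rightarrow> bool" where
  "orbit_detects_zero G S x \<longleftrightarrow>
     (\<forall>f\<in>carrier (Gamma_c G S).
        (\<forall>\<gamma>\<in>arrows G. gdom G \<gamma> \<in> orbit G x \<longrightarrow> f \<gamma> = \<zero>\<^bsub>stalk S (grng G \<gamma>)\<^esub>) \<longrightarrow>
        f = \<zero>\<^bsub>Gamma_c G S\<^esub>)"



section \<open>The skew group ring of the isotropy group at a unit\<close>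

text \<open>The formal sum of the \<open>b\<^sub>\<delta> \<delta>\<close> is the finitely supported function
  \<open>\<delta> \<mapsto> b\<^sub>\<delta>\<close> on the isotropy group (\<open>undefined\<close> elsewhere); the product
  is the biadditive extension of \<open>(b \<delta>) (c \<eta>) = (b \<alpha>\<^sub>\<delta>(c)) (\<delta> \<eta>)\<close>.\<close>

definition skew_group_ring ::
    "('g, 'm) top_groupoid_scheme \<Rightarrow> ('g, 'e, 'n) gsheaf_rings_scheme \<Rightarrow> 'g \<Rightarrow> ('g \<Rightarrow> 'e) ring" where
  "skew_group_ring G S x =
     \<lparr>carrier = {a \<in> isotropy G x \<rightarrow>\<^sub>E carrier (stalk S x).
        finite {\<delta> \<in> isotropy G x. a \<delta> \<noteq> \<zero>\<^bsub>stalk S x\<^esub>}},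
      mult = (\<lambda>a b. \<lambda>\<epsilon>\<in>isotropy G x.
        finsum (stalk S x) (\<lambda>(\<delta>, \<eta>). a \<delta> \<otimes>\<^bsub>stalk S x\<^esub> act S \<delta> (b \<eta>))
          {(\<delta>, \<eta>) \<in> isotropy G x \<times> isotropy G x. gmult G \<delta> \<eta> = \<epsilon> \<and>
            a \<delta> \<noteq> \<zero>\<^bsub>stalk S x\<^esub> \<and> b \<eta> \<noteq> \<zero>\<^bsub>stalk S x\<^esub>}),
      one = (\<lambda>\<delta>\<in>isotropy G x. if \<delta> = x then \<one>\<^bsub>stalk S x\<^esub> else \<zero>\<^bsub>stalk S x\<^esub>),
      zero = (\<lambda>\<delta>\<in>isotropy G x. \<zero>\<^bsub>stalk S x\<^esub>),
      add = (\<lambda>a b. \<lambda>\<delta>\<in>isotropy G x. a \<delta> \<oplus>\<^bsub>stalk S x\<^esub> b \<delta>)\<rparr>"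


section \<open>Left primitive rings\<close>

text \<open>Modules over rings that are neither commutative nor unital. The
  \<open>one\<close> of the ring, and the \<open>mult\<close> and \<open>one\<close> of
  the module record, are ignored.\<close>

definition left_module :: "('r, 'k) ring_scheme \<Rightarrow> ('r, 'n, 'l) module_scheme \<Rightarrow> bool" where
  "left_module R N \<longleftrightarrow> abelian_group N \<and>
     (\<forall>a\<in>carrier R. \<forall>u\<in>carrier N. a \<odot>\<^bsub>N\<^esub> u \<in> carrier N) \<and>
     (\<forall>a\<in>carrier R. \<forall>b\<in>carrier R. \<forall>u\<in>carrier N.
        (a \<oplus>\<^bsub>R\<^esub> b) \<odot>\<^bsub>N\<^esub> u = a \<odot>\<^bsub>N\<^esub> u \<oplus>\<^bsub>N\<^esub> b \<odot>\<^bsub>N\<^esub> u) \<and>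
     (\<forall>a\<in>carrier R. \<forall>u\<in>carrier N. \<forall>v\<in>carrier N.
        a \<odot>\<^bsub>N\<^esub> (u \<oplus>\<^bsub>N\<^esub> v) = a \<odot>\<^bsub>N\<^esub> u \<oplus>\<^bsub>N\<^esub> a \<odot>\<^bsub>N\<^esub> v) \<and>
     (\<forall>a\<in>carrier R. \<forall>b\<in>carrier R. \<forall>u\<in>carrier N.
        (a \<otimes>\<^bsub>R\<^esub> b) \<odot>\<^bsub>N\<^esub> u = a \<odot>\<^bsub>N\<^esub> (b \<odot>\<^bsub>N\<^esub> u))"

definition simple_left_module :: "('r, 'k) ring_scheme \<Rightarrow> ('r, 'n, 'l) module_scheme \<Rightarrow> bool" where
  "simple_left_module R N \<longleftrightarrow> left_module R N \<and>
     (\<exists>a\<in>carrier R. \<exists>u\<in>carrier N. a \<odot>\<^bsub>N\<^esub> u \<noteq> \<zero>\<^bsub>N\<^esub>) \<and>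
     (\<forall>H. submodule H R N \<longrightarrow> H = {\<zero>\<^bsub>N\<^esub>} \<or> H = carrier N)"

definition faithful_left_module :: "('r, 'k) ring_scheme \<Rightarrow> ('r, 'n, 'l) module_scheme \<Rightarrow> bool" where
  "faithful_left_module R N \<longleftrightarrow> left_module R N \<and>
     (\<forall>a\<in>carrier R. (\<forall>u\<in>carrier N. a \<odot>\<^bsub>N\<^esub> u = \<zero>\<^bsub>N\<^esub>) \<longrightarrow> a = \<zero>\<^bsub>R\<^esub>)"

text \<open>The module ranges over all modules whose carrier consists of sets of ring elements, as in a
  quotient of the ring by a left ideal. Every simple module is isomorphic to such a
  quotient, so this is no restriction: see \<open>left_primitiveI\<close>, where
  the carrier type is arbitrary.\<close>

definition left_primitive :: "('r, 'k) ring_scheme \<Rightarrow> bool" where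
  "left_primitive R \<longleftrightarrow>
     (\<exists>N :: ('r, 'r set) module. simple_left_module R N \<and> faithful_left_module R N)"

lemma simple_left_module_cyclic:
  assumes R: "abelian_group R" and R_mult: "\<And>a b. a \<in> carrier R \<Longrightarrow> b \<in> carrier R \<Longrightarrow> a \<otimes>\<^bsub>R\<^esub> b \<in> carrier R"
    and N: "simple_left_module R N"
  obtains u where "u \<in> carrier N" "carrier N = (\<lambda>a. a \<odot>\<^bsub>N\<^esub> u) ` carrier R"
proof -
  interpret R: abelian_group R by fact
  have M: "left_module R N" using N by (simp add: simple_left_module_def)
  interpret N: abelian_group N using M by (simp add: left_module_def)
  have cl: "a \<odot>\<^bsub>N\<^esub> u \<in> carrier N" if "a \<in> carrier R" "u \<in> carrier N" for a u
    using M that by (simp add: left_module_def)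
  have ld: "(a \<oplus>\<^bsub>R\<^esub> b) \<odot>\<^bsub>N\<^esub> u = a \<odot>\<^bsub>N\<^esub> u \<oplus>\<^bsub>N\<^esub> b \<odot>\<^bsub>N\<^esub> u"
    if "a \<in> carrier R" "b \<in> carrier R" "u \<in> carrier N" for a b u
    using M that by (simp add: left_module_def)
  have as: "(a \<otimes>\<^bsub>R\<^esub> b) \<odot>\<^bsub>N\<^esub> u = a \<odot>\<^bsub>N\<^esub> (b \<odot>\<^bsub>N\<^esub> u)"
    if "a \<in> carrier R" "b \<in> carrier R" "u \<in> carrier N" for a b u
    using M that by (simp add: left_module_def)
  obtain a u where au: "a \<in> carrier R" "u \<in> carrier N" "a \<odot>\<^bsub>N\<^esub> u \<noteq> \<zero>\<^bsub>N\<^esub>"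
    using N by (auto simp: simple_left_module_def)
  let ?H = "(\<lambda>a. a \<odot>\<^bsub>N\<^esub> u) ` carrier R"
  have z: "\<zero>\<^bsub>R\<^esub> \<odot>\<^bsub>N\<^esub> u = \<zero>\<^bsub>N\<^esub>"
    using ld[of "\<zero>\<^bsub>R\<^esub>" "\<zero>\<^bsub>R\<^esub>" u] cl[of "\<zero>\<^bsub>R\<^esub>" u] au
    by (metis N.add.l_cancel_one' R.r_zero R.zero_closed)
  have neg: "\<ominus>\<^bsub>N\<^esub> (b \<odot>\<^bsub>N\<^esub> u) = (\<ominus>\<^bsub>R\<^esub> b) \<odot>\<^bsub>N\<^esub> u" if "b \<in> carrier R" for b
    using ld[of "\<ominus>\<^bsub>R\<^esub> b" b u] z that au cl
    by (metis N.minus_equality R.a_inv_closed R.l_neg)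
  have "submodule ?H R N"
  proof (unfold_locales)
    show "?H \<subseteq> carrier (add_monoid N)" using cl au by auto
    show "x \<otimes>\<^bsub>add_monoid N\<^esub> y \<in> ?H" if xy: "x \<in> ?H" "y \<in> ?H" for x y
    proof -
      obtain b c where bc: "b \<in> carrier R" "c \<in> carrier R" "x = b \<odot>\<^bsub>N\<^esub> u" "y = c \<odot>\<^bsub>N\<^esub> u"
        using xy by auto
      then have "x \<oplus>\<^bsub>N\<^esub> y = (b \<oplus>\<^bsub>R\<^esub> c) \<odot>\<^bsub>N\<^esub> u" using ld au by simp
      then show ?thesis using bc by auto
    qed
    show "\<one>\<^bsub>add_monoid N\<^esub> \<in> ?H" using z by (auto intro!: image_eqI[of _ _ "\<zero>\<^bsub>R\<^esub>"])
    show "inv\<^bsub>add_monoid N\<^esub> x \<in> ?H" if "x \<in> ?H" for x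
      using that neg by (auto simp: a_inv_def[symmetric])
    show "b \<odot>\<^bsub>N\<^esub> x \<in> ?H" if b: "b \<in> carrier R" "x \<in> ?H" for b x
    proof -
      obtain c where "c \<in> carrier R" "x = c \<odot>\<^bsub>N\<^esub> u" using b by auto
      then show ?thesis using as[of b c u] b au R_mult by (auto intro!: image_eqI[of _ _ "b \<otimes>\<^bsub>R\<^esub> c"])
    qed
  qed
  then have "?H = {\<zero>\<^bsub>N\<^esub>} \<or> ?H = carrier N"
    using N by (simp add: simple_left_module_def)
  then have "carrier N = ?H" using au by blast
  then show ?thesis using that au by blast
qed

lemma left_primitiveI:
  fixes N :: "('r, 'n, 'l) module_scheme"
  assumes R: "abelian_group R" and R_mult: "\<And>a b. a \<in> carrier R \<Longrightarrow> b \<in> carrier R \<Longrightarrow> a \<otimes>\<^bsub>R\<^esub> b \<in> carrier R"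
    and simple: "simple_left_module R N" and faithful: "faithful_left_module R N"
  shows "left_primitive R"
proof -
  obtain u where u: "u \<in> carrier N" "carrier N = (\<lambda>a. a \<odot>\<^bsub>N\<^esub> u) ` carrier R"
    using simple_left_module_cyclic[OF R R_mult simple] by blast
  define \<phi> where "\<phi> y = {a \<in> carrier R. a \<odot>\<^bsub>N\<^esub> u = y}" for y
  have inj: "inj_on \<phi> (carrier N)"
  proof (rule inj_onI)
    fix y z assume *: "y \<in> carrier N" "z \<in> carrier N" "\<phi> y = \<phi> z"
    then obtain a where a: "a \<in> carrier R" "y = a \<odot>\<^bsub>N\<^esub> u" using u(2) by auto
    then have "a \<in> \<phi> z" using *(3) by (auto simp: \<phi>_def)
    then show "y = z" using a by (simp add: \<phi>_def)
  qed
  define \<psi> where "\<psi> = inv_into (carrier N) \<phi>"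
  have \<psi>[simp]: "\<psi> (\<phi> y) = y" if "y \<in> carrier N" for y
    using inj that by (simp add: \<psi>_def)
  have M: "left_module R N" using simple by (simp add: simple_left_module_def)
  interpret N: abelian_group N using M by (simp add: left_module_def)
  have cl[simp]: "a \<odot>\<^bsub>N\<^esub> u \<in> carrier N" if "a \<in> carrier R" "u \<in> carrier N" for a u
    using M that by (simp add: left_module_def)
  define N' :: "('r, 'r set) module" where "N' =
    \<lparr>carrier = \<phi> ` carrier N, mult = undefined, one = undefined, zero = \<phi> \<zero>\<^bsub>N\<^esub>,
     add = (\<lambda>x y. \<phi> (\<psi> x \<oplus>\<^bsub>N\<^esub> \<psi> y)), smult = (\<lambda>a x. \<phi> (a \<odot>\<^bsub>N\<^esub> \<psi> x))\<rparr>"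
  have N'[simp]: "carrier N' = \<phi> ` carrier N" "\<zero>\<^bsub>N'\<^esub> = \<phi> \<zero>\<^bsub>N\<^esub>"
    "x \<oplus>\<^bsub>N'\<^esub> y = \<phi> (\<psi> x \<oplus>\<^bsub>N\<^esub> \<psi> y)" "a \<odot>\<^bsub>N'\<^esub> x = \<phi> (a \<odot>\<^bsub>N\<^esub> \<psi> x)" for a x y
    by (simp_all add: N'_def)
  have "abelian_group N'"
  proof (rule abelian_groupI)
    fix x assume "x \<in> carrier N'"
    then obtain y where y: "y \<in> carrier N" "x = \<phi> y" by auto
    then show "\<exists>z\<in>carrier N'. z \<oplus>\<^bsub>N'\<^esub> x = \<zero>\<^bsub>N'\<^esub>"
      by (auto intro!: bexI[of _ "\<ominus>\<^bsub>N\<^esub> y"] simp: N.l_neg)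
  qed (auto simp: N.a_ac)
  interpret N': abelian_group N' by fact
  have M': "left_module R N'"
    using M \<open>abelian_group N'\<close> by (auto simp: left_module_def)
  have \<phi>_eq: "\<phi> y = \<phi> z \<longleftrightarrow> y = z" if "y \<in> carrier N" "z \<in> carrier N" for y z
    using inj that by (auto dest: inj_onD)
  have neg: "\<ominus>\<^bsub>N'\<^esub> (\<phi> y) = \<phi> (\<ominus>\<^bsub>N\<^esub> y)" if "y \<in> carrier N" for y
    using that by (intro N'.minus_equality) (auto simp: N.l_neg)
  have "simple_left_module R N'"
    unfolding simple_left_module_def
  proof (intro conjI allI impI)
    show "left_module R N'" by fact
    show "\<exists>a\<in>carrier R. \<exists>u\<in>carrier N'. a \<odot>\<^bsub>N'\<^esub> u \<noteq> \<zero>\<^bsub>N'\<^esub>"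
      using simple \<phi>_eq by (auto simp: simple_left_module_def)
  next
    fix H assume "submodule H R N'"
    then interpret H: submodule H R N' .
    have sub: "H \<subseteq> \<phi> ` carrier N" using H.subset by simp
    let ?K = "\<psi> ` H"
    have K: "y \<in> ?K \<longleftrightarrow> y \<in> carrier N \<and> \<phi> y \<in> H" for y
      using sub by (force simp: image_iff)
    have "submodule ?K R N"
    proof (unfold_locales)
      show "?K \<subseteq> carrier (add_monoid N)" using K by auto
      show "x \<otimes>\<^bsub>add_monoid N\<^esub> y \<in> ?K" if "x \<in> ?K" "y \<in> ?K" for x y
        using that H.m_closed[of "\<phi> x" "\<phi> y"] unfolding K by simp
      show "\<one>\<^bsub>add_monoid N\<^esub> \<in> ?K" using H.one_closed unfolding K by simp
      show "inv\<^bsub>add_monoid N\<^esub> x \<in> ?K" if "x \<in> ?K" for x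
        using that H.m_inv_closed[of "\<phi> x"] neg unfolding K a_inv_def[symmetric] by simp
      show "a \<odot>\<^bsub>N\<^esub> x \<in> ?K" if "a \<in> carrier R" "x \<in> ?K" for a x
        using that H.smult_closed[of a "\<phi> x"] unfolding K by simp
    qed
    then have "?K = {\<zero>\<^bsub>N\<^esub>} \<or> ?K = carrier N"
      using simple by (simp add: simple_left_module_def)
    moreover have "H = \<phi> ` ?K" using sub by (force simp: image_iff)
    ultimately show "H = {\<zero>\<^bsub>N'\<^esub>} \<or> H = carrier N'" by auto
  qed
  moreover have "faithful_left_module R N'"
    using faithful M' \<phi>_eq by (auto simp: faithful_left_module_def)
  ultimately show ?thesis unfolding left_primitive_def by blast
qed

end

theory Submission
  imports Defs "HOL-Algebra.Product_Groups"
begin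

text \<open>
  (1) Let \<open>N\<close> be a faithful simple module, and let \<open>N(T)\<close>, for an invariant set \<open>T\<close> of units, consist of
  the \<open>u\<close> such that every \<open>y \<in> T\<close> has a compact open neighbourhood \<open>W\<close> with \<open>1\<^sub>W u = 0\<close>.
  These are the sections vanishing on \<open>T\<close>, if \<open>N\<close> is viewed as the module of compactly supported
  sections of a sheaf. An element of \<open>\<Gamma>\<close> that vanishes on \<open>r\<^sup>-\<^sup>1(y)\<close> vanishes on
  \<open>r\<^sup>-\<^sup>1(W)\<close> for some neighbourhood \<open>W\<close> of \<open>y\<close>; consequently \<open>N(T)\<close> is a submodule, and it contains
  \<open>f N\<close> whenever \<open>f\<close> vanishes on \<open>d\<^sup>-\<^sup>1(T)\<close>. For the set of all units \<open>N(T)\<close> is proper, hence \<open>0\<close>, so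
  \<open>N(Orb(x))\<close> is proper, hence \<open>0\<close>, for some \<open>x\<close>, and faithfulness gives the claim.

  (2) Choosing an arrow from \<open>x\<close> to each point of its orbit turns the restriction of \<open>f \<in> \<Gamma>\<close> to
  \<open>d\<^sup>-\<^sup>1(Orb(x))\<close> into a row- and column-finite matrix over \<open>B\<^sub>x\<close>, multiplicatively. So \<open>\<Gamma>\<close> acts on the
  finitely supported functions from the orbit to a faithful simple \<open>B\<^sub>x\<close>-module. The action is faithful
  by hypothesis, and simple because elements of \<open>\<Gamma>\<close> can be prescribed arbitrarily on finitely many arrows
  over a finite set of units.
\<close>


section \<open>Local homeomorphisms\<close>

text \<open>The arrows need not form a Hausdorff space: a compact open bisection need not be closed,
  so it is not evident that an element of \<Gamma> vanishing on \<open>r\<^sup>-\<^sup>1(y)\<close>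
  also vanishes over a neighbourhood of \<open>y\<close>. Two facts compensate. The unit space is
  Hausdorff. Hence compact sets of units are closed, differences of compact open sets of units are
  again compact open, and the idempotents \<open>one_on W\<close> can serve as local units in place
  of an identity of \<Gamma>. Moreover a generator follows, near \<open>y\<close>, the local section
  of the sheaf through its only possible nonzero value over \<open>y\<close>. This description
  survives differences once it is phrased as a sum over every sufficiently large finite set of
  arrows over \<open>y\<close>. In (2), injectivity of \<open>r\<close> on bisections makes rows
  finite, so that matrix products exist; injectivity of \<open>d\<close> makes columns finite, so
  that finitely supported vectors stay finitely supported.\<close>

lemma local_homeomorphism_imp_continuous_map:
  assumes "local_homeomorphism X Y f"
  shows "continuous_map X Y f"
  unfolding continuous_map_def
proof (intro conjI allI impI)
  have loc: "\<exists>U. openin X U \<and> x \<in> U \<and> openin Y (f ` U) \<and> continuous_map (subtopology X U) Y f"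
    if "x \<in> topspace X" for x
    using assms that homeomorphic_imp_continuous_map
    by (metis continuous_map_into_fulltopology local_homeomorphism_def)
  show "f \<in> topspace X \<rightarrow> topspace Y"
  proof
    fix x assume "x \<in> topspace X"
    then show "f x \<in> topspace Y" using loc openin_subset by blast
  qed
  fix V assume V: "openin Y V"
  show "openin X {x \<in> topspace X. f x \<in> V}"
    unfolding openin_subopen[of X "{x \<in> topspace X. f x \<in> V}"]
  proof
    fix x assume x: "x \<in> {x \<in> topspace X. f x \<in> V}"
    then obtain U where U: "openin X U" "x \<in> U" "continuous_map (subtopology X U) Y f"
      using loc by blast
    have "openin (subtopology X U) {x \<in> topspace (subtopology X U). f x \<in> V}"
      using U(3) V by (rule openin_continuous_map_preimage)
    then have "openin X {x \<in> topspace (subtopology X U). f x \<in> V}"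
      using U(1) openin_trans_full by blast
    then show "\<exists>T. openin X T \<and> x \<in> T \<and> T \<subseteq> {x \<in> topspace X. f x \<in> V}"
      using x U(2) by (intro exI[of _ "{x \<in> topspace (subtopology X U). f x \<in> V}"]) auto
  qed
qed

lemma local_homeomorphism_imp_open_map:
  assumes "local_homeomorphism X Y f"
  shows "open_map X Y f"
  unfolding open_map_def
proof (intro allI impI)
  fix V assume V: "openin X V"
  show "openin Y (f ` V)"
    unfolding openin_subopen[of Y "f ` V"]
  proof
    fix y assume "y \<in> f ` V"
    then obtain x where x: "x \<in> V" "y = f x" by blast
    then have "x \<in> topspace X" using V openin_subset by blast
    then obtain U where U: "openin X U" "x \<in> U" "openin Y (f ` U)"
        "open_map (subtopology X U) (subtopology Y (f ` U)) f"
      using assms homeomorphic_imp_open_map unfolding local_homeomorphism_def by metis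
    have "openin (subtopology X U) (U \<inter> V)" by (simp add: V openin_subtopology_Int2)
    then have "openin Y (f ` (U \<inter> V))"
      using U(3,4) unfolding open_map_def by (meson openin_trans_full)
    then show "\<exists>T. openin Y T \<and> y \<in> T \<and> T \<subseteq> f ` V"
      using x U(2) by (intro exI[of _ "f ` (U \<inter> V)"]) auto
  qed
qed

text \<open>On an open set where it is injective, \<open>f\<close> is a continuous open bijection
  onto its image, hence a homeomorphism; \<open>U\<close> need not be one of the sets supplied by
  the definition. All continuous local inverses of \<open>r\<close> and of \<open>proj S\<close>
  come from here.\<close>

lemma local_homeomorphism_inverse_continuous:
  assumes f: "local_homeomorphism X Y f" and U: "openin X U" and inj: "inj_on f U"
  shows "continuous_map (subtopology Y (f ` U)) X (inv_into U f)"
proof -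
  have fU: "openin Y (f ` U)" using local_homeomorphism_imp_open_map[OF f] U by (simp add: open_map_def)
  have top: "topspace (subtopology X U) = U" "topspace (subtopology Y (f ` U)) = f ` U"
    using openin_subset[OF U] openin_subset[OF fU] by (simp_all add: inf.absorb2)
  have "homeomorphic_map (subtopology X U) (subtopology Y (f ` U)) f"
    using f inj U top local_homeomorphism_imp_open_map[OF f] local_homeomorphism_imp_continuous_map[OF f]
    by (intro bijective_open_imp_homeomorphic_map continuous_map_into_subtopology
        continuous_map_from_subtopology open_map_into_subtopology open_map_from_subtopology) auto
  then obtain g where g: "homeomorphic_maps (subtopology X U) (subtopology Y (f ` U)) f g"
    using homeomorphic_map_maps by blast
  then have "continuous_map (subtopology Y (f ` U)) X g"
    unfolding homeomorphic_maps_def continuous_map_in_subtopology by blast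
  moreover have "g y = inv_into U f y" if "y \<in> f ` U" for y
    using g that inj top unfolding homeomorphic_maps_def by (auto simp: inv_into_f_f)
  ultimately show ?thesis using top by (auto intro: continuous_map_eq)
qed

lemma local_homeomorphism_injective_nbhd:
  assumes "local_homeomorphism X Y f" "x \<in> topspace X"
  obtains U where "openin X U" "x \<in> U" "inj_on f U"
proof -
  obtain U where U: "openin X U" "x \<in> U"
      "homeomorphic_map (subtopology X U) (subtopology Y (f ` U)) f"
    using assms unfolding local_homeomorphism_def by blast
  then have "inj_on f U"
    using homeomorphic_imp_injective_map[OF U(3)] openin_subset[OF U(1)]
    by (simp add: inf.absorb2)
  then show ?thesis using U that by blast
qed

text \<open>The continuous inverse of \<open>f\<close> on \<open>U\<close> carries \<open>K\<close>
  onto this set. This is how compact sets of arrows are produced from compact sets of units.\<close>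

lemma compactin_homeomorphic_image:
  assumes "local_homeomorphism X Y f" "openin X U" "inj_on f U" "compactin Y K" "K \<subseteq> f ` U"
  shows "compactin X {x \<in> U. f x \<in> K}"
proof -
  have "compactin X (inv_into U f ` K)"
    using local_homeomorphism_inverse_continuous[OF assms(1-3)] assms(4,5)
    by (intro image_compactin) (auto simp: compactin_subtopology)
  moreover have "inv_into U f ` K = {x \<in> U. f x \<in> K}"
  proof (intro equalityI subsetI)
    fix x assume "x \<in> inv_into U f ` K"
    then show "x \<in> {x \<in> U. f x \<in> K}"
      using assms(5) by (auto simp: inv_into_into f_inv_into_f subset_iff)
  next
    fix x assume "x \<in> {x \<in> U. f x \<in> K}"
    then show "x \<in> inv_into U f ` K"
      using assms(3) by (auto intro!: image_eqI[of _ _ "f x"])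
  qed
  ultimately show ?thesis by simp
qed

text \<open>Near the common value \<open>p\<close> is injective, and by continuity both sections
  stay in that neighbourhood for \<open>z\<close> close to \<open>y\<close>; as both lie over
  \<open>z\<close>, they coincide. No separation property of \<open>E\<close> enters.\<close>

lemma sections_agree_locally:
  assumes p: "local_homeomorphism E Y p"
    and W: "openin Y W" "y \<in> W"
    and s: "continuous_map (subtopology Y W) E s" "\<And>z. z \<in> W \<Longrightarrow> p (s z) = z"
    and t: "continuous_map (subtopology Y W) E t" "\<And>z. z \<in> W \<Longrightarrow> p (t z) = z"
    and eq: "s y = t y"
  obtains W' where "openin Y W'" "y \<in> W'" "W' \<subseteq> W" "\<And>z. z \<in> W' \<Longrightarrow> s z = t z"
proof -
  have top: "topspace (subtopology Y W) = W" using W(1) openin_subset by force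
  have "s y \<in> topspace E" using s(1) W(2) top unfolding continuous_map_def by blast
  then obtain U where U: "openin E U" "s y \<in> U" "inj_on p U"
    using local_homeomorphism_injective_nbhd[OF p] by blast
  let ?W' = "{z \<in> W. s z \<in> U} \<inter> {z \<in> W. t z \<in> U}"
  have "openin (subtopology Y W) ?W'"
    using openin_continuous_map_preimage[OF s(1) U(1)] openin_continuous_map_preimage[OF t(1) U(1)]
    unfolding top by blast
  then have "openin Y ?W'" using W(1) openin_trans_full by blast
  moreover have "s z = t z" if "z \<in> ?W'" for z
    using inj_onD[OF U(3), of "s z" "t z"] that s(2)[of z] t(2)[of z] by simp
  moreover have "y \<in> ?W'" using W(2) U(2) eq by simp
  ultimately show ?thesis using that[of ?W'] by blast
qed


section \<open>Ample groupoids\<close>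

context groupoid
begin

abbreviation r :: "'g \<Rightarrow> 'g"
  where "r \<equiv> grng G"

abbreviation d :: "'g \<Rightarrow> 'g"
  where "d \<equiv> gdom G"

abbreviation ldiv :: "'g \<Rightarrow> 'g \<Rightarrow> 'g"
  where "ldiv \<beta> \<equiv> gmult G (ginv G \<beta>)"

lemma composable_iff [simp]:
  "(\<beta>, \<gamma>) \<in> composable G \<longleftrightarrow> \<beta> \<in> arrows G \<and> \<gamma> \<in> arrows G \<and> d \<beta> = r \<gamma>"
  by (simp add: composable_def)

lemma dom_in_units [simp]: "\<gamma> \<in> arrows G \<Longrightarrow> d \<gamma> \<in> units G"
  by (simp add: units_def)

lemma rng_in_units [simp]: "\<gamma> \<in> arrows G \<Longrightarrow> r \<gamma> \<in> units G"
  using dom_in_units[of "ginv G \<gamma>"] by (simp add: dom_inv inv_closed)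

lemmas [simp] = mult_closed dom_mult rng_mult inv_closed dom_inv rng_inv mult_dom rng_mult_self

lemma units_arrows: "x \<in> units G \<Longrightarrow> x \<in> arrows G"
proof -
  assume "x \<in> units G"
  then obtain \<gamma> where \<gamma>: "\<gamma> \<in> arrows G" "x = d \<gamma>" by (auto simp: units_def)
  then have "ldiv \<gamma> \<gamma> \<in> arrows G" by (intro mult_closed) simp
  then show ?thesis using \<gamma> by (simp add: gdom_def)
qed

lemma units_dom_rng: "x \<in> units G \<Longrightarrow> d x = x \<and> r x = x"
proof -
  assume "x \<in> units G"
  then obtain \<gamma> where \<gamma>: "\<gamma> \<in> arrows G" "x = ldiv \<gamma> \<gamma>"
    by (auto simp: units_def gdom_def)
  then have "d x = d \<gamma>" "r x = d \<gamma>" by simp_all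
  then show ?thesis using \<gamma> by (simp add: gdom_def)
qed

lemma units_simps [simp]:
  "x \<in> units G \<Longrightarrow> x \<in> arrows G" "x \<in> units G \<Longrightarrow> d x = x" "x \<in> units G \<Longrightarrow> r x = x"
  using units_arrows units_dom_rng by auto

lemma mult_unit: "\<gamma> \<in> arrows G \<Longrightarrow> x = d \<gamma> \<Longrightarrow> gmult G \<gamma> x = \<gamma>"
  by simp_all

lemma inv_mult_self: "\<gamma> \<in> arrows G \<Longrightarrow> ldiv \<gamma> \<gamma> = d \<gamma>"
  and mult_inv_self: "\<gamma> \<in> arrows G \<Longrightarrow> gmult G \<gamma> (ginv G \<gamma>) = r \<gamma>"
  by (simp_all add: gdom_def grng_def)

lemma inv_mult_cancel [simp]:
  "\<beta> \<in> arrows G \<Longrightarrow> \<gamma> \<in> arrows G \<Longrightarrow> d \<beta> = r \<gamma> \<Longrightarrow> ldiv \<beta> (gmult G \<beta> \<gamma>) = \<gamma>"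
  by (subst mult_assoc[symmetric]) (simp_all add: inv_mult_self)

lemma mult_inv_cancel [simp]:
  "\<beta> \<in> arrows G \<Longrightarrow> \<gamma> \<in> arrows G \<Longrightarrow> r \<beta> = r \<gamma> \<Longrightarrow> gmult G \<beta> (ldiv \<beta> \<gamma>) = \<gamma>"
  by (subst mult_assoc[symmetric]) (simp_all add: mult_inv_self)

lemma inv_inv [simp]: "\<gamma> \<in> arrows G \<Longrightarrow> ginv G (ginv G \<gamma>) = \<gamma>"
proof -
  assume \<gamma>: "\<gamma> \<in> arrows G"
  then have "ldiv (ginv G \<gamma>) (ldiv \<gamma> \<gamma>) = \<gamma>"
    by (intro inv_mult_cancel) simp_all
  moreover have "ldiv (ginv G \<gamma>) (d \<gamma>) = ginv G (ginv G \<gamma>)"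
    using \<gamma> by (intro mult_unit) simp_all
  ultimately show ?thesis using \<gamma> by (simp add: inv_mult_self)
qed

lemma unit_inv [simp]: "x \<in> units G \<Longrightarrow> ginv G x = x"
  using inv_mult_self[of x] mult_unit[of "ginv G x" x] by simp

lemma orbit_eq: "orbit G x = {y. \<exists>\<gamma>\<in>arrows G. d \<gamma> = x \<and> r \<gamma> = y}"
  by (auto simp: orbit_def)

lemma orbit_units: "y \<in> orbit G x \<Longrightarrow> y \<in> units G"
  by (auto simp: orbit_eq)

lemma orbit_self: "x \<in> units G \<Longrightarrow> x \<in> orbit G x"
  by (auto simp: orbit_eq intro!: bexI[of _ x])

lemma orbit_invariant:
  assumes "\<gamma> \<in> arrows G"
  shows "d \<gamma> \<in> orbit G x \<longleftrightarrow> r \<gamma> \<in> orbit G x"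
proof
  assume "d \<gamma> \<in> orbit G x"
  then obtain \<delta> where "\<delta> \<in> arrows G" "d \<delta> = x" "r \<delta> = d \<gamma>" by (auto simp: orbit_eq)
  then show "r \<gamma> \<in> orbit G x"
    unfolding orbit_eq using assms by (auto intro!: bexI[of _ "gmult G \<gamma> \<delta>"])
next
  assume "r \<gamma> \<in> orbit G x"
  then obtain \<delta> where "\<delta> \<in> arrows G" "d \<delta> = x" "r \<delta> = r \<gamma>" by (auto simp: orbit_eq)
  then show "d \<gamma> \<in> orbit G x"
    unfolding orbit_eq using assms by (auto intro!: bexI[of _ "ldiv \<gamma> \<delta>"])
qed

end

context ample_groupoid
begin

abbreviation X :: "'a topology"
  where "X \<equiv> gtop G"

abbreviation X0 :: "'a topology"
  where "X0 \<equiv> unit_space G"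

lemma topspace_gtop [simp]: "topspace X = arrows G"
  by (simp add: arrows_def)

lemma topspace_unit_space [simp]: "topspace X0 = units G"
  using units_arrows by (auto simp: unit_space_def)

lemma rng_continuous: "continuous_map X X0 r"
  using rng_local_homeomorphism by (rule local_homeomorphism_imp_continuous_map)

lemma dom_continuous: "continuous_map X X0 d"
proof -
  have "continuous_map X X0 (r \<circ> ginv G)"
    using inv_continuous rng_continuous by (rule continuous_map_compose)
  then show ?thesis by (rule continuous_map_eq) simp
qed

lemma openin_rng_image: "openin X U \<Longrightarrow> openin X0 (r ` U)"
  using local_homeomorphism_imp_open_map[OF rng_local_homeomorphism] by (simp add: open_map_def)

lemma openin_rng_preimage: "openin X0 W \<Longrightarrow> openin X {\<gamma> \<in> arrows G. r \<gamma> \<in> W}"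
  using openin_continuous_map_preimage[OF rng_continuous] by simp

lemma openin_dom_preimage: "openin X0 W \<Longrightarrow> openin X {\<gamma> \<in> arrows G. d \<gamma> \<in> W}"
  using openin_continuous_map_preimage[OF dom_continuous] by simp

text \<open>If \<gamma> and \<open>r \<gamma>\<close> both lie in a set where \<open>r\<close> is
  injective, then \<gamma> is the unit \<open>r \<gamma>\<close>, because \<open>r\<close> fixes
  units. Continuity of \<open>r\<close> makes this an open condition that holds at every
  unit.\<close>

lemma openin_units: "openin X (units G)"
  unfolding openin_subopen[of _ "units G"]
proof
  fix x assume x: "x \<in> units G"
  then obtain U where U: "openin X U" "x \<in> U" "inj_on r U"
    using local_homeomorphism_injective_nbhd[OF rng_local_homeomorphism, of x] by auto
  have "continuous_map X X r"
    using rng_continuous by (simp add: unit_space_def continuous_map_in_subtopology)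
  then have "openin X {\<gamma> \<in> U. r \<gamma> \<in> U}"
    using U(1) openin_continuous_map_preimage_gen by blast
  moreover have "{\<gamma> \<in> U. r \<gamma> \<in> U} \<subseteq> units G"
  proof safe
    fix \<gamma> assume \<gamma>: "\<gamma> \<in> U" "r \<gamma> \<in> U"
    then have "\<gamma> \<in> arrows G" using openin_subset[OF U(1)] by auto
    have "\<gamma> = r \<gamma>" by (rule inj_onD[OF U(3)]) (use \<gamma> \<open>\<gamma> \<in> arrows G\<close> in auto)
    then show "\<gamma> \<in> units G" using \<open>\<gamma> \<in> arrows G\<close> by (metis rng_in_units)
  qed
  ultimately show "\<exists>T. openin X T \<and> x \<in> T \<and> T \<subseteq> units G"
    using x U(2) by (intro exI[of _ "{\<gamma> \<in> U. r \<gamma> \<in> U}"]) auto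
qed

lemma openin_unit_space: "openin X0 W \<longleftrightarrow> openin X W \<and> W \<subseteq> units G"
  unfolding unit_space_def using openin_units by (rule openin_open_subtopology)

text \<open>The Hausdorff property is pulled back from the unit space along the injective continuous
  map \<open>r\<close>. So the Hausdorff clause of \<open>compact_open\<close> is automatic for
  bisections.\<close>

lemma Hausdorff_subtopology_inj_rng:
  assumes "U \<subseteq> arrows G" "inj_on r U"
  shows "Hausdorff_space (subtopology X U)"
  using unit_space_Hausdorff continuous_map_from_subtopology[OF rng_continuous, of U]
  by (rule Hausdorff_space_injective_preimage) (use assms in \<open>simp add: inf.absorb2\<close>)

lemma compact_open_units:
  "compact_open X W \<and> W \<subseteq> units G \<longleftrightarrow> openin X0 W \<and> compactin X0 W"
proof -
  have "compactin X0 W \<longleftrightarrow> compactin X W \<and> W \<subseteq> units G"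
    by (simp add: unit_space_def compactin_subtopology)
  moreover have "W \<subseteq> units G \<Longrightarrow> Hausdorff_space (subtopology X W)"
    by (rule Hausdorff_subtopology_inj_rng) (auto simp: inj_on_def subset_iff)
  ultimately show ?thesis unfolding compact_open_def openin_unit_space by blast
qed

lemma compactin_imp_closedin_unit_space: "compactin X0 K \<Longrightarrow> closedin X0 K"
  using unit_space_Hausdorff compactin_imp_closedin by blast

lemma compact_open_unit_nbhd:
  assumes "openin X0 W" "x \<in> W"
  obtains K where "openin X0 K" "compactin X0 K" "x \<in> K" "K \<subseteq> W"
  using unit_space_basis[OF assms] by (auto simp: compact_open_def)

text \<open>\<open>U1\<close> secures injectivity of \<open>r\<close>. As \<open>d\<close> is
  \<open>r\<close> composed with inversion, the preimage of \<open>U2\<close> under inversion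
  secures injectivity of \<open>d\<close>. Cutting down to the arrows whose range lies in a compact
  open set of units then gives compactness.\<close>

lemma compact_open_bisection_nbhd:
  assumes W: "openin X W" "\<gamma> \<in> W"
  obtains U where "compact_open X U" "bisection G U" "\<gamma> \<in> U" "U \<subseteq> W"
proof -
  have \<gamma>: "\<gamma> \<in> arrows G" using openin_subset[OF W(1)] W(2) by auto
  obtain U1 where U1: "openin X U1" "\<gamma> \<in> U1" "inj_on r U1"
    using local_homeomorphism_injective_nbhd[OF rng_local_homeomorphism] \<gamma> by auto
  obtain U2 where U2: "openin X U2" "ginv G \<gamma> \<in> U2" "inj_on r U2"
    using local_homeomorphism_injective_nbhd[OF rng_local_homeomorphism, of "ginv G \<gamma>"] \<gamma> by auto
  let ?U3 = "U1 \<inter> {\<gamma> \<in> arrows G. ginv G \<gamma> \<in> U2} \<inter> W"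
  have U3: "openin X ?U3"
    using U1(1) U2(1) W(1) openin_continuous_map_preimage[OF inv_continuous U2(1)] by auto
  have inj: "inj_on r ?U3" using U1(3) by (rule inj_on_subset) auto
  have inj_d: "inj_on d ?U3"
  proof (rule inj_onI)
    fix \<alpha> \<beta> assume ab: "\<alpha> \<in> ?U3" "\<beta> \<in> ?U3" "d \<alpha> = d \<beta>"
    then have "ginv G \<alpha> = ginv G \<beta>" using inj_onD[OF U2(3), of "ginv G \<alpha>" "ginv G \<beta>"] by simp
    then have "ginv G (ginv G \<alpha>) = ginv G (ginv G \<beta>)" by (rule arg_cong)
    then show "\<alpha> = \<beta>" using ab by simp
  qed
  obtain K where K: "openin X0 K" "compactin X0 K" "r \<gamma> \<in> K" "K \<subseteq> r ` ?U3"
    using compact_open_unit_nbhd[OF openin_rng_image[OF U3], of "r \<gamma>"] \<gamma> U1(2) U2(2) W(2) by auto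
  let ?U = "{\<beta> \<in> ?U3. r \<beta> \<in> K}"
  have "compactin X ?U"
    using rng_local_homeomorphism U3 inj K(2,4) by (rule compactin_homeomorphic_image)
  moreover have "openin X ?U"
    using rng_continuous U3 K(1) by (rule openin_continuous_map_preimage_gen)
  moreover have "bisection G ?U"
    using inj inj_d by (auto simp: bisection_def inj_on_def)
  moreover have "Hausdorff_space (subtopology X ?U)"
    by (rule Hausdorff_subtopology_inj_rng) (use inj in \<open>auto simp: inj_on_def\<close>)
  ultimately show ?thesis
    using that[of ?U] \<gamma> U1(2) U2(2) W(2) K(3) by (auto simp: compact_open_def)
qed

lemma continuous_map_mult:
  assumes "continuous_map T X f" "continuous_map T X g"
    and "\<And>x. x \<in> topspace T \<Longrightarrow> d (f x) = r (g x)"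
  shows "continuous_map T X (\<lambda>x. gmult G (f x) (g x))"
proof -
  have "continuous_map T (subtopology (prod_topology X X) (composable G)) (\<lambda>x. (f x, g x))"
    using assms continuous_map_funspace[OF assms(1)] continuous_map_funspace[OF assms(2)]
    by (auto simp: continuous_map_in_subtopology intro!: continuous_map_pairedI)
  from continuous_map_compose[OF this mult_continuous] show ?thesis by (simp add: o_def)
qed

lemma bisection_rng_section:
  assumes "openin X U" "bisection G U"
  shows "continuous_map (subtopology X0 (r ` U)) X (inv_into U r)"
  using local_homeomorphism_inverse_continuous[OF rng_local_homeomorphism assms(1)] assms(2)
  by (simp add: bisection_def)

end

section \<open>Finite sums\<close>

lemma (in abelian_monoid) finsum_superset:
  assumes "finite B" "A \<subseteq> B" "\<And>i. i \<in> B \<Longrightarrow> f i \<in> carrier G" "\<And>i. i \<in> B - A \<Longrightarrow> f i = \<zero>"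
  shows "finsum G f A = finsum G f B"
  using assms by (intro add.finprod_mono_neutral_cong_left) auto

lemma finsum_hom:
  assumes R: "abelian_monoid R" and N: "abelian_monoid N"
    and closed: "\<And>a. a \<in> carrier R \<Longrightarrow> h a \<in> carrier N"
    and zero: "h \<zero>\<^bsub>R\<^esub> = \<zero>\<^bsub>N\<^esub>"
    and add: "\<And>a b. a \<in> carrier R \<Longrightarrow> b \<in> carrier R \<Longrightarrow> h (a \<oplus>\<^bsub>R\<^esub> b) = h a \<oplus>\<^bsub>N\<^esub> h b"
    and A: "finite A" and f: "\<And>i. i \<in> A \<Longrightarrow> f i \<in> carrier R"
  shows "h (finsum R f A) = finsum N (\<lambda>i. h (f i)) A"
proof -
  interpret R: abelian_monoid R by fact
  interpret N: abelian_monoid N by fact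
  show ?thesis
    using A f
  proof induction
    case (insert i A)
    then show ?case using closed by (simp add: R.finsum_insert N.finsum_insert Pi_iff add R.finsum_closed)
  qed (simp add: zero)
qed

lemma (in abelian_monoid) finsum_swap:
  assumes "finite I" "finite J" "\<And>i j. i \<in> I \<Longrightarrow> j \<in> J \<Longrightarrow> f i j \<in> carrier G"
  shows "finsum G (\<lambda>i. finsum G (\<lambda>j. f i j) J) I = finsum G (\<lambda>j. finsum G (\<lambda>i. f i j) I) J"
  using assms(1,3)
proof induction
  case empty
  then show ?case by simp
next
  case (insert i I)
  have "finsum G (\<lambda>j. finsum G (\<lambda>i. f i j) (insert i I)) J = finsum G (\<lambda>j. f i j \<oplus> finsum G (\<lambda>i. f i j) I) J"
    using insert by (intro finsum_cong') (auto simp: Pi_iff intro!: finsum_insert finsum_closed)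
  also have "\<dots> = finsum G (\<lambda>j. f i j) J \<oplus> finsum G (\<lambda>j. finsum G (\<lambda>i. f i j) I) J"
    using insert by (intro finsum_addf) (auto simp: Pi_iff intro!: finsum_closed)
  also have "\<dots> = finsum G (\<lambda>i. finsum G (\<lambda>j. f i j) J) (insert i I)"
    using insert by (subst finsum_insert) (auto simp: Pi_iff intro!: finsum_closed)
  finally show ?case by simp
qed

text \<open>The additive structure is that of the direct sum \<open>sum_group\<close>. It serves
  twice: for the skew group ring, and for the finitely supported functions on the orbit.\<close>

lemma finitely_supported_abelian_group:
  assumes A: "abelian_group A"
    and carrier: "carrier R = {f \<in> I \<rightarrow>\<^sub>E carrier A. finite {i \<in> I. f i \<noteq> \<zero>\<^bsub>A\<^esub>}}"
    and add: "\<And>f g. f \<oplus>\<^bsub>R\<^esub> g = (\<lambda>i\<in>I. f i \<oplus>\<^bsub>A\<^esub> g i)"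
    and zero: "\<zero>\<^bsub>R\<^esub> = (\<lambda>i\<in>I. \<zero>\<^bsub>A\<^esub>)"
  shows "abelian_group R"
proof -
  interpret A: abelian_group A by fact
  let ?S = "sum_group I (\<lambda>_. add_monoid A)"
  have "group ?S" by (rule sum_group) (rule A.a_group)
  then interpret S: comm_group ?S
    by (rule group.group_comm_groupI) (auto simp: carrier_sum_group A.a_group A.a_comm PiE_iff intro!: restrict_ext)
  have eqs: "carrier R = carrier ?S" "\<zero>\<^bsub>R\<^esub> = \<one>\<^bsub>?S\<^esub>" "f \<oplus>\<^bsub>R\<^esub> g = f \<otimes>\<^bsub>?S\<^esub> g" for f g
    by (simp_all add: carrier_sum_group A.a_group carrier add zero)
  show ?thesis
    by (rule abelian_groupI; unfold eqs)
      (auto simp del: one_sum_group mult_sum_group simp: S.m_assoc intro: S.m_comm S.l_inv_ex)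
qed


section \<open>The convolution ring\<close>

locale ample_groupoid_sheaf =
  ample_groupoid G + sheaf: groupoid_sheaf_of_rings G S
  for G :: "('g, 'm) top_groupoid_scheme" and S :: "('g, 'e, 'n) gsheaf_rings_scheme"
begin

abbreviation \<O> :: "'g \<Rightarrow> 'e ring"
  where "\<O> \<equiv> stalk S"

abbreviation sections :: "('g \<Rightarrow> 'e) monoid"
  where "sections \<equiv> section_group G S"

abbreviation generators :: "('g \<Rightarrow> 'e) set"
  where "generators \<equiv> Gamma_c_generators G S"

abbreviation conv :: "('g \<Rightarrow> 'e) \<Rightarrow> ('g \<Rightarrow> 'e) \<Rightarrow> 'g \<Rightarrow> 'e"
  where "conv \<equiv> convolution G S"

abbreviation \<Gamma> :: "('g \<Rightarrow> 'e) ring"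
  where "\<Gamma> \<equiv> Gamma_c G S"

lemma stalk_carrier: "e \<in> carrier (\<O> x) \<longleftrightarrow> e \<in> topspace (etop S) \<and> proj S e = x"
  by (simp add: stalk_def)

lemma stalk_ops:
  "a \<oplus>\<^bsub>\<O> x\<^esub> b = eadd S a b" "a \<otimes>\<^bsub>\<O> x\<^esub> b = emult S a b"
  "\<one>\<^bsub>\<O> x\<^esub> = eone S x" "\<zero>\<^bsub>\<O> x\<^esub> = ezero S x"
  by (simp_all add: stalk_def)

lemma stalk_rng: "\<gamma> \<in> arrows G \<Longrightarrow> ring (\<O> (r \<gamma>))"
  and stalk_dom: "\<gamma> \<in> arrows G \<Longrightarrow> ring (\<O> (d \<gamma>))"
  by (simp_all add: sheaf.stalk_ring)

lemma act_closed:
  "\<gamma> \<in> arrows G \<Longrightarrow> e \<in> carrier (\<O> (d \<gamma>)) \<Longrightarrow> act S \<gamma> e \<in> carrier (\<O> (r \<gamma>))"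
  by (rule ring_hom_closed[OF sheaf.act_ring_hom])

lemma act_add:
  "\<gamma> \<in> arrows G \<Longrightarrow> a \<in> carrier (\<O> (d \<gamma>)) \<Longrightarrow> b \<in> carrier (\<O> (d \<gamma>)) \<Longrightarrow>
    act S \<gamma> (a \<oplus>\<^bsub>\<O> (d \<gamma>)\<^esub> b) = act S \<gamma> a \<oplus>\<^bsub>\<O> (r \<gamma>)\<^esub> act S \<gamma> b"
  by (rule ring_hom_add[OF sheaf.act_ring_hom])

lemma act_mult:
  "\<gamma> \<in> arrows G \<Longrightarrow> a \<in> carrier (\<O> (d \<gamma>)) \<Longrightarrow> b \<in> carrier (\<O> (d \<gamma>)) \<Longrightarrow>
    act S \<gamma> (a \<otimes>\<^bsub>\<O> (d \<gamma>)\<^esub> b) = act S \<gamma> a \<otimes>\<^bsub>\<O> (r \<gamma>)\<^esub> act S \<gamma> b"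
  by (rule ring_hom_mult[OF sheaf.act_ring_hom])

lemma act_zero: "\<gamma> \<in> arrows G \<Longrightarrow> act S \<gamma> \<zero>\<^bsub>\<O> (d \<gamma>)\<^esub> = \<zero>\<^bsub>\<O> (r \<gamma>)\<^esub>"
  using ring_hom_zero[OF sheaf.act_ring_hom stalk_dom stalk_rng] by blast

lemma act_one: "\<gamma> \<in> arrows G \<Longrightarrow> act S \<gamma> \<one>\<^bsub>\<O> (d \<gamma>)\<^esub> = \<one>\<^bsub>\<O> (r \<gamma>)\<^esub>"
  by (rule ring_hom_one[OF sheaf.act_ring_hom])

lemma act_comp:
  "\<beta> \<in> arrows G \<Longrightarrow> \<gamma> \<in> arrows G \<Longrightarrow> d \<beta> = r \<gamma> \<Longrightarrow> e \<in> carrier (\<O> (d \<gamma>)) \<Longrightarrow>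
    act S \<beta> (act S \<gamma> e) = act S (gmult G \<beta> \<gamma>) e"
  by (rule sheaf.act_act) (auto simp: stalk_carrier)

lemma act_unit: "x \<in> units G \<Longrightarrow> e \<in> carrier (\<O> x) \<Longrightarrow> act S x e = e"
  using sheaf.act_unit by (auto simp: stalk_carrier)

lemma act_inv_act:
  assumes "\<gamma> \<in> arrows G" "e \<in> carrier (\<O> (d \<gamma>))"
  shows "act S (ginv G \<gamma>) (act S \<gamma> e) = e"
  using assms by (simp add: act_comp inv_mult_self act_unit)

lemma act_act_inv:
  assumes "\<gamma> \<in> arrows G" "e \<in> carrier (\<O> (r \<gamma>))"
  shows "act S \<gamma> (act S (ginv G \<gamma>) e) = e"
  using act_inv_act[of "ginv G \<gamma>" e] assms by simp

lemma section_closed: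
  "f \<in> carrier sections \<Longrightarrow> \<gamma> \<in> arrows G \<Longrightarrow> f \<gamma> \<in> carrier (\<O> (r \<gamma>))"
  by (auto simp: section_group_def)

lemma sections_eqI:
  "f \<in> carrier sections \<Longrightarrow> g \<in> carrier sections \<Longrightarrow> (\<And>\<gamma>. \<gamma> \<in> arrows G \<Longrightarrow> f \<gamma> = g \<gamma>) \<Longrightarrow> f = g"
  by (auto simp: section_group_def intro: PiE_ext)

lemma sections_add_apply:
  "\<gamma> \<in> arrows G \<Longrightarrow> (f \<otimes>\<^bsub>sections\<^esub> g) \<gamma> = f \<gamma> \<oplus>\<^bsub>\<O> (r \<gamma>)\<^esub> g \<gamma>"
  and sections_zero_apply: "\<gamma> \<in> arrows G \<Longrightarrow> \<one>\<^bsub>sections\<^esub> \<gamma> = \<zero>\<^bsub>\<O> (r \<gamma>)\<^esub>"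
  by (simp_all add: section_group_def)

text \<open>This identification supplies the group axioms and the pointwise formula for
  inverses.\<close>

lemma sections_eq_product_group: "sections = product_group (arrows G) (\<lambda>\<gamma>. add_monoid (\<O> (r \<gamma>)))"
  by (simp add: section_group_def product_group_def)

lemma stalk_add_group: "\<gamma> \<in> arrows G \<Longrightarrow> group (add_monoid (\<O> (r \<gamma>)))"
  using stalk_rng by (intro abelian_group.a_group ring.is_abelian_group)

lemma sections_comm_group: "comm_group sections"
  unfolding sections_eq_product_group
proof (rule group.group_comm_groupI[OF product_group[OF stalk_add_group]])
  have "a \<oplus>\<^bsub>\<O> (r \<gamma>)\<^esub> b = b \<oplus>\<^bsub>\<O> (r \<gamma>)\<^esub> a"
    if "\<gamma> \<in> arrows G" "a \<in> carrier (\<O> (r \<gamma>))" "b \<in> carrier (\<O> (r \<gamma>))" for \<gamma> a b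
  proof -
    interpret R: ring "\<O> (r \<gamma>)" using that(1) by (rule stalk_rng)
    show ?thesis using that(2,3) by (rule R.a_comm)
  qed
  then show "f \<otimes>\<^bsub>product_group (arrows G) (\<lambda>\<gamma>. add_monoid (\<O> (r \<gamma>)))\<^esub> g =
      g \<otimes>\<^bsub>product_group (arrows G) (\<lambda>\<gamma>. add_monoid (\<O> (r \<gamma>)))\<^esub> f"
    if "f \<in> carrier (product_group (arrows G) (\<lambda>\<gamma>. add_monoid (\<O> (r \<gamma>))))"
      "g \<in> carrier (product_group (arrows G) (\<lambda>\<gamma>. add_monoid (\<O> (r \<gamma>))))" for f g
    using that by (auto simp: PiE_iff intro!: restrict_ext)
qed

sublocale sections: comm_group sections
  by (rule sections_comm_group)

lemma sections_inv_apply: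
  "f \<in> carrier sections \<Longrightarrow> \<gamma> \<in> arrows G \<Longrightarrow> (inv\<^bsub>sections\<^esub> f) \<gamma> = \<ominus>\<^bsub>\<O> (r \<gamma>)\<^esub> f \<gamma>"
  unfolding sections_eq_product_group
  by (subst inv_product_group) (simp_all only: carrier_product_group stalk_add_group a_inv_def restrict_apply' monoid.simps partial_object.simps)

lemma generators_sections: "generators \<subseteq> carrier sections"
  by (auto simp: Gamma_c_generators_def)

lemma Gamma_subgroup: "subgroup (carrier \<Gamma>) sections"
  using sections.generate_is_subgroup[OF generators_sections] by (simp add: Gamma_c_def)

lemma Gamma_sections: "f \<in> carrier \<Gamma> \<Longrightarrow> f \<in> carrier sections"
  using subgroup.subset[OF Gamma_subgroup] by blast

lemma generators_Gamma: "f \<in> generators \<Longrightarrow> f \<in> carrier \<Gamma>"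
  by (simp add: Gamma_c_def generate.incl)

lemma Gamma_ops: "f \<oplus>\<^bsub>\<Gamma>\<^esub> g = f \<otimes>\<^bsub>sections\<^esub> g" "\<zero>\<^bsub>\<Gamma>\<^esub> = \<one>\<^bsub>sections\<^esub>"
    "f \<otimes>\<^bsub>\<Gamma>\<^esub> g = conv f g"
  by (simp_all add: Gamma_c_def)

lemma Gamma_abelian_group: "abelian_group \<Gamma>"
proof (rule abelian_groupI)
  interpret subgroup "carrier \<Gamma>" sections by (rule Gamma_subgroup)
  show "\<exists>g\<in>carrier \<Gamma>. g \<oplus>\<^bsub>\<Gamma>\<^esub> f = \<zero>\<^bsub>\<Gamma>\<^esub>" if "f \<in> carrier \<Gamma>" for f
    using that Gamma_sections by (intro bexI[of _ "inv\<^bsub>sections\<^esub> f"]) (auto simp: Gamma_ops)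
qed (auto simp: Gamma_ops Gamma_sections sections.m_ac subgroup.m_closed[OF Gamma_subgroup]
    subgroup.one_closed[OF Gamma_subgroup])

sublocale Gamma: abelian_group \<Gamma>
  by (rule Gamma_abelian_group)

lemma Gamma_neg: "f \<in> carrier \<Gamma> \<Longrightarrow> \<ominus>\<^bsub>\<Gamma>\<^esub> f = inv\<^bsub>sections\<^esub> f"
  using subgroup.m_inv_closed[OF Gamma_subgroup] Gamma_sections
  by (intro Gamma.minus_equality) (auto simp: Gamma_ops)

lemma Gamma_closed: "f \<in> carrier \<Gamma> \<Longrightarrow> \<gamma> \<in> arrows G \<Longrightarrow> f \<gamma> \<in> carrier (\<O> (r \<gamma>))"
  by (simp add: Gamma_sections section_closed)

lemma Gamma_eqI: "f \<in> carrier \<Gamma> \<Longrightarrow> g \<in> carrier \<Gamma> \<Longrightarrow> (\<And>\<gamma>. \<gamma> \<in> arrows G \<Longrightarrow> f \<gamma> = g \<gamma>) \<Longrightarrow> f = g"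
  by (simp add: Gamma_sections sections_eqI)

lemma Gamma_apply:
  assumes "\<gamma> \<in> arrows G"
  shows "(f \<oplus>\<^bsub>\<Gamma>\<^esub> g) \<gamma> = f \<gamma> \<oplus>\<^bsub>\<O> (r \<gamma>)\<^esub> g \<gamma>"
    and "\<zero>\<^bsub>\<Gamma>\<^esub> \<gamma> = \<zero>\<^bsub>\<O> (r \<gamma>)\<^esub>"
    and "g \<in> carrier \<Gamma> \<Longrightarrow> (f \<ominus>\<^bsub>\<Gamma>\<^esub> g) \<gamma> = f \<gamma> \<ominus>\<^bsub>\<O> (r \<gamma>)\<^esub> g \<gamma>"
  using assms by (simp_all add: Gamma_ops sections_add_apply sections_zero_apply Gamma_neg a_minus_def
      sections_inv_apply Gamma_sections)

text \<open>No closure is taken. Only the nonzero arrows themselves matter below, and in the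
  non-Hausdorff case a closure could be much larger than the bisections that contain them.\<close>

definition supp :: "('g \<Rightarrow> 'e) \<Rightarrow> 'g set"
  where "supp f = {\<gamma> \<in> arrows G. f \<gamma> \<noteq> \<zero>\<^bsub>\<O> (r \<gamma>)\<^esub>}"

lemma generator_supp:
  assumes "f \<in> generators"
  obtains U where "compact_open X U" "bisection G U"
    "continuous_map (subtopology X U) (etop S) f" "supp f \<subseteq> U"
  using assms by (auto simp: Gamma_c_generators_def supp_def)

lemma generatorI:
  assumes "f \<in> carrier sections" "compact_open X U" "bisection G U"
    "continuous_map (subtopology X U) (etop S) f" "supp f \<subseteq> U"
  shows "f \<in> generators"
  unfolding Gamma_c_generators_def using assms
  by (auto simp: supp_def intro!: exI[of _ U])

lemma not_supp: "\<gamma> \<in> arrows G \<Longrightarrow> \<gamma> \<notin> supp f \<Longrightarrow> f \<gamma> = \<zero>\<^bsub>\<O> (r \<gamma>)\<^esub>"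
  by (simp add: supp_def)

text \<open>Closure under differences covers sums, negatives and zero at once, so every later
  induction has a single inductive case.\<close>

lemma Gamma_induct [consumes 1, case_names generator diff]:
  assumes "f \<in> carrier \<Gamma>"
    and gen: "\<And>f. f \<in> generators \<Longrightarrow> P f"
    and diff: "\<And>f g. f \<in> carrier \<Gamma> \<Longrightarrow> g \<in> carrier \<Gamma> \<Longrightarrow> P f \<Longrightarrow> P g \<Longrightarrow> P (f \<ominus>\<^bsub>\<Gamma>\<^esub> g)"
  shows "P f"
proof -
  \<comment> \<open>Zero is a generator, supported on the empty bisection; this starts the chain
    that yields negatives as \<open>0 - f\<close> and sums as \<open>f - (- g)\<close>.\<close>
  have "\<zero>\<^bsub>\<Gamma>\<^esub> \<in> generators"
    using Gamma_sections[OF Gamma.zero_closed]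
    by (intro generatorI[of _ "{}"])
      (auto simp: compact_open_def bisection_def supp_def Gamma_apply Hausdorff_space_def)
  then have zero: "P \<zero>\<^bsub>\<Gamma>\<^esub>" by (rule gen)
  have neg: "P (\<ominus>\<^bsub>\<Gamma>\<^esub> f)" if "f \<in> carrier \<Gamma>" "P f" for f
    using diff[OF Gamma.zero_closed that(1) zero that(2)] that(1) by (simp add: a_minus_def)
  have "f \<in> generate sections (generators)" using assms(1) by (simp add: Gamma_c_def)
  then show ?thesis
  proof induction
    case one
    then show ?case using zero by (simp add: Gamma_ops)
  next
    case (incl f)
    then show ?case by (rule gen)
  next
    case (inv f)
    then show ?case using neg[of f] gen[of f] generators_Gamma[of f] by (simp add: Gamma_neg)
  next
    case (eng f g)
    then have "f \<in> carrier \<Gamma>" "g \<in> carrier \<Gamma>" by (simp_all add: Gamma_c_def)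
    then show ?case using diff[of f "\<ominus>\<^bsub>\<Gamma>\<^esub> g"] neg[of g] eng by (simp add: a_minus_def Gamma_ops)
  qed
qed

lemma supp_diff: "g \<in> carrier \<Gamma> \<Longrightarrow> supp (f \<ominus>\<^bsub>\<Gamma>\<^esub> g) \<subseteq> supp f \<union> supp g"
proof
  fix \<gamma> assume g: "g \<in> carrier \<Gamma>" and \<gamma>: "\<gamma> \<in> supp (f \<ominus>\<^bsub>\<Gamma>\<^esub> g)"
  then have "\<gamma> \<in> arrows G" by (simp add: supp_def)
  interpret R: ring "\<O> (r \<gamma>)" using \<open>\<gamma> \<in> arrows G\<close> by (rule stalk_rng)
  have "\<zero>\<^bsub>\<O> (r \<gamma>)\<^esub> \<ominus>\<^bsub>\<O> (r \<gamma>)\<^esub> \<zero>\<^bsub>\<O> (r \<gamma>)\<^esub> = \<zero>\<^bsub>\<O> (r \<gamma>)\<^esub>"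
    by (simp add: a_minus_def)
  then show "\<gamma> \<in> supp f \<union> supp g" using g \<gamma> by (auto simp: supp_def Gamma_apply)
qed

lemma supp_add: "supp (f \<oplus>\<^bsub>\<Gamma>\<^esub> g) \<subseteq> supp f \<union> supp g"
proof
  fix \<gamma> assume \<gamma>: "\<gamma> \<in> supp (f \<oplus>\<^bsub>\<Gamma>\<^esub> g)"
  then have "\<gamma> \<in> arrows G" by (simp add: supp_def)
  interpret R: ring "\<O> (r \<gamma>)" using \<open>\<gamma> \<in> arrows G\<close> by (rule stalk_rng)
  show "\<gamma> \<in> supp f \<union> supp g" using \<gamma> by (auto simp: supp_def Gamma_apply)
qed

text \<open>A bisection meets each fibre of \<open>r\<close> and each fibre of \<open>d\<close> in
  at most one arrow, and finiteness passes to differences. These are the row and column finiteness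
  of the matrices used later.\<close>

lemma finite_supp:
  assumes "f \<in> carrier \<Gamma>"
  shows "finite {\<gamma> \<in> supp f. r \<gamma> = y}" "finite {\<gamma> \<in> supp f. d \<gamma> = y}"
proof -
  have "finite {\<gamma> \<in> supp f. h \<gamma> = y}"
    if h: "\<And>U. bisection G U \<Longrightarrow> inj_on h U" for h :: "'g \<Rightarrow> 'g"
    using assms
  proof (induction rule: Gamma_induct)
    case (generator f)
    then obtain U where U: "bisection G U" "supp f \<subseteq> U" by (rule generator_supp)
    have "inj_on h {\<gamma> \<in> supp f. h \<gamma> = y}" using h[OF U(1)] U(2) by (auto intro: inj_on_subset)
    then show ?case by (rule inj_on_finite[of _ _ "{y}"]) auto
  next
    case (diff f g)
    then have "finite ({\<gamma> \<in> supp f. h \<gamma> = y} \<union> {\<gamma> \<in> supp g. h \<gamma> = y})" by simp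
    then show ?case by (rule finite_subset[rotated]) (use supp_diff[OF diff.hyps(2), of f] in auto)
  qed
  then show "finite {\<gamma> \<in> supp f. r \<gamma> = y}" "finite {\<gamma> \<in> supp f. d \<gamma> = y}"
    by (simp_all add: bisection_def)
qed

section \<open>Convolution as a finite sum, and its biadditivity\<close>

lemma convolution_term_closed:
  assumes "f \<in> carrier sections" "g \<in> carrier sections" "\<beta> \<in> arrows G" "\<rho> \<in> arrows G" "d \<beta> = r \<rho>"
  shows "f \<beta> \<otimes>\<^bsub>\<O> (r \<beta>)\<^esub> act S \<beta> (g \<rho>) \<in> carrier (\<O> (r \<beta>))"
proof -
  interpret R: ring "\<O> (r \<beta>)" using assms(3) by (rule stalk_rng)
  show ?thesis using assms section_closed act_closed by (metis R.m_closed)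
qed

lemma convolution_closed:
  assumes "f \<in> carrier sections" "g \<in> carrier sections"
  shows "conv f g \<in> carrier sections"
proof -
  have "conv f g \<gamma> \<in> carrier (\<O> (r \<gamma>))" if \<gamma>: "\<gamma> \<in> arrows G" for \<gamma>
  proof -
    interpret R: ring "\<O> (r \<gamma>)" using \<gamma> by (rule stalk_rng)
    show ?thesis using convolution_term_closed[OF assms] \<gamma>
      by (auto simp: convolution_def intro!: R.finsum_closed)
  qed
  then show ?thesis by (auto simp: section_group_def convolution_def)
qed

text \<open>A factorization of \<gamma> is determined by its left factor \<beta>, the right one
  being \<open>ldiv \<beta> \<gamma>\<close>, so the sum over pairs is reindexed by \<beta>. The set
  \<open>A\<close> may exceed the support of \<open>f\<close>; this lets several convolutions be
  evaluated over one common index set.\<close>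

lemma convolution_apply:
  assumes fg: "f \<in> carrier sections" "g \<in> carrier sections" and \<gamma>: "\<gamma> \<in> arrows G"
    and A: "finite A" "A \<subseteq> arrows G" "\<And>\<beta>. \<beta> \<in> A \<Longrightarrow> r \<beta> = r \<gamma>"
    and supp: "\<And>\<beta>. \<beta> \<in> supp f \<Longrightarrow> r \<beta> = r \<gamma> \<Longrightarrow> \<beta> \<in> A"
  shows "conv f g \<gamma> =
    finsum (\<O> (r \<gamma>)) (\<lambda>\<beta>. f \<beta> \<otimes>\<^bsub>\<O> (r \<gamma>)\<^esub> act S \<beta> (g (ldiv \<beta> \<gamma>))) A"
proof -
  let ?R = "\<O> (r \<gamma>)"
  interpret R: ring ?R using \<gamma> by (rule stalk_rng)
  let ?t = "\<lambda>\<beta>. f \<beta> \<otimes>\<^bsub>?R\<^esub> act S \<beta> (g (ldiv \<beta> \<gamma>))"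
  let ?u = "\<lambda>(\<beta>, \<rho>). f \<beta> \<otimes>\<^bsub>?R\<^esub> act S \<beta> (g \<rho>)"
  let ?h = "\<lambda>\<beta>. (\<beta>, ldiv \<beta> \<gamma>)"
  let ?N = "{\<beta> \<in> A. ?t \<beta> \<noteq> \<zero>\<^bsub>?R\<^esub>}"
  have A': "\<beta> \<in> arrows G" "r \<beta> = r \<gamma>" if "\<beta> \<in> A" for \<beta> using A that by auto
  have t: "?t \<beta> \<in> carrier ?R" if "\<beta> \<in> A" for \<beta>
    using convolution_term_closed[OF fg, of \<beta> "ldiv \<beta> \<gamma>"] A'[OF that] \<gamma> by simp
  have eq: "{(\<beta>, \<rho>) \<in> composable G. gmult G \<beta> \<rho> = \<gamma> \<and> f \<beta> \<otimes>\<^bsub>?R\<^esub> act S \<beta> (g \<rho>) \<noteq> \<zero>\<^bsub>?R\<^esub>} = ?h ` ?N"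
  proof (intro equalityI subsetI)
    fix x assume "x \<in> {(\<beta>, \<rho>) \<in> composable G. gmult G \<beta> \<rho> = \<gamma> \<and> f \<beta> \<otimes>\<^bsub>?R\<^esub> act S \<beta> (g \<rho>) \<noteq> \<zero>\<^bsub>?R\<^esub>}"
    then obtain \<beta> \<rho> where x: "x = (\<beta>, \<rho>)" and *: "\<beta> \<in> arrows G" "\<rho> \<in> arrows G" "d \<beta> = r \<rho>"
        "gmult G \<beta> \<rho> = \<gamma>" "f \<beta> \<otimes>\<^bsub>?R\<^esub> act S \<beta> (g \<rho>) \<noteq> \<zero>\<^bsub>?R\<^esub>"
      by auto
    have r: "r \<beta> = r \<gamma>" "ldiv \<beta> \<gamma> = \<rho>" using *(1-3) *(4)[symmetric] by simp_all
    have act: "act S \<beta> (g \<rho>) \<in> carrier ?R"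
      using * r act_closed[of \<beta> "g \<rho>"] section_closed[OF fg(2), of \<rho>] by simp
    have "\<beta> \<in> supp f"
      using *(1,5) r(1) R.l_null[OF act] by (auto simp: supp_def)
    then have "\<beta> \<in> A" using r by (intro supp) simp_all
    then show "x \<in> ?h ` ?N" using x * r by (intro image_eqI[of _ _ \<beta>]) simp_all
  next
    fix x assume "x \<in> ?h ` ?N"
    then obtain \<beta> where "x = ?h \<beta>" "\<beta> \<in> A" "?t \<beta> \<noteq> \<zero>\<^bsub>?R\<^esub>" by auto
    then show "x \<in> {(\<beta>, \<rho>) \<in> composable G. gmult G \<beta> \<rho> = \<gamma> \<and> f \<beta> \<otimes>\<^bsub>?R\<^esub> act S \<beta> (g \<rho>) \<noteq> \<zero>\<^bsub>?R\<^esub>}"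
      using A' \<gamma> by simp
  qed
  have "conv f g \<gamma> = finsum ?R ?u {(\<beta>, \<rho>) \<in> composable G. gmult G \<beta> \<rho> = \<gamma> \<and> f \<beta> \<otimes>\<^bsub>?R\<^esub> act S \<beta> (g \<rho>) \<noteq> \<zero>\<^bsub>?R\<^esub>}"
    using \<gamma> by (simp add: convolution_def)
  also have "\<dots> = finsum ?R ?u (?h ` ?N)" by (rule arg_cong[OF eq])
  also have "\<dots> = finsum ?R (\<lambda>\<beta>. ?u (?h \<beta>)) ?N"
    using t by (intro R.finsum_reindex) (auto simp: inj_on_def)
  also have "\<dots> = finsum ?R ?t A"
    using t A(1) by (auto intro!: R.finsum_superset)
  finally show ?thesis .
qed

lemma convolution_apply_Gamma:
  assumes "f \<in> carrier \<Gamma>" "g \<in> carrier sections" "\<gamma> \<in> arrows G"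
  shows "conv f g \<gamma> =
    finsum (\<O> (r \<gamma>)) (\<lambda>\<beta>. f \<beta> \<otimes>\<^bsub>\<O> (r \<gamma>)\<^esub> act S \<beta> (g (ldiv \<beta> \<gamma>)))
      {\<beta> \<in> supp f. r \<beta> = r \<gamma>}"
  using assms finite_supp(1)[of f "r \<gamma>"]
  by (intro convolution_apply) (auto simp: Gamma_sections supp_def)

lemma convolution_add_left:
  assumes f: "f \<in> carrier \<Gamma>" and f': "f' \<in> carrier \<Gamma>" and g: "g \<in> carrier sections"
  shows "conv (f \<oplus>\<^bsub>\<Gamma>\<^esub> f') g = conv f g \<oplus>\<^bsub>\<Gamma>\<^esub> conv f' g"
proof (rule sections_eqI)
  show "conv (f \<oplus>\<^bsub>\<Gamma>\<^esub> f') g \<in> carrier sections"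
    using assms by (simp add: convolution_closed Gamma_sections)
  show "conv f g \<oplus>\<^bsub>\<Gamma>\<^esub> conv f' g \<in> carrier sections"
    using assms by (simp add: convolution_closed Gamma_sections Gamma_ops)
  fix \<gamma> assume \<gamma>: "\<gamma> \<in> arrows G"
  let ?R = "\<O> (r \<gamma>)"
  interpret R: ring ?R using \<gamma> by (rule stalk_rng)
  \<comment> \<open>One index set that works for \<open>f\<close>, \<open>f'\<close> and their
    sum.\<close>
  let ?A = "{\<beta> \<in> supp f. r \<beta> = r \<gamma>} \<union> {\<beta> \<in> supp f'. r \<beta> = r \<gamma>}"
  let ?g = "\<lambda>\<beta>. act S \<beta> (g (ldiv \<beta> \<gamma>))"
  have A: "finite ?A" "?A \<subseteq> arrows G" "\<And>\<beta>. \<beta> \<in> ?A \<Longrightarrow> r \<beta> = r \<gamma>"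
    using finite_supp(1) f f' by (auto simp: supp_def)
  have conv: "conv h g \<gamma> = finsum ?R (\<lambda>\<beta>. h \<beta> \<otimes>\<^bsub>?R\<^esub> ?g \<beta>) ?A"
    if "h \<in> carrier \<Gamma>" "supp h \<subseteq> supp f \<union> supp f'" for h
    by (rule convolution_apply[OF Gamma_sections[OF that(1)] g \<gamma> A]) (use that(2) in auto)
  have closed: "?g \<beta> \<in> carrier ?R" "f \<beta> \<in> carrier ?R" "f' \<beta> \<in> carrier ?R" if "\<beta> \<in> ?A" for \<beta>
  proof -
    have \<beta>: "\<beta> \<in> arrows G" "r \<beta> = r \<gamma>" using A(2,3) that by blast+
    show "?g \<beta> \<in> carrier ?R" "f \<beta> \<in> carrier ?R" "f' \<beta> \<in> carrier ?R"
      using \<beta> \<gamma> Gamma_closed[OF f, of \<beta>] Gamma_closed[OF f', of \<beta>]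
        act_closed[of \<beta> "g (ldiv \<beta> \<gamma>)"] section_closed[OF g, of "ldiv \<beta> \<gamma>"]
      by simp_all
  qed
  have "conv (f \<oplus>\<^bsub>\<Gamma>\<^esub> f') g \<gamma> = finsum ?R (\<lambda>\<beta>. (f \<oplus>\<^bsub>\<Gamma>\<^esub> f') \<beta> \<otimes>\<^bsub>?R\<^esub> ?g \<beta>) ?A"
    using f f' supp_add by (intro conv) auto
  also have "\<dots> = finsum ?R (\<lambda>\<beta>. f \<beta> \<otimes>\<^bsub>?R\<^esub> ?g \<beta> \<oplus>\<^bsub>?R\<^esub> f' \<beta> \<otimes>\<^bsub>?R\<^esub> ?g \<beta>) ?A"
  proof (intro R.finsum_cong')
    fix \<beta> assume \<beta>: "\<beta> \<in> ?A"
    then have "\<beta> \<in> arrows G" "r \<beta> = r \<gamma>" using A(2,3) by blast+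
    then have "(f \<oplus>\<^bsub>\<Gamma>\<^esub> f') \<beta> = f \<beta> \<oplus>\<^bsub>?R\<^esub> f' \<beta>" by (simp add: Gamma_apply)
    then show "(f \<oplus>\<^bsub>\<Gamma>\<^esub> f') \<beta> \<otimes>\<^bsub>?R\<^esub> ?g \<beta> = f \<beta> \<otimes>\<^bsub>?R\<^esub> ?g \<beta> \<oplus>\<^bsub>?R\<^esub> f' \<beta> \<otimes>\<^bsub>?R\<^esub> ?g \<beta>"
      using closed[OF \<beta>] by (simp add: R.l_distr)
  qed (use closed in auto)
  also have "\<dots> = conv f g \<gamma> \<oplus>\<^bsub>?R\<^esub> conv f' g \<gamma>"
    using conv[OF f] conv[OF f'] closed by (simp add: R.finsum_addf Pi_iff)
  finally show "conv (f \<oplus>\<^bsub>\<Gamma>\<^esub> f') g \<gamma> = (conv f g \<oplus>\<^bsub>\<Gamma>\<^esub> conv f' g) \<gamma>"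
    using \<gamma> by (simp add: Gamma_apply)
qed

lemma convolution_add_right:
  assumes f: "f \<in> carrier \<Gamma>" and g: "g \<in> carrier sections" and g': "g' \<in> carrier sections"
  shows "conv f (g \<oplus>\<^bsub>\<Gamma>\<^esub> g') = conv f g \<oplus>\<^bsub>\<Gamma>\<^esub> conv f g'"
proof (rule sections_eqI)
  show "conv f (g \<oplus>\<^bsub>\<Gamma>\<^esub> g') \<in> carrier sections"
    using assms by (simp add: convolution_closed Gamma_sections Gamma_ops)
  show "conv f g \<oplus>\<^bsub>\<Gamma>\<^esub> conv f g' \<in> carrier sections"
    using assms by (simp add: convolution_closed Gamma_sections Gamma_ops)
  fix \<gamma> assume \<gamma>: "\<gamma> \<in> arrows G"
  let ?R = "\<O> (r \<gamma>)"
  interpret R: ring ?R using \<gamma> by (rule stalk_rng)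
  let ?A = "{\<beta> \<in> supp f. r \<beta> = r \<gamma>}"
  let ?g = "\<lambda>g \<beta>. act S \<beta> (g (ldiv \<beta> \<gamma>))"
  have A: "\<beta> \<in> arrows G" "r \<beta> = r \<gamma>" if "\<beta> \<in> ?A" for \<beta> using that by (auto simp: supp_def)
  have cl_f: "f \<beta> \<in> carrier ?R" if "\<beta> \<in> ?A" for \<beta>
    using Gamma_closed[OF f, of \<beta>] A[OF that] by simp
  have cl_g: "?g h \<beta> \<in> carrier ?R" if "\<beta> \<in> ?A" "h \<in> carrier sections" for h \<beta>
    using A[OF that(1)] \<gamma> act_closed[of \<beta> "h (ldiv \<beta> \<gamma>)"]
      section_closed[OF that(2), of "ldiv \<beta> \<gamma>"] by simp
  have add: "?g (g \<oplus>\<^bsub>\<Gamma>\<^esub> g') \<beta> = ?g g \<beta> \<oplus>\<^bsub>?R\<^esub> ?g g' \<beta>" if "\<beta> \<in> ?A" for \<beta>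
    using A[OF that] \<gamma> act_add[of \<beta> "g (ldiv \<beta> \<gamma>)" "g' (ldiv \<beta> \<gamma>)"]
      section_closed[OF g, of "ldiv \<beta> \<gamma>"] section_closed[OF g', of "ldiv \<beta> \<gamma>"]
    by (simp add: Gamma_apply)
  have "conv f (g \<oplus>\<^bsub>\<Gamma>\<^esub> g') \<gamma> = finsum ?R (\<lambda>\<beta>. f \<beta> \<otimes>\<^bsub>?R\<^esub> ?g (g \<oplus>\<^bsub>\<Gamma>\<^esub> g') \<beta>) ?A"
    using assms \<gamma> by (simp add: convolution_apply_Gamma Gamma_ops)
  also have "\<dots> = finsum ?R (\<lambda>\<beta>. f \<beta> \<otimes>\<^bsub>?R\<^esub> ?g g \<beta> \<oplus>\<^bsub>?R\<^esub> f \<beta> \<otimes>\<^bsub>?R\<^esub> ?g g' \<beta>) ?A"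
    using cl_f cl_g g g' add by (intro R.finsum_cong') (auto simp: R.r_distr)
  also have "\<dots> = conv f g \<gamma> \<oplus>\<^bsub>?R\<^esub> conv f g' \<gamma>"
    using cl_f cl_g assms \<gamma> by (simp add: R.finsum_addf Pi_iff convolution_apply_Gamma)
  finally show "conv f (g \<oplus>\<^bsub>\<Gamma>\<^esub> g') \<gamma> = (conv f g \<oplus>\<^bsub>\<Gamma>\<^esub> conv f g') \<gamma>"
    using \<gamma> by (simp add: Gamma_apply)
qed

text \<open>Stated in the group of all sections, as \<open>conv f g\<close> is not yet known to lie in \<open>\<Gamma>\<close>.\<close>

lemma convolution_diff:
  shows "f \<in> carrier \<Gamma> \<Longrightarrow> f' \<in> carrier \<Gamma> \<Longrightarrow> g \<in> carrier sections \<Longrightarrow> conv (f \<ominus>\<^bsub>\<Gamma>\<^esub> f') g =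
      conv f g \<otimes>\<^bsub>sections\<^esub> inv\<^bsub>sections\<^esub> conv f' g"
    and "f \<in> carrier \<Gamma> \<Longrightarrow> g \<in> carrier \<Gamma> \<Longrightarrow> g' \<in> carrier \<Gamma> \<Longrightarrow> conv f (g \<ominus>\<^bsub>\<Gamma>\<^esub> g') =
      conv f g \<otimes>\<^bsub>sections\<^esub> inv\<^bsub>sections\<^esub> conv f g'"
proof -
  \<comment> \<open>Both claims follow from additivity applied to \<open>(f - g) + g = f\<close>,
    solved for the first summand in the group of all sections.\<close>
  have cancel: "f \<ominus>\<^bsub>\<Gamma>\<^esub> g \<oplus>\<^bsub>\<Gamma>\<^esub> g = f" if "f \<in> carrier \<Gamma>" "g \<in> carrier \<Gamma>" for f g
    using that by (simp add: a_minus_def Gamma.a_assoc Gamma.l_neg)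
  have solve: "h = k \<otimes>\<^bsub>sections\<^esub> inv\<^bsub>sections\<^esub> l"
    if "k = h \<otimes>\<^bsub>sections\<^esub> l" "h \<in> carrier sections" "l \<in> carrier sections" for h k l
    using that by (simp add: sections.m_assoc)
  show "conv (f \<ominus>\<^bsub>\<Gamma>\<^esub> f') g = conv f g \<otimes>\<^bsub>sections\<^esub> inv\<^bsub>sections\<^esub> conv f' g"
    if "f \<in> carrier \<Gamma>" "f' \<in> carrier \<Gamma>" "g \<in> carrier sections"
    using convolution_add_left[of "f \<ominus>\<^bsub>\<Gamma>\<^esub> f'" f' g] that
    unfolding cancel[OF that(1,2)] by (intro solve) (auto simp: Gamma_ops(1) convolution_closed Gamma_sections)
  show "conv f (g \<ominus>\<^bsub>\<Gamma>\<^esub> g') = conv f g \<otimes>\<^bsub>sections\<^esub> inv\<^bsub>sections\<^esub> conv f g'"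
    if "f \<in> carrier \<Gamma>" "g \<in> carrier \<Gamma>" "g' \<in> carrier \<Gamma>"
    using convolution_add_right[of f "g \<ominus>\<^bsub>\<Gamma>\<^esub> g'" g'] that
    unfolding cancel[OF that(2,3)] by (intro solve) (auto simp: Gamma_ops(1) convolution_closed Gamma_sections)
qed

end

section \<open>Products of compact open bisections, and closure under convolution\<close>

context ample_groupoid
begin

text \<open>\<open>T\<close> is the set of all products of an arrow of \<open>U\<close> with a
  composable arrow of \<open>V\<close>. It is written through the factorization: the only arrow of
  \<open>U\<close> with range \<open>r \<gamma>\<close> is \<open>inv_into U r (r \<gamma>)\<close>,
  which determines the other factor. Thus openness of \<open>T\<close> and continuity of both
  factors can be read off.\<close>

lemma compact_open_bisection_mult:
  assumes U: "compact_open X U" "bisection G U" and V: "compact_open X V" "bisection G V"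
  defines "T \<equiv> {\<gamma> \<in> arrows G. r \<gamma> \<in> r ` U \<and> ldiv (inv_into U r (r \<gamma>)) \<gamma> \<in> V}"
  shows "compact_open X T" "bisection G T"
    and "continuous_map (subtopology X T) X (\<lambda>\<gamma>. inv_into U r (r \<gamma>))"
    and "continuous_map (subtopology X T) X
      (\<lambda>\<gamma>. ldiv (inv_into U r (r \<gamma>)) \<gamma>)"
proof -
  let ?\<sigma> = "\<lambda>\<gamma>. inv_into U r (r \<gamma>)"
  let ?\<kappa> = "\<lambda>\<gamma>. ldiv (?\<sigma> \<gamma>) \<gamma>"
  let ?D = "{\<gamma> \<in> arrows G. r \<gamma> \<in> r ` U}"
  have oU: "openin X U" and oV: "openin X V"
    and cU: "compactin X U" and cV: "compactin X V"
    using U V by (auto simp: compact_open_def)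
  have UA: "U \<subseteq> arrows G" and VA: "V \<subseteq> arrows G" using U(2) V(2) by (auto simp: bisection_def)
  have iU: "inj_on r U" "inj_on d U" and iV: "inj_on r V" "inj_on d V"
    using U(2) V(2) by (auto simp: bisection_def)
  have \<sigma>: "?\<sigma> \<gamma> \<in> U" "?\<sigma> \<gamma> \<in> arrows G" "r (?\<sigma> \<gamma>) = r \<gamma>" if "r \<gamma> \<in> r ` U" for \<gamma>
    using that UA by (auto simp: inv_into_into f_inv_into_f intro!: subsetD[OF UA])
  have topD: "topspace (subtopology X ?D) = ?D" by auto
  have "continuous_map (subtopology X ?D) (subtopology X0 (r ` U)) r"
    using rng_continuous by (intro continuous_map_into_subtopology continuous_map_from_subtopology) auto
  from continuous_map_compose[OF this bisection_rng_section[OF oU U(2)]]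
  have c\<sigma>: "continuous_map (subtopology X ?D) X ?\<sigma>" by (simp add: o_def)
  have c\<sigma>': "continuous_map (subtopology X ?D) X (\<lambda>\<gamma>. ginv G (?\<sigma> \<gamma>))"
    using continuous_map_compose[OF c\<sigma> inv_continuous] by (simp add: o_def)
  have c\<kappa>: "continuous_map (subtopology X ?D) X ?\<kappa>"
    using c\<sigma>' by (intro continuous_map_mult) (use \<sigma> in \<open>auto intro: continuous_map_from_subtopology\<close>)
  have TD: "T = {\<gamma> \<in> ?D. ?\<kappa> \<gamma> \<in> V}" by (auto simp: T_def)
  have "openin (subtopology X ?D) T"
    unfolding TD using openin_continuous_map_preimage[OF c\<kappa> oV] unfolding topD .
  moreover have "openin X ?D"
    using openin_rng_preimage[OF openin_rng_image[OF oU]] .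
  ultimately have oT: "openin X T" by (rule openin_trans_full)
  have split: "\<gamma> = gmult G (?\<sigma> \<gamma>) (?\<kappa> \<gamma>)" "d (?\<sigma> \<gamma>) = r (?\<kappa> \<gamma>)" "d \<gamma> = d (?\<kappa> \<gamma>)"
    if "\<gamma> \<in> ?D" for \<gamma>
    using that \<sigma>[of \<gamma>] by simp_all
  have iT: "inj_on r T"
  proof (rule inj_onI)
    fix \<gamma> \<delta> assume *: "\<gamma> \<in> T" "\<delta> \<in> T" "r \<gamma> = r \<delta>"
    then have D: "\<gamma> \<in> ?D" "\<delta> \<in> ?D" "?\<kappa> \<gamma> \<in> V" "?\<kappa> \<delta> \<in> V" by (auto simp: TD)
    have eq: "?\<sigma> \<gamma> = ?\<sigma> \<delta>" using * by simp
    then have "r (?\<kappa> \<gamma>) = r (?\<kappa> \<delta>)" using split(2)[OF D(1)] split(2)[OF D(2)] by simp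
    then have "?\<kappa> \<gamma> = ?\<kappa> \<delta>" using D(3,4) by (rule inj_onD[OF iV(1)])
    then show "\<gamma> = \<delta>" using split(1)[OF D(1)] split(1)[OF D(2)] eq by simp
  qed
  have "inj_on d T"
  proof (rule inj_onI)
    fix \<gamma> \<delta> assume *: "\<gamma> \<in> T" "\<delta> \<in> T" "d \<gamma> = d \<delta>"
    then have D: "\<gamma> \<in> ?D" "\<delta> \<in> ?D" "?\<kappa> \<gamma> \<in> V" "?\<kappa> \<delta> \<in> V" by (auto simp: TD)
    have "d (?\<kappa> \<gamma>) = d (?\<kappa> \<delta>)" using *(3) split(3)[OF D(1)] split(3)[OF D(2)] by simp
    then have eq: "?\<kappa> \<gamma> = ?\<kappa> \<delta>" using D(3,4) by (rule inj_onD[OF iV(2)])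
    then have "d (?\<sigma> \<gamma>) = d (?\<sigma> \<delta>)" using split(2)[OF D(1)] split(2)[OF D(2)] by simp
    then have "?\<sigma> \<gamma> = ?\<sigma> \<delta>" by (rule inj_onD[OF iU(2)]) (use D(1,2) \<sigma>(1) in blast)+
    then show "\<gamma> = \<delta>" using split(1)[OF D(1)] split(1)[OF D(2)] eq by simp
  qed
  then show "bisection G T" using iT openin_subset[OF oT] by (simp add: bisection_def)
  show "continuous_map (subtopology X T) X ?\<sigma>"
    using c\<sigma> by (rule continuous_map_from_subtopology_mono) (auto simp: TD)
  show "continuous_map (subtopology X T) X ?\<kappa>"
    using c\<kappa> by (rule continuous_map_from_subtopology_mono) (auto simp: TD)
  let ?C = "{\<beta> \<in> arrows G. d \<beta> \<in> r ` V} \<inter> U"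
  let ?\<tau> = "inv_into V r"
  have \<tau>: "?\<tau> y \<in> V" "?\<tau> y \<in> arrows G" "r (?\<tau> y) = y" if "y \<in> r ` V" for y
    using that VA by (auto simp: inv_into_into f_inv_into_f intro!: subsetD[OF VA])
  \<comment> \<open>For compactness \<open>T\<close> is presented as a continuous image of
    \<open>?C\<close>, the arrows of \<open>U\<close> that can be followed by one of
    \<open>V\<close>. Compact sets of units are closed, so \<open>?C\<close> is the intersection of
    the compact \<open>U\<close> with a closed set.\<close>
  have "compactin X0 (r ` V)" using cV rng_continuous by (rule image_compactin)
  then have "closedin X {\<beta> \<in> arrows G. d \<beta> \<in> r ` V}"
    using closedin_continuous_map_preimage[OF dom_continuous compactin_imp_closedin_unit_space] by simp
  then have cC: "compactin X ?C" using cU by (rule closed_Int_compactin)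
  have "continuous_map (subtopology X ?C) (subtopology X0 (r ` V)) d"
    using dom_continuous by (intro continuous_map_into_subtopology continuous_map_from_subtopology) auto
  from continuous_map_compose[OF this bisection_rng_section[OF oV V(2)]]
  have "continuous_map (subtopology X ?C) X (\<lambda>\<beta>. ?\<tau> (d \<beta>))" by (simp add: o_def)
  then have "continuous_map (subtopology X ?C) X (\<lambda>\<beta>. gmult G \<beta> (?\<tau> (d \<beta>)))"
    by (intro continuous_map_mult) (use \<tau> in \<open>auto intro: continuous_map_from_subtopology\<close>)
  then have "compactin X ((\<lambda>\<beta>. gmult G \<beta> (?\<tau> (d \<beta>))) ` ?C)"
    using cC by (intro image_compactin) (auto simp: compactin_subtopology)
  moreover have "(\<lambda>\<beta>. gmult G \<beta> (?\<tau> (d \<beta>))) ` ?C = T"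
  proof (intro equalityI subsetI)
    fix \<gamma> assume "\<gamma> \<in> (\<lambda>\<beta>. gmult G \<beta> (?\<tau> (d \<beta>))) ` ?C"
    then obtain \<beta> where \<beta>: "\<beta> \<in> arrows G" "\<beta> \<in> U" "d \<beta> \<in> r ` V" "\<gamma> = gmult G \<beta> (?\<tau> (d \<beta>))" by auto
    note t = \<tau>[OF \<beta>(3)]
    have \<gamma>: "\<gamma> \<in> arrows G" "r \<gamma> = r \<beta>" using \<beta> t by simp_all
    then have "?\<sigma> \<gamma> = \<beta>" using \<beta>(2) iU(1) by simp
    then have "?\<kappa> \<gamma> = ?\<tau> (d \<beta>)" using \<beta> t by simp
    then show "\<gamma> \<in> T" using \<gamma> \<beta>(2) t by (simp add: T_def)
  next
    fix \<gamma> assume "\<gamma> \<in> T"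
    then have D: "\<gamma> \<in> ?D" "?\<kappa> \<gamma> \<in> V" by (auto simp: TD)
    then have "?\<tau> (r (?\<kappa> \<gamma>)) = ?\<kappa> \<gamma>" using iV(1) by (intro inv_into_f_f)
    then have "\<gamma> = gmult G (?\<sigma> \<gamma>) (?\<tau> (d (?\<sigma> \<gamma>)))" using split(1,2)[OF D(1)] by simp
    moreover have "?\<sigma> \<gamma> \<in> ?C" 
    proof -
      have "d (?\<sigma> \<gamma>) \<in> r ` V" using split(2)[OF D(1)] D(2) by (rule image_eqI)
      then show ?thesis using D(1) \<sigma>[of \<gamma>] by simp
    qed
    ultimately show "\<gamma> \<in> (\<lambda>\<beta>. gmult G \<beta> (?\<tau> (d \<beta>))) ` ?C" by (rule image_eqI)
  qed
  ultimately have "compactin X T" by simp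
  then show "compact_open X T"
    using oT iT Hausdorff_subtopology_inj_rng[of T] openin_subset[OF oT] by (simp add: compact_open_def)
qed

end

context ample_groupoid_sheaf
begin

lemma continuous_map_stalkwise:
  assumes "continuous_map (fibre_square S) (etop S) (\<lambda>(a, b). h a b)"
    and "continuous_map T (etop S) f" "continuous_map T (etop S) g"
    and "\<And>x. x \<in> topspace T \<Longrightarrow> proj S (f x) = proj S (g x)"
  shows "continuous_map T (etop S) (\<lambda>x. h (f x) (g x))"
proof -
  have "continuous_map T (fibre_square S) (\<lambda>x. (f x, g x))"
    using assms(2-4) by (auto simp: fibre_square_def continuous_map_in_subtopology intro!: continuous_map_pairedI)
  from continuous_map_compose[OF this assms(1)] show ?thesis by (simp add: o_def)
qed

lemmas continuous_map_stalk_add = continuous_map_stalkwise[OF sheaf.add_continuous]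
lemmas continuous_map_stalk_mult = continuous_map_stalkwise[OF sheaf.mult_continuous]

lemma continuous_map_act:
  assumes "continuous_map T X f" "continuous_map T (etop S) g"
    and "\<And>x. x \<in> topspace T \<Longrightarrow> d (f x) = proj S (g x)"
  shows "continuous_map T (etop S) (\<lambda>x. act S (f x) (g x))"
proof -
  have "continuous_map T (subtopology (prod_topology X (etop S)) {(\<gamma>, e). d \<gamma> = proj S e}) (\<lambda>x. (f x, g x))"
    using assms by (auto simp: continuous_map_in_subtopology intro!: continuous_map_pairedI)
  from continuous_map_compose[OF this sheaf.act_continuous] show ?thesis by (simp add: o_def)
qed

text \<open>Over a given range the bisection \<open>U\<close> offers at most one left factor, so the
  convolution sum has at most one term. That term is continuous on the product bisection, since both
  factors and all sheaf operations are.\<close>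

lemma generators_convolution:
  assumes f: "f \<in> generators" and g: "g \<in> generators"
  shows "conv f g \<in> generators"
proof -
  obtain U where U: "compact_open X U" "bisection G U"
      "continuous_map (subtopology X U) (etop S) f" "supp f \<subseteq> U"
    using f by (rule generator_supp)
  obtain V where V: "compact_open X V" "bisection G V"
      "continuous_map (subtopology X V) (etop S) g" "supp g \<subseteq> V"
    using g by (rule generator_supp)
  have fs: "f \<in> carrier sections" and gs: "g \<in> carrier sections" using f g generators_sections by auto
  have UA: "U \<subseteq> arrows G" and iU: "inj_on r U" using U(2) by (auto simp: bisection_def)
  let ?\<sigma> = "\<lambda>\<gamma>. inv_into U r (r \<gamma>)"
  let ?\<kappa> = "\<lambda>\<gamma>. ldiv (?\<sigma> \<gamma>) \<gamma>"
  let ?T = "{\<gamma> \<in> arrows G. r \<gamma> \<in> r ` U \<and> ?\<kappa> \<gamma> \<in> V}"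
  note T = compact_open_bisection_mult[OF U(1,2) V(1,2)]
  have \<sigma>: "?\<sigma> \<gamma> \<in> U" "?\<sigma> \<gamma> \<in> arrows G" "r (?\<sigma> \<gamma>) = r \<gamma>" if "r \<gamma> \<in> r ` U" for \<gamma>
    using that UA by (auto simp: inv_into_into f_inv_into_f intro!: subsetD[OF UA])
  have conv: "conv f g \<gamma> = f (?\<sigma> \<gamma>) \<otimes>\<^bsub>\<O> (r \<gamma>)\<^esub> act S (?\<sigma> \<gamma>) (g (?\<kappa> \<gamma>))"
    if "\<gamma> \<in> arrows G" "r \<gamma> \<in> r ` U" for \<gamma>
  proof -
    interpret R: ring "\<O> (r \<gamma>)" using that(1) by (rule stalk_rng)
    have "conv f g \<gamma> = finsum (\<O> (r \<gamma>))
        (\<lambda>\<beta>. f \<beta> \<otimes>\<^bsub>\<O> (r \<gamma>)\<^esub> act S \<beta> (g (ldiv \<beta> \<gamma>))) {?\<sigma> \<gamma>}"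
    proof (rule convolution_apply[OF fs gs that(1)])
      show "\<beta> \<in> {?\<sigma> \<gamma>}" if "\<beta> \<in> supp f" "r \<beta> = r \<gamma>" for \<beta>
      proof -
        have "?\<sigma> \<beta> = \<beta>" using that(1) U(4) iU by (intro inv_into_f_f) auto
        then show ?thesis using that(2) by simp
      qed
    qed (use \<sigma>[OF that(2)] in auto)
    moreover have "f (?\<sigma> \<gamma>) \<otimes>\<^bsub>\<O> (r \<gamma>)\<^esub> act S (?\<sigma> \<gamma>) (g (?\<kappa> \<gamma>)) \<in> carrier (\<O> (r \<gamma>))"
      using convolution_term_closed[OF fs gs, of "?\<sigma> \<gamma>" "?\<kappa> \<gamma>"] \<sigma>[OF that(2)] that(1) by simp
    ultimately show ?thesis by (simp add: R.finsum_insert)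
  qed
  show ?thesis
  proof (rule generatorI[OF _ T(1,2)])
    show "conv f g \<in> carrier sections" using fs gs by (rule convolution_closed)
    show "supp (conv f g) \<subseteq> ?T"
    proof
      fix \<gamma> assume "\<gamma> \<in> supp (conv f g)"
      then have \<gamma>: "\<gamma> \<in> arrows G" and nz: "conv f g \<gamma> \<noteq> \<zero>\<^bsub>\<O> (r \<gamma>)\<^esub>" by (auto simp: supp_def)
      interpret R: ring "\<O> (r \<gamma>)" using \<gamma> by (rule stalk_rng)
      have U\<gamma>: "r \<gamma> \<in> r ` U"
      proof (rule ccontr)
        assume *: "r \<gamma> \<notin> r ` U"
        have "conv f g \<gamma> = finsum (\<O> (r \<gamma>))
            (\<lambda>\<beta>. f \<beta> \<otimes>\<^bsub>\<O> (r \<gamma>)\<^esub> act S \<beta> (g (ldiv \<beta> \<gamma>))) {}"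
        proof (rule convolution_apply[OF fs gs \<gamma>])
          show "\<beta> \<in> {}" if "\<beta> \<in> supp f" "r \<beta> = r \<gamma>" for \<beta>
            using that U(4) * by (metis imageI subsetD)
        qed auto
        then show False using nz by simp
      qed
      note s = \<sigma>[OF U\<gamma>]
      have "?\<kappa> \<gamma> \<in> V"
      proof (rule ccontr)
        assume "?\<kappa> \<gamma> \<notin> V"
        then have "?\<kappa> \<gamma> \<notin> supp g" using V(4) by blast
        then have "g (?\<kappa> \<gamma>) = \<zero>\<^bsub>\<O> (d (?\<sigma> \<gamma>))\<^esub>"
          using s \<gamma> not_supp[of "?\<kappa> \<gamma>" g] by simp
        then have "act S (?\<sigma> \<gamma>) (g (?\<kappa> \<gamma>)) = \<zero>\<^bsub>\<O> (r \<gamma>)\<^esub>" using s by (simp add: act_zero)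
        moreover have "f (?\<sigma> \<gamma>) \<in> carrier (\<O> (r \<gamma>))" using section_closed[OF fs s(2)] s by simp
        ultimately show False using nz conv[OF \<gamma> U\<gamma>] by simp
      qed
      then show "\<gamma> \<in> ?T" using \<gamma> U\<gamma> by simp
    qed
    have top: "topspace (subtopology X ?T) = ?T" by auto
    have T_U: "continuous_map (subtopology X ?T) (subtopology X U) ?\<sigma>"
      using T(3) by (rule continuous_map_into_subtopology) (use \<sigma>(1) in auto)
    have T_V: "continuous_map (subtopology X ?T) (subtopology X V) ?\<kappa>"
      using T(4) by (rule continuous_map_into_subtopology) auto
    have stalks: "f (?\<sigma> \<gamma>) \<in> carrier (\<O> (r \<gamma>))" "g (?\<kappa> \<gamma>) \<in> carrier (\<O> (d (?\<sigma> \<gamma>)))"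
        "act S (?\<sigma> \<gamma>) (g (?\<kappa> \<gamma>)) \<in> carrier (\<O> (r \<gamma>))" if "\<gamma> \<in> ?T" for \<gamma>
      using that \<sigma>[of \<gamma>] section_closed[OF fs, of "?\<sigma> \<gamma>"] section_closed[OF gs, of "?\<kappa> \<gamma>"]
        act_closed[of "?\<sigma> \<gamma>" "g (?\<kappa> \<gamma>)"] by simp_all
    have "continuous_map (subtopology X ?T) (etop S) (\<lambda>\<gamma>. f (?\<sigma> \<gamma>))"
      using continuous_map_compose[OF T_U U(3)] by (simp add: o_def)
    moreover have "continuous_map (subtopology X ?T) (etop S) (\<lambda>\<gamma>. act S (?\<sigma> \<gamma>) (g (?\<kappa> \<gamma>)))"
      using continuous_map_compose[OF T_V V(3)] stalks(2)
      by (intro continuous_map_act T(3)) (auto simp: o_def stalk_carrier)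
    ultimately have "continuous_map (subtopology X ?T) (etop S) (\<lambda>\<gamma>. emult S (f (?\<sigma> \<gamma>)) (act S (?\<sigma> \<gamma>) (g (?\<kappa> \<gamma>))))"
    proof (rule continuous_map_stalk_mult)
      fix \<gamma> assume "\<gamma> \<in> topspace (subtopology X ?T)"
      then show "proj S (f (?\<sigma> \<gamma>)) = proj S (act S (?\<sigma> \<gamma>) (g (?\<kappa> \<gamma>)))"
        unfolding top using stalks(1,3)[of \<gamma>] by (simp only: stalk_carrier)
    qed
    then show "continuous_map (subtopology X ?T) (etop S) (conv f g)"
      by (rule continuous_map_eq) (auto simp: conv stalk_ops)
  qed
qed

text \<open>Biadditivity reduces the claim to generators by two inductions: first on the right
  factor with a generator on the left, then on the left factor.\<close>

lemma Gamma_mult_closed: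
  assumes "f \<in> carrier \<Gamma>" "g \<in> carrier \<Gamma>"
  shows "f \<otimes>\<^bsub>\<Gamma>\<^esub> g \<in> carrier \<Gamma>"
proof -
  interpret sub: subgroup "carrier \<Gamma>" sections by (rule Gamma_subgroup)
  have gen: "conv f g \<in> carrier \<Gamma>" if f: "f \<in> generators" and "g \<in> carrier \<Gamma>" for f g
    using that(2)
  proof (induction rule: Gamma_induct)
    case (generator g)
    then show ?case using generators_convolution[OF f] generators_Gamma by blast
  next
    case (diff g g')
    then show ?case using convolution_diff(2)[OF generators_Gamma[OF f]] by simp
  qed
  have "conv f g \<in> carrier \<Gamma>"
    using assms(1)
  proof (induction rule: Gamma_induct)
    case (generator f)
    then show ?case using gen assms(2) by simp
  next
    case (diff f f')
    then show ?case using convolution_diff(1) Gamma_sections[OF assms(2)] by simp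
  qed
  then show ?thesis by (simp add: Gamma_ops)
qed

end

section \<open>Germs\<close>

context ample_groupoid_sheaf
begin

text \<open>Here \<open>s\<close> is a total function of which only the behaviour near
  \<open>y\<close> is constrained. With no domain attached, equalities between local sections become
  statements about the filter \<open>near y\<close>.\<close>

definition local_section :: "'g \<Rightarrow> ('g \<Rightarrow> 'e) \<Rightarrow> bool"
  where "local_section y s \<longleftrightarrow> (\<exists>V. openin X0 V \<and> y \<in> V \<and>
    continuous_map (subtopology X0 V) (etop S) s \<and> (\<forall>z\<in>V. s z \<in> carrier (\<O> z)))"

abbreviation near :: "'g \<Rightarrow> 'g filter"
  where "near \<equiv> nhdsin X0"

lemma eventually_nhdsin_openin:
  "openin X0 V \<Longrightarrow> y \<in> V \<Longrightarrow> \<forall>\<^sub>F z in near y. z \<in> V"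
  unfolding eventually_nhdsin by blast

lemma eventually_units: "y \<in> units G \<Longrightarrow> \<forall>\<^sub>F z in near y. z \<in> units G"
  using openin_topspace[of X0] by (intro eventually_nhdsin_openin) simp_all

lemma local_section_units: "local_section y s \<Longrightarrow> y \<in> units G"
  using openin_subset unfolding local_section_def by fastforce

lemma local_section_closed:
  assumes "local_section y s"
  shows "\<forall>\<^sub>F z in near y. s z \<in> carrier (\<O> z)"
  using assms unfolding local_section_def eventually_nhdsin by blast

lemma local_section_common:
  assumes "local_section y s" "local_section y t"
  obtains V where "openin X0 V" "y \<in> V"
    "continuous_map (subtopology X0 V) (etop S) s" "continuous_map (subtopology X0 V) (etop S) t"
    "\<forall>z\<in>V. s z \<in> carrier (\<O> z)" "\<forall>z\<in>V. t z \<in> carrier (\<O> z)"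
proof -
  obtain V V' where V: "openin X0 V" "y \<in> V" "continuous_map (subtopology X0 V) (etop S) s" "\<forall>z\<in>V. s z \<in> carrier (\<O> z)"
    and V': "openin X0 V'" "y \<in> V'" "continuous_map (subtopology X0 V') (etop S) t" "\<forall>z\<in>V'. t z \<in> carrier (\<O> z)"
    using assms unfolding local_section_def by blast
  show ?thesis
    by (rule that[of "V \<inter> V'"]) (use V V' in \<open>auto elim: continuous_map_from_subtopology_mono\<close>)
qed

lemma local_section_agree:
  assumes s: "local_section y s" and t: "local_section y t" and eq: "s y = t y"
  shows "\<forall>\<^sub>F z in near y. s z = t z"
proof -
  obtain V where V: "openin X0 V" "y \<in> V"
    "continuous_map (subtopology X0 V) (etop S) s" "continuous_map (subtopology X0 V) (etop S) t"
    "\<forall>z\<in>V. s z \<in> carrier (\<O> z)" "\<forall>z\<in>V. t z \<in> carrier (\<O> z)"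
    using local_section_common[OF s t] .
  obtain W' where "openin X0 W'" "y \<in> W'" "\<And>z. z \<in> W' \<Longrightarrow> s z = t z"
    by (rule sections_agree_locally[OF sheaf.proj_local_homeomorphism V(1,2,3) _ V(4) _ eq])
      (use V(5,6) in \<open>auto simp: stalk_carrier\<close>)
  then show ?thesis unfolding eventually_nhdsin by blast
qed

lemma local_section_add:
  assumes s: "local_section y s" and t: "local_section y t"
  shows "local_section y (\<lambda>z. s z \<oplus>\<^bsub>\<O> z\<^esub> t z)"
proof -
  obtain V where V: "openin X0 V" "y \<in> V"
    "continuous_map (subtopology X0 V) (etop S) s" "continuous_map (subtopology X0 V) (etop S) t"
    "\<forall>z\<in>V. s z \<in> carrier (\<O> z)" "\<forall>z\<in>V. t z \<in> carrier (\<O> z)"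
    using local_section_common[OF s t] .
  have "continuous_map (subtopology X0 V) (etop S) (\<lambda>z. eadd S (s z) (t z))"
    using V(3,4)
  proof (rule continuous_map_stalk_add)
    show "proj S (s z) = proj S (t z)" if "z \<in> topspace (subtopology X0 V)" for z
      using that V(5,6) by (simp add: stalk_carrier)
  qed
  moreover have "s z \<oplus>\<^bsub>\<O> z\<^esub> t z \<in> carrier (\<O> z)" if z: "z \<in> V" for z
  proof -
    interpret R: ring "\<O> z" using openin_subset[OF V(1)] z by (intro sheaf.stalk_ring) auto
    show ?thesis using V(5,6) z by simp
  qed
  ultimately show ?thesis
    unfolding local_section_def using V(1,2) by (intro exI[of _ V]) (simp add: stalk_ops)
qed

text \<open>A local section \<open>s\<close> with \<open>s y = 0\<close> and \<open>s + s\<close> agree at \<open>y\<close>, hence near \<open>y\<close>. In this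
  way continuity of the zero section follows from that of the addition.\<close>

lemma local_section_zero:
  assumes s: "local_section y s" and zero: "s y = \<zero>\<^bsub>\<O> y\<^esub>"
  shows "\<forall>\<^sub>F z in near y. s z = \<zero>\<^bsub>\<O> z\<^esub>"
proof -
  have y: "y \<in> units G" using s by (rule local_section_units)
  interpret R: ring "\<O> y" using y by (rule sheaf.stalk_ring)
  have "\<forall>\<^sub>F z in near y. s z \<oplus>\<^bsub>\<O> z\<^esub> s z = s z"
    using local_section_add[OF s s] s by (rule local_section_agree) (simp add: zero)
  moreover have "\<forall>\<^sub>F z in near y. z \<in> units G" using y by (rule eventually_units)
  ultimately show ?thesis
    using local_section_closed[OF s]
  proof eventually_elim
    case (elim z)
    then interpret R: ring "\<O> z" by (intro sheaf.stalk_ring)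
    show ?case using elim by (simp add: R.add.l_cancel_one)
  qed
qed

text \<open>An arbitrary choice of a local section through \<open>e\<close>. It is determined only
  up to equality near \<open>proj S e\<close>, so every identity between germs below holds
  eventually rather than everywhere.\<close>

definition germ :: "'e \<Rightarrow> 'g \<Rightarrow> 'e"
  where "germ e = (SOME s. local_section (proj S e) s \<and> s (proj S e) = e)"

lemma germ:
  assumes "e \<in> carrier (\<O> y)"
  shows "local_section y (germ e)" "germ e y = e"
proof -
  have e: "e \<in> topspace (etop S)" "proj S e = y" using assms by (simp_all only: stalk_carrier)
  obtain U where U: "openin (etop S) U" "e \<in> U" "inj_on (proj S) U"
    using local_homeomorphism_injective_nbhd[OF sheaf.proj_local_homeomorphism e(1)] by blast
  have "openin X0 (proj S ` U)"
    using local_homeomorphism_imp_open_map[OF sheaf.proj_local_homeomorphism] U(1) by (simp add: open_map_def)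
  moreover have "continuous_map (subtopology X0 (proj S ` U)) (etop S) (inv_into U (proj S))"
    using sheaf.proj_local_homeomorphism U(1,3) by (rule local_homeomorphism_inverse_continuous)
  moreover have "inv_into U (proj S) z \<in> carrier (\<O> z)" if "z \<in> proj S ` U" for z
    using that openin_subset[OF U(1)] inv_into_into[of z "proj S" U]
    by (auto simp: stalk_carrier f_inv_into_f)
  ultimately have "local_section y (inv_into U (proj S))"
    unfolding local_section_def using U(2) e(2) by (intro exI[of _ "proj S ` U"]) auto
  moreover have "inv_into U (proj S) y = e" using U(2,3) e(2) inv_into_f_f by metis
  ultimately have "\<exists>s. local_section y s \<and> s y = e" by blast
  then show "local_section y (germ e)" "germ e y = e"
    unfolding germ_def e(2) by (rule someI2_ex, simp)+
qed

lemma germ_zero: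
  assumes "y \<in> units G"
  shows "\<forall>\<^sub>F z in near y. germ \<zero>\<^bsub>\<O> y\<^esub> z = \<zero>\<^bsub>\<O> z\<^esub>"
proof -
  interpret R: ring "\<O> y" using assms by (rule sheaf.stalk_ring)
  show ?thesis using germ[OF R.zero_closed] by (rule local_section_zero)
qed

text \<open>Chosen sections do not respect the ring operations, but two local sections with the same
  value at \<open>y\<close> agree near \<open>y\<close>. The identity is put as a sum because it is
  addition whose continuity is given.\<close>

lemma germ_diff:
  assumes y: "y \<in> units G" and a: "a \<in> carrier (\<O> y)" and b: "b \<in> carrier (\<O> y)"
  shows "\<forall>\<^sub>F z in near y. germ (a \<ominus>\<^bsub>\<O> y\<^esub> b) z \<oplus>\<^bsub>\<O> z\<^esub> germ b z = germ a z"
proof -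
  interpret R: ring "\<O> y" using y by (rule sheaf.stalk_ring)
  have "a \<ominus>\<^bsub>\<O> y\<^esub> b \<in> carrier (\<O> y)" "a \<ominus>\<^bsub>\<O> y\<^esub> b \<oplus>\<^bsub>\<O> y\<^esub> b = a"
    using a b by (simp_all add: a_minus_def R.a_assoc R.l_neg)
  then show ?thesis
    using germ germ[OF a] germ[OF b] by (intro local_section_agree local_section_add) simp_all
qed

text \<open>Near a unit \<open>y\<close>, an element of \<open>\<Gamma>\<close> is the sum of the local sections determined by its values
  on \<open>r\<^sup>-\<^sup>1(y)\<close>, each spread over an open set around the arrow in question on which \<open>r\<close> is injective.
  In the non-Hausdorff case these sets may overlap arbitrarily close to \<open>y\<close>, so the sum cannot be
  replaced by a case distinction.\<close>

definition spread :: "('g \<Rightarrow> 'g set) \<Rightarrow> ('g \<Rightarrow> 'e) \<Rightarrow> 'g \<Rightarrow> 'g \<Rightarrow> 'e"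
  where "spread B f \<beta> \<gamma> = (if \<gamma> \<in> B \<beta> then germ (f \<beta>) (r \<gamma>) else \<zero>\<^bsub>\<O> (r \<gamma>)\<^esub>)"

text \<open>The neighbourhood of \<open>y\<close> is uniform in \<gamma>: for each \<open>z\<close>
  in it the formula holds at all arrows over \<open>z\<close> simultaneously, however many there
  are.\<close>

definition represents :: "('g \<Rightarrow> 'g set) \<Rightarrow> 'g set \<Rightarrow> 'g \<Rightarrow> ('g \<Rightarrow> 'e) \<Rightarrow> bool"
  where "represents B A y f \<longleftrightarrow> (\<forall>\<^sub>F z in near y. \<forall>\<gamma>\<in>arrows G. r \<gamma> = z \<longrightarrow>
    f \<gamma> = finsum (\<O> z) (\<lambda>\<beta>. spread B f \<beta> \<gamma>) A)"

text \<open>At most one arrow of \<open>U\<close> lies over \<open>y\<close>. If there is one,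
  \<open>f\<close> moves along \<open>U\<close> as a local section with the same value at
  \<open>y\<close> as the chosen germ; if there is none, \<open>f\<close> vanishes near
  \<open>y\<close>. Further arrows in \<open>A\<close> contribute germs of zero, which are zero near
  \<open>y\<close>, so \<open>A\<close> can be any finite enlargement.\<close>

lemma generator_spread:
  assumes f: "f \<in> generators" and y: "y \<in> units G"
    and B: "\<And>\<beta>. \<beta> \<in> arrows G \<Longrightarrow> openin X (B \<beta>) \<and> \<beta> \<in> B \<beta> \<and> inj_on r (B \<beta>)"
    and U: "compact_open X U" "bisection G U"
      "continuous_map (subtopology X U) (etop S) f" "supp f \<subseteq> U"
    and A: "finite A" "{\<beta> \<in> U. r \<beta> = y} \<subseteq> A" "A \<subseteq> {\<beta> \<in> arrows G. r \<beta> = y}"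
  shows "represents B A y f"
proof -
  have oU: "openin X U" and UA: "U \<subseteq> arrows G" and iU: "inj_on r U"
    using U by (auto simp: compact_open_def bisection_def)
  have fs: "f \<in> carrier sections" using f generators_sections by auto
  have units: "\<forall>\<^sub>F z in near y. z \<in> units G" using y by (rule eventually_units)
  have zero: "\<forall>\<^sub>F z in near y. \<forall>\<beta>\<in>A - {\<beta> \<in> U. r \<beta> = y}. germ (f \<beta>) z = \<zero>\<^bsub>\<O> z\<^esub>"
  proof (rule eventually_ball_finite)
    show "\<forall>\<beta>\<in>A - {\<beta> \<in> U. r \<beta> = y}. \<forall>\<^sub>F z in near y. germ (f \<beta>) z = \<zero>\<^bsub>\<O> z\<^esub>"
    proof
      fix \<beta> assume \<beta>: "\<beta> \<in> A - {\<beta> \<in> U. r \<beta> = y}"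
      then have "\<beta> \<in> arrows G" "r \<beta> = y" "\<beta> \<notin> supp f" using A(3) U(4) by auto
      then have "f \<beta> = \<zero>\<^bsub>\<O> y\<^esub>" using not_supp[of \<beta> f] by simp
      then show "\<forall>\<^sub>F z in near y. germ (f \<beta>) z = \<zero>\<^bsub>\<O> z\<^esub>"
        using germ_zero[OF y] by simp
    qed
  qed (use A(1) in simp)
  show ?thesis
  proof (cases "y \<in> r ` U")
    case False
    have "compactin X0 (r ` U)"
      using U(1) rng_continuous by (intro image_compactin) (auto simp: compact_open_def)
    then have "openin X0 (units G - r ` U)"
      using openin_diff[OF openin_topspace compactin_imp_closedin_unit_space, of "r ` U"] by simp
    then have "\<forall>\<^sub>F z in near y. z \<in> units G - r ` U"
      using y False by (intro eventually_nhdsin_openin) auto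
    then show ?thesis
      unfolding represents_def using zero
    proof eventually_elim
      case (elim z)
      then interpret R: ring "\<O> z" by (intro sheaf.stalk_ring) simp
      have "{\<beta> \<in> U. r \<beta> = y} = {}" using False by auto
      then have "spread B f \<beta> \<gamma> = \<zero>\<^bsub>\<O> z\<^esub>" if "\<beta> \<in> A" "r \<gamma> = z" for \<beta> \<gamma>
        using elim that by (simp add: spread_def)
      moreover have "f \<gamma> = \<zero>\<^bsub>\<O> z\<^esub>" if "\<gamma> \<in> arrows G" "r \<gamma> = z" for \<gamma>
      proof -
        have "\<gamma> \<notin> supp f" using elim that U(4) by auto
        then show ?thesis using not_supp[of \<gamma> f] that by simp
      qed
      ultimately show ?case by (simp add: R.add.finprod_one_eqI)
    qed
  next
    case True
    then obtain \<beta>0 where \<beta>0: "\<beta>0 \<in> U" "r \<beta>0 = y" by auto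
    have A0: "{\<beta> \<in> U. r \<beta> = y} = {\<beta>0}" using \<beta>0 iU by (auto dest: inj_onD)
    have \<beta>0A: "\<beta>0 \<in> arrows G" using \<beta>0 UA by auto
    have f\<beta>0: "f \<beta>0 \<in> carrier (\<O> y)" using section_closed[OF fs \<beta>0A] \<beta>0 by simp
    let ?s = "\<lambda>z. f (inv_into U r z)"
    have "local_section y ?s"
      unfolding local_section_def
    proof (intro exI conjI ballI)
      show "openin X0 (r ` U)" using oU by (rule openin_rng_image)
      show "y \<in> r ` U" by (rule True)
      have "continuous_map (subtopology X0 (r ` U)) (subtopology X U) (inv_into U r)"
        using bisection_rng_section[OF oU U(2)]
        by (rule continuous_map_into_subtopology) (auto simp: inv_into_into)
      from continuous_map_compose[OF this U(3)]
      show "continuous_map (subtopology X0 (r ` U)) (etop S) ?s" by (simp add: o_def)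
      fix z assume z: "z \<in> r ` U"
      then have "inv_into U r z \<in> arrows G" using UA inv_into_into[OF z] by blast
      then show "?s z \<in> carrier (\<O> z)" using section_closed[OF fs] f_inv_into_f[OF z] by metis
    qed
    then have "\<forall>\<^sub>F z in near y. ?s z = germ (f \<beta>0) z"
      using germ[OF f\<beta>0] \<beta>0 iU by (intro local_section_agree) auto
    moreover have "\<forall>\<^sub>F z in near y. z \<in> r ` (U \<inter> B \<beta>0)"
      using \<beta>0 B[OF \<beta>0A] oU by (intro eventually_nhdsin_openin openin_rng_image) auto
    ultimately show ?thesis
      unfolding represents_def using zero units local_section_closed[OF germ(1)[OF f\<beta>0]]
    proof eventually_elim
      case (elim z)
      interpret R: ring "\<O> z" using elim(4) by (rule sheaf.stalk_ring)
      show ?case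
      proof (intro ballI impI)
        fix \<gamma> assume \<gamma>: "\<gamma> \<in> arrows G" "r \<gamma> = z"
        obtain \<beta> where \<beta>: "\<beta> \<in> U" "\<beta> \<in> B \<beta>0" "r \<beta> = z" using elim(2) by auto
        \<comment> \<open>For \<open>z\<close> close to \<open>y\<close> the sets \<open>U\<close>
          and \<open>B \<beta>0\<close> share their only arrow over \<open>z\<close>. Hence
          spreading along \<open>B \<beta>0\<close> agrees with spreading along \<open>U\<close>,
          although the two sets may differ.\<close>
        have UB: "\<gamma> \<in> U \<longleftrightarrow> \<gamma> = \<beta>" "\<gamma> \<in> B \<beta>0 \<longleftrightarrow> \<gamma> = \<beta>"
          using \<beta> \<gamma> iU B[OF \<beta>0A] by (auto dest: inj_onD)
        have term0: "spread B f \<beta>0 \<gamma> = f \<gamma>"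
        proof (cases "\<gamma> = \<beta>")
          case True
          then have "inv_into U r z = \<gamma>" using \<beta> \<gamma> iU by auto
          then show ?thesis using elim(1) UB True \<gamma> by (simp add: spread_def)
        next
          case False
          then have "\<gamma> \<notin> supp f" using UB U(4) by auto
          then show ?thesis using not_supp[of \<gamma> f] \<gamma> False UB by (simp add: spread_def)
        qed
        have f\<gamma>: "f \<gamma> \<in> carrier (\<O> z)" using section_closed[OF fs \<gamma>(1)] \<gamma> by simp
        have terms: "spread B f \<beta> \<gamma> = \<zero>\<^bsub>\<O> z\<^esub>" if "\<beta> \<in> A - {\<beta>0}" for \<beta>
          using elim(3) that \<gamma> unfolding A0 by (simp add: spread_def)
        have "finsum (\<O> z) (\<lambda>\<beta>. spread B f \<beta> \<gamma>) {\<beta>0} = finsum (\<O> z) (\<lambda>\<beta>. spread B f \<beta> \<gamma>) A"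
        proof (rule R.finsum_superset)
          show "spread B f \<beta> \<gamma> \<in> carrier (\<O> z)" if "\<beta> \<in> A" for \<beta>
            using that terms[of \<beta>] term0 f\<gamma> by (cases "\<beta> = \<beta>0") auto
        qed (use A terms A0 in auto)
        then show "f \<gamma> = finsum (\<O> z) (\<lambda>\<beta>. spread B f \<beta> \<gamma>) A"
          using f\<gamma> term0 by (simp add: R.finsum_insert)
      qed
    qed
  qed
qed

text \<open>Asserting the representation for all finite \<open>A\<close> above some
  \<open>A0\<close>, rather than for one set, is what makes the induction work: \<open>f\<close> and
  \<open>g\<close> may come with different sets, but both are represented over anything containing
  the union.\<close>

lemma Gamma_spread:
  assumes f: "f \<in> carrier \<Gamma>" and y: "y \<in> units G"
    and B: "\<And>\<beta>. \<beta> \<in> arrows G \<Longrightarrow> openin X (B \<beta>) \<and> \<beta> \<in> B \<beta> \<and> inj_on r (B \<beta>)"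
  shows "\<exists>A0. finite A0 \<and> A0 \<subseteq> {\<beta> \<in> arrows G. r \<beta> = y} \<and>
    (\<forall>A. finite A \<and> A0 \<subseteq> A \<and> A \<subseteq> {\<beta> \<in> arrows G. r \<beta> = y} \<longrightarrow> represents B A y f)"
  using f
proof (induction rule: Gamma_induct)
  case (generator f)
  then obtain U where U: "compact_open X U" "bisection G U"
      "continuous_map (subtopology X U) (etop S) f" "supp f \<subseteq> U"
    by (rule generator_supp)
  then have "inj_on r {\<beta> \<in> U. r \<beta> = y}" by (auto simp: bisection_def intro: inj_on_subset)
  then have "finite {\<beta> \<in> U. r \<beta> = y}" by (rule inj_on_finite[of _ _ "{y}"]) auto
  moreover have "{\<beta> \<in> U. r \<beta> = y} \<subseteq> {\<beta> \<in> arrows G. r \<beta> = y}" using U(2) by (auto simp: bisection_def)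
  ultimately show ?case
    using generator_spread[OF generator y B U] by (intro exI[of _ "{\<beta> \<in> U. r \<beta> = y}"]) blast
next
  case (diff f g)
  obtain A0 where A0: "finite A0" "A0 \<subseteq> {\<beta> \<in> arrows G. r \<beta> = y}"
    "\<forall>A. finite A \<and> A0 \<subseteq> A \<and> A \<subseteq> {\<beta> \<in> arrows G. r \<beta> = y} \<longrightarrow> represents B A y f"
    using diff.IH(1) by blast
  obtain A1 where A1: "finite A1" "A1 \<subseteq> {\<beta> \<in> arrows G. r \<beta> = y}"
    "\<forall>A. finite A \<and> A1 \<subseteq> A \<and> A \<subseteq> {\<beta> \<in> arrows G. r \<beta> = y} \<longrightarrow> represents B A y g"
    using diff.IH(2) by blast
  let ?h = "f \<ominus>\<^bsub>\<Gamma>\<^esub> g"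
  have h: "?h \<in> carrier \<Gamma>" using diff.hyps by simp
  show ?case
  proof (intro exI[of _ "A0 \<union> A1"] conjI allI impI)
    fix A assume A: "finite A \<and> A0 \<union> A1 \<subseteq> A \<and> A \<subseteq> {\<beta> \<in> arrows G. r \<beta> = y}"
    have closed: "\<forall>\<^sub>F z in near y. \<forall>\<beta>\<in>A. germ (k \<beta>) z \<in> carrier (\<O> z)"
      if k: "k \<in> carrier \<Gamma>" for k
    proof (intro eventually_ball_finite ballI)
      fix \<beta> assume "\<beta> \<in> A"
      then have "k \<beta> \<in> carrier (\<O> y)" using Gamma_closed[OF k, of \<beta>] A by auto
      then show "\<forall>\<^sub>F z in near y. germ (k \<beta>) z \<in> carrier (\<O> z)"
        by (intro local_section_closed germ)
    qed (use A in simp)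
    have diffs: "\<forall>\<^sub>F z in near y. \<forall>\<beta>\<in>A. germ (?h \<beta>) z \<oplus>\<^bsub>\<O> z\<^esub> germ (g \<beta>) z = germ (f \<beta>) z"
    proof (intro eventually_ball_finite ballI)
      fix \<beta> assume "\<beta> \<in> A"
      then have \<beta>: "\<beta> \<in> arrows G" "r \<beta> = y" using A by auto
      then have "f \<beta> \<in> carrier (\<O> y)" "g \<beta> \<in> carrier (\<O> y)" "?h \<beta> = f \<beta> \<ominus>\<^bsub>\<O> y\<^esub> g \<beta>"
        using Gamma_closed[OF diff.hyps(1) \<beta>(1)] Gamma_closed[OF diff.hyps(2) \<beta>(1)]
          Gamma_apply(3)[OF \<beta>(1) diff.hyps(2)] by simp_all
      then show "\<forall>\<^sub>F z in near y. germ (?h \<beta>) z \<oplus>\<^bsub>\<O> z\<^esub> germ (g \<beta>) z = germ (f \<beta>) z"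
        using germ_diff[OF y] by simp
    qed (use A in simp)
    have units: "\<forall>\<^sub>F z in near y. z \<in> units G" using y by (rule eventually_units)
    have "represents B A y f" "represents B A y g" using A A0(3) A1(3) by simp_all
    then show "represents B A y ?h"
      unfolding represents_def using closed[OF h] closed[OF diff.hyps(2)] diffs units
    proof eventually_elim
      case (elim z)
      interpret R: ring "\<O> z" using elim(6) by (rule sheaf.stalk_ring)
      show ?case
      proof (intro ballI impI)
        fix \<gamma> assume \<gamma>: "\<gamma> \<in> arrows G" "r \<gamma> = z"
        let ?s = "\<lambda>k. finsum (\<O> z) (\<lambda>\<beta>. spread B k \<beta> \<gamma>) A"
        have cl: "(\<lambda>\<beta>. spread B ?h \<beta> \<gamma>) \<in> A \<rightarrow> carrier (\<O> z)" "(\<lambda>\<beta>. spread B g \<beta> \<gamma>) \<in> A \<rightarrow> carrier (\<O> z)"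
          using elim(3,4) \<gamma> by (auto simp: spread_def)
        then have "?s ?h \<oplus>\<^bsub>\<O> z\<^esub> ?s g = finsum (\<O> z) (\<lambda>\<beta>. spread B ?h \<beta> \<gamma> \<oplus>\<^bsub>\<O> z\<^esub> spread B g \<beta> \<gamma>) A"
          by (simp add: R.finsum_addf)
        also have "\<dots> = ?s f"
        proof (rule R.finsum_cong'[OF refl])
          show eq: "spread B ?h \<beta> \<gamma> \<oplus>\<^bsub>\<O> z\<^esub> spread B g \<beta> \<gamma> = spread B f \<beta> \<gamma>" if "\<beta> \<in> A" for \<beta>
            using elim(5) \<gamma> that by (simp add: spread_def)
          show "(\<lambda>\<beta>. spread B f \<beta> \<gamma>) \<in> A \<rightarrow> carrier (\<O> z)"
          proof
            fix \<beta> assume "\<beta> \<in> A"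
            then show "spread B f \<beta> \<gamma> \<in> carrier (\<O> z)" using cl unfolding eq[OF \<open>\<beta> \<in> A\<close>, symmetric] by blast
          qed
        qed
        \<comment> \<open>The germs of the difference plus those of \<open>g\<close> sum up to
          \<open>f\<close>; subtracting the sum that represents \<open>g\<close> leaves the
          representation of the difference.\<close>
        finally have "f \<gamma> \<ominus>\<^bsub>\<O> z\<^esub> g \<gamma> = ?s ?h \<oplus>\<^bsub>\<O> z\<^esub> ?s g \<ominus>\<^bsub>\<O> z\<^esub> ?s g"
          using elim(1,2) \<gamma> by simp
        also have "\<dots> = ?s ?h" using cl by (simp add: a_minus_def R.a_assoc R.r_neg)
        finally show "?h \<gamma> = ?s ?h" using Gamma_apply(3)[OF \<gamma>(1) diff.hyps(2)] \<gamma>(2) by simp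
      qed
    qed
  qed (use A0 A1 in auto)
qed

lemma Gamma_vanish_near:
  assumes f: "f \<in> carrier \<Gamma>" and y: "y \<in> units G"
    and zero: "\<And>\<gamma>. \<gamma> \<in> arrows G \<Longrightarrow> r \<gamma> = y \<Longrightarrow> f \<gamma> = \<zero>\<^bsub>\<O> y\<^esub>"
  obtains W where "openin X0 W" "compactin X0 W" "y \<in> W"
    "\<And>\<gamma>. \<gamma> \<in> arrows G \<Longrightarrow> r \<gamma> \<in> W \<Longrightarrow> f \<gamma> = \<zero>\<^bsub>\<O> (r \<gamma>)\<^esub>"
proof -
  have "\<exists>B. openin X B \<and> \<beta> \<in> B \<and> inj_on r B" if "\<beta> \<in> arrows G" for \<beta>
    using local_homeomorphism_injective_nbhd[OF rng_local_homeomorphism, of \<beta>] that by auto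
  then obtain B where B: "\<And>\<beta>. \<beta> \<in> arrows G \<Longrightarrow> openin X (B \<beta>) \<and> \<beta> \<in> B \<beta> \<and> inj_on r (B \<beta>)"
    by metis
  obtain A where A: "A \<subseteq> {\<beta> \<in> arrows G. r \<beta> = y}" and
    rep: "represents B A y f"
    using Gamma_spread[OF f y B] by blast
  have "\<forall>\<^sub>F z in near y. z \<in> units G" using y by (rule eventually_units)
  then have "\<forall>\<^sub>F z in near y. \<forall>\<gamma>\<in>arrows G. r \<gamma> = z \<longrightarrow> f \<gamma> = \<zero>\<^bsub>\<O> z\<^esub>"
    using rep[unfolded represents_def] germ_zero[OF y]
  proof eventually_elim
    case (elim z)
    interpret R: ring "\<O> z" using elim(1) by (rule sheaf.stalk_ring)
    have "spread B f \<beta> \<gamma> = \<zero>\<^bsub>\<O> z\<^esub>" if "\<beta> \<in> A" "r \<gamma> = z" for \<beta> \<gamma>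
    proof -
      have "f \<beta> = \<zero>\<^bsub>\<O> y\<^esub>" using that A zero by blast
      then show ?thesis using elim(3) that by (simp add: spread_def)
    qed
    then show ?case using elim(2) by (simp add: R.add.finprod_one_eqI)
  qed
  then obtain W where W: "openin X0 W" "y \<in> W"
    "\<And>z \<gamma>. z \<in> W \<Longrightarrow> \<gamma> \<in> arrows G \<Longrightarrow> r \<gamma> = z \<Longrightarrow> f \<gamma> = \<zero>\<^bsub>\<O> z\<^esub>"
    using y unfolding eventually_nhdsin by auto
  obtain K where "openin X0 K" "compactin X0 K" "y \<in> K" "K \<subseteq> W"
    using compact_open_unit_nbhd[OF W(1,2)] .
  then show ?thesis using that[of K] W(3) by blast
qed

end

section \<open>Indicator functions and interpolation\<close>

context ample_groupoid_sheaf
begin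

text \<open>Intended for sets of units, where \<gamma> and \<open>r \<gamma>\<close> coincide, so
  that the value lies in the right stalk. For compact open \<open>W\<close> these are the local
  units of \<Gamma>.\<close>

definition one_on :: "'g set \<Rightarrow> 'g \<Rightarrow> 'e"
  where "one_on W = (\<lambda>\<gamma>\<in>arrows G. if \<gamma> \<in> W then \<one>\<^bsub>\<O> \<gamma>\<^esub> else \<zero>\<^bsub>\<O> (r \<gamma>)\<^esub>)"

lemma one_on_apply:
  "\<gamma> \<in> arrows G \<Longrightarrow> one_on W \<gamma> = (if \<gamma> \<in> W then \<one>\<^bsub>\<O> \<gamma>\<^esub> else \<zero>\<^bsub>\<O> (r \<gamma>)\<^esub>)"
  by (simp add: one_on_def)

lemma one_on_sections:
  assumes "W \<subseteq> units G"
  shows "one_on W \<in> carrier sections"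
proof -
  have "one_on W \<gamma> \<in> carrier (\<O> (r \<gamma>))" if \<gamma>: "\<gamma> \<in> arrows G" for \<gamma>
  proof -
    interpret R: ring "\<O> (r \<gamma>)" using \<gamma> by (rule stalk_rng)
    show ?thesis
    proof (cases "\<gamma> \<in> W")
      case True
      then have "r \<gamma> = \<gamma>" using assms by auto
      then show ?thesis using \<gamma> True R.one_closed by (simp add: one_on_apply)
    qed (use \<gamma> in \<open>simp add: one_on_apply\<close>)
  qed
  then show ?thesis by (auto simp: section_group_def one_on_def)
qed

lemma one_on_Gamma:
  assumes W: "openin X0 W" "compactin X0 W"
  shows "one_on W \<in> carrier \<Gamma>"
proof -
  have co: "compact_open X W" and Wu: "W \<subseteq> units G" using W compact_open_units by blast+
  have WA: "W \<subseteq> arrows G" using Wu units_arrows by blast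
  show ?thesis
  proof (intro generators_Gamma generatorI)
    show "one_on W \<in> carrier sections" using Wu by (rule one_on_sections)
    show "compact_open X W" by (rule co)
    show "bisection G W" using Wu WA by (auto simp: bisection_def inj_on_def subset_iff)
    have "subtopology X W = subtopology X0 W"
      using Wu by (simp add: unit_space_def subtopology_subtopology inf.absorb2)
    then have "continuous_map (subtopology X W) (etop S) (eone S)"
      using sheaf.one_continuous by (simp add: continuous_map_from_subtopology)
    then show "continuous_map (subtopology X W) (etop S) (one_on W)"
      by (rule continuous_map_eq) (auto simp: one_on_apply stalk_ops)
    show "supp (one_on W) \<subseteq> W" by (auto simp: supp_def one_on_apply split: if_splits)
  qed
qed

lemma one_on_convolution:
  assumes W: "W \<subseteq> units G" and f: "f \<in> carrier sections" and \<gamma>: "\<gamma> \<in> arrows G"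
  shows "conv (one_on W) f \<gamma> = (if r \<gamma> \<in> W then f \<gamma> else \<zero>\<^bsub>\<O> (r \<gamma>)\<^esub>)"
proof -
  let ?R = "\<O> (r \<gamma>)"
  interpret R: ring ?R using \<gamma> by (rule stalk_rng)
  have f\<gamma>: "f \<gamma> \<in> carrier ?R" using f \<gamma> by (rule section_closed)
  have "conv (one_on W) f \<gamma> = finsum ?R
      (\<lambda>\<beta>. one_on W \<beta> \<otimes>\<^bsub>?R\<^esub> act S \<beta> (f (ldiv \<beta> \<gamma>))) {r \<gamma>}"
  proof (rule convolution_apply[OF one_on_sections[OF W] f \<gamma>])
    show "\<beta> \<in> {r \<gamma>}" if "\<beta> \<in> supp (one_on W)" "r \<beta> = r \<gamma>" for \<beta>
    proof -
      have "\<beta> \<in> W" using that(1) by (auto simp: supp_def one_on_apply split: if_splits)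
      then have "r \<beta> = \<beta>" using W by auto
      then show ?thesis using that(2) by simp
    qed
  qed (use \<gamma> in auto)
  also have "\<dots> = one_on W (r \<gamma>) \<otimes>\<^bsub>?R\<^esub> f \<gamma>"
    using \<gamma> f\<gamma> act_unit[of "r \<gamma>" "f \<gamma>"] section_closed[OF one_on_sections[OF W], of "r \<gamma>"]
    by (simp add: R.finsum_insert)
  also have "\<dots> = (if r \<gamma> \<in> W then f \<gamma> else \<zero>\<^bsub>?R\<^esub>)"
    using \<gamma> f\<gamma> by (simp add: one_on_apply)
  finally show ?thesis .
qed

lemma one_on_mult_eq_zero:
  assumes W: "openin X0 W" "compactin X0 W" and f: "f \<in> carrier \<Gamma>"
    and zero: "\<And>\<gamma>. \<gamma> \<in> arrows G \<Longrightarrow> r \<gamma> \<in> W \<Longrightarrow> f \<gamma> = \<zero>\<^bsub>\<O> (r \<gamma>)\<^esub>"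
  shows "one_on W \<otimes>\<^bsub>\<Gamma>\<^esub> f = \<zero>\<^bsub>\<Gamma>\<^esub>"
proof (rule Gamma_eqI)
  fix \<gamma> assume \<gamma>: "\<gamma> \<in> arrows G"
  have "W \<subseteq> units G" using W(1) openin_unit_space by blast
  then show "(one_on W \<otimes>\<^bsub>\<Gamma>\<^esub> f) \<gamma> = \<zero>\<^bsub>\<Gamma>\<^esub> \<gamma>"
    using one_on_convolution[OF _ Gamma_sections[OF f] \<gamma>] zero[OF \<gamma>] \<gamma> by (simp add: Gamma_ops(3) Gamma_apply)
qed (use W f in \<open>simp_all add: Gamma_mult_closed one_on_Gamma\<close>)

text \<open>Multiplication on the right by \<open>one_on W\<close> restricts to arrows with domain
  in \<open>W\<close>, and \<open>one_on_convolution\<close> is the same for ranges on the left.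
  Here the only surviving term is the factorization of \<gamma> as \<gamma> times its
  domain.\<close>

lemma convolution_one_on:
  assumes W: "W \<subseteq> units G" and f: "f \<in> carrier \<Gamma>" and \<gamma>: "\<gamma> \<in> arrows G"
  shows "conv f (one_on W) \<gamma> = (if d \<gamma> \<in> W then f \<gamma> else \<zero>\<^bsub>\<O> (r \<gamma>)\<^esub>)"
proof -
  let ?R = "\<O> (r \<gamma>)"
  interpret R: ring ?R using \<gamma> by (rule stalk_rng)
  \<comment> \<open>The arrow \<gamma> is added by hand because it may lie outside the support of
    \<open>f\<close>.\<close>
  let ?A = "insert \<gamma> {\<beta> \<in> supp f. r \<beta> = r \<gamma>}"
  let ?t = "\<lambda>\<beta>. f \<beta> \<otimes>\<^bsub>?R\<^esub> act S \<beta> (one_on W (ldiv \<beta> \<gamma>))"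
  have f\<gamma>: "f \<gamma> \<in> carrier ?R" using f \<gamma> by (rule Gamma_closed)
  have A: "\<beta> \<in> arrows G" "r \<beta> = r \<gamma>" if "\<beta> \<in> ?A" for \<beta>
    using that \<gamma> by (auto simp: supp_def)
  have closed: "?t \<beta> \<in> carrier ?R" if "\<beta> \<in> ?A" for \<beta>
    using convolution_term_closed[OF Gamma_sections[OF f] one_on_sections[OF W], of \<beta> "ldiv \<beta> \<gamma>"]
      A[OF that] \<gamma> by simp
  have zero: "?t \<beta> = \<zero>\<^bsub>?R\<^esub>" if "\<beta> \<in> ?A - {\<gamma>}" for \<beta>
  proof -
    have \<beta>: "\<beta> \<in> arrows G" "r \<beta> = r \<gamma>" "\<beta> \<noteq> \<gamma>" using that A[of \<beta>] by simp_all
    \<comment> \<open>If this quotient were a unit, it would be \<open>d \<beta>\<close>, which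
      forces \<beta> to equal \<gamma>.\<close>
    have "ldiv \<beta> \<gamma> \<notin> W"
    proof
      let ?u = "ldiv \<beta> \<gamma>"
      assume "?u \<in> W"
      then have "?u \<in> units G" using W by auto
      then have "?u = r ?u" by simp
      then have "?u = d \<beta>" using \<beta> \<gamma> by simp
      moreover have "gmult G \<beta> ?u = \<gamma>" using \<beta> \<gamma> by simp
      ultimately show False using \<beta> by simp
    qed
    then have "act S \<beta> (one_on W (ldiv \<beta> \<gamma>)) = \<zero>\<^bsub>?R\<^esub>"
      using \<beta> \<gamma> act_zero[of \<beta>] by (simp add: one_on_apply)
    then show ?thesis using Gamma_closed[OF f \<beta>(1)] \<beta>(2) by simp
  qed
  have "conv f (one_on W) \<gamma> = finsum ?R ?t ?A"
    by (rule convolution_apply[OF Gamma_sections[OF f] one_on_sections[OF W] \<gamma> _ _ A(2)])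
      (use A(1) finite_supp(1)[OF f, of "r \<gamma>"] in auto)
  also have "\<dots> = finsum ?R ?t {\<gamma>}"
    using finite_supp(1)[OF f, of "r \<gamma>"] closed zero by (intro R.finsum_superset[symmetric]) auto
  also have "\<dots> = f \<gamma> \<otimes>\<^bsub>?R\<^esub> act S \<gamma> (one_on W (d \<gamma>))"
    using closed[of \<gamma>] \<gamma> by (simp add: R.finsum_insert inv_mult_self)
  also have "\<dots> = (if d \<gamma> \<in> W then f \<gamma> else \<zero>\<^bsub>?R\<^esub>)"
    using \<gamma> f\<gamma> act_one[of \<gamma>] act_zero[of \<gamma>] by (simp add: one_on_apply)
  finally show ?thesis .
qed

text \<open>Any compact open \<open>W\<close> containing \<open>K\<close> then satisfies
  \<open>f * one_on W = f\<close>: this is the source of local right units.\<close>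

lemma compact_dom_supp:
  "f \<in> carrier \<Gamma> \<Longrightarrow> \<exists>K. compactin X0 K \<and> d ` supp f \<subseteq> K"
proof (induction rule: Gamma_induct)
  case (generator f)
  then obtain U where U: "compact_open X U" "supp f \<subseteq> U" by (rule generator_supp)
  then have "compactin X0 (d ` U)"
    using dom_continuous by (intro image_compactin) (auto simp: compact_open_def)
  then show ?case using U(2) by blast
next
  case (diff f g)
  then obtain K L where "compactin X0 K" "d ` supp f \<subseteq> K"
      "compactin X0 L" "d ` supp g \<subseteq> L" by blast
  moreover have "d ` supp (f \<ominus>\<^bsub>\<Gamma>\<^esub> g) \<subseteq> d ` supp f \<union> d ` supp g"
    using supp_diff[OF diff.hyps(2), of f] by blast
  ultimately show ?case by (intro exI[of _ "K \<union> L"] conjI compactin_Un) blast+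
qed

text \<open>A local section through \<open>e\<close> is composed with \<open>r\<close> on a compact
  open bisection small enough for the section to be defined over its ranges.\<close>

lemma generator_through:
  assumes \<gamma>: "\<gamma> \<in> arrows G" and e: "e \<in> carrier (\<O> (r \<gamma>))"
    and W: "openin X W" "\<gamma> \<in> W"
  obtains f U where "f \<in> generators" "f \<gamma> = e" "supp f \<subseteq> U" "bisection G U" "\<gamma> \<in> U" "U \<subseteq> W"
proof -
  obtain V where V: "openin X0 V" "r \<gamma> \<in> V"
      "continuous_map (subtopology X0 V) (etop S) (germ e)"
      "\<And>z. z \<in> V \<Longrightarrow> germ e z \<in> carrier (\<O> z)"
    using germ(1)[OF e] unfolding local_section_def by blast
  have "openin X (W \<inter> {\<beta> \<in> arrows G. r \<beta> \<in> V})"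
    using W(1) openin_rng_preimage[OF V(1)] by (rule openin_Int)
  then obtain U where U: "compact_open X U" "bisection G U" "\<gamma> \<in> U" "U \<subseteq> W \<inter> {\<beta> \<in> arrows G. r \<beta> \<in> V}"
    by (rule compact_open_bisection_nbhd[of _ \<gamma>]) (use \<gamma> V(2) W(2) in auto)
  define f where "f = (\<lambda>\<beta>\<in>arrows G. if \<beta> \<in> U then germ e (r \<beta>) else \<zero>\<^bsub>\<O> (r \<beta>)\<^esub>)"
  have "f \<beta> \<in> carrier (\<O> (r \<beta>))" if \<beta>: "\<beta> \<in> arrows G" for \<beta>
  proof -
    interpret R: ring "\<O> (r \<beta>)" using \<beta> by (rule stalk_rng)
    show ?thesis using \<beta> U(4) V(4)[of "r \<beta>"] by (auto simp: f_def)
  qed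
  then have fs: "f \<in> carrier sections" by (auto simp: section_group_def f_def)
  have supp: "supp f \<subseteq> U" by (auto simp: supp_def f_def split: if_splits)
  have "continuous_map (subtopology X U) (subtopology X0 V) r"
    using rng_continuous U(4) by (intro continuous_map_into_subtopology continuous_map_from_subtopology) auto
  from continuous_map_compose[OF this V(3)]
  have "continuous_map (subtopology X U) (etop S) f"
    by (rule continuous_map_eq) (auto simp: f_def)
  then have "f \<in> generators" using fs U(1,2) supp by (intro generatorI)
  moreover have "f \<gamma> = e" using \<gamma> U(3) germ(2)[OF e] by (simp add: f_def)
  ultimately show ?thesis using that[of f U] supp U by blast
qed

text \<open>The prescription includes zero at every other arrow over \<open>F\<close>, of which
  there may be infinitely many. It can be met by adding one arrow at a time: a bisection whose
  domains avoid the rest of \<open>F\<close> contains only the new arrow among all arrows over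
  \<open>F\<close>, so earlier values are untouched.\<close>

lemma interpolation:
  assumes F: "finite F" "F \<subseteq> units G" and D: "finite D" "D \<subseteq> {\<gamma> \<in> arrows G. d \<gamma> \<in> F}"
    and c: "\<And>\<gamma>. \<gamma> \<in> D \<Longrightarrow> c \<gamma> \<in> carrier (\<O> (r \<gamma>))"
  shows "\<exists>f\<in>carrier \<Gamma>. \<forall>\<gamma>\<in>arrows G. d \<gamma> \<in> F \<longrightarrow> f \<gamma> = (if \<gamma> \<in> D then c \<gamma> else \<zero>\<^bsub>\<O> (r \<gamma>)\<^esub>)"
  using D c
proof (induction D)
  case empty
  show ?case by (rule bexI[of _ "\<zero>\<^bsub>\<Gamma>\<^esub>"]) (simp_all add: Gamma_apply)
next
  case (insert \<gamma>0 D)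
  then obtain f where f: "f \<in> carrier \<Gamma>"
    "\<And>\<gamma>. \<gamma> \<in> arrows G \<Longrightarrow> d \<gamma> \<in> F \<Longrightarrow> f \<gamma> = (if \<gamma> \<in> D then c \<gamma> else \<zero>\<^bsub>\<O> (r \<gamma>)\<^esub>)"
    by auto
  have \<gamma>0: "\<gamma>0 \<in> arrows G" "d \<gamma>0 \<in> F" using insert.prems by auto
  \<comment> \<open>Finite sets of units are closed since the unit space is Hausdorff, so the
    remaining points of \<open>F\<close> can be avoided by an open set.\<close>
  have "closedin X0 (F - {d \<gamma>0})"
    using unit_space_Hausdorff F by (intro closedin_Hausdorff_finite) auto
  then have "openin X0 (units G - (F - {d \<gamma>0}))"
    using openin_diff[OF openin_topspace, of X0] by simp
  note open_dom = openin_dom_preimage[OF this]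
  obtain g U where g: "g \<in> generators" "g \<gamma>0 = c \<gamma>0" "supp g \<subseteq> U" "bisection G U" "\<gamma>0 \<in> U"
      "U \<subseteq> {\<gamma> \<in> arrows G. d \<gamma> \<in> units G - (F - {d \<gamma>0})}"
    by (rule generator_through[OF \<gamma>0(1) _ open_dom, of "c \<gamma>0"]) (use insert.prems(2) \<gamma>0 in auto)
  have g\<Gamma>: "g \<in> carrier \<Gamma>" using g(1) by (rule generators_Gamma)
  show ?case
  proof (intro bexI[of _ "f \<oplus>\<^bsub>\<Gamma>\<^esub> g"] ballI impI)
    show "f \<oplus>\<^bsub>\<Gamma>\<^esub> g \<in> carrier \<Gamma>" using f(1) g\<Gamma> by simp
    fix \<gamma> assume \<gamma>: "\<gamma> \<in> arrows G" "d \<gamma> \<in> F"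
    interpret R: ring "\<O> (r \<gamma>)" using \<gamma>(1) by (rule stalk_rng)
    show "(f \<oplus>\<^bsub>\<Gamma>\<^esub> g) \<gamma> = (if \<gamma> \<in> insert \<gamma>0 D then c \<gamma> else \<zero>\<^bsub>\<O> (r \<gamma>)\<^esub>)"
    proof (cases "\<gamma> = \<gamma>0")
      case True
      then have "f \<gamma> = \<zero>\<^bsub>\<O> (r \<gamma>)\<^esub>" "g \<gamma> = c \<gamma>" "c \<gamma> \<in> carrier (\<O> (r \<gamma>))"
        using f(2)[OF \<gamma>] g(2) insert.hyps(2) insert.prems(2)[of \<gamma>0] by auto
      then show ?thesis using True Gamma_apply(1)[OF \<gamma>(1), of f g] R.l_zero by auto
    next
      case False
      have "\<gamma> \<notin> U"
      proof
        assume U: "\<gamma> \<in> U"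
        then have "d \<gamma> = d \<gamma>0" using g(6) \<gamma>(2) by auto
        then show False using False U g(4,5) by (auto simp: bisection_def dest: inj_onD)
      qed
      then have "g \<gamma> = \<zero>\<^bsub>\<O> (r \<gamma>)\<^esub>" using g(3) not_supp[OF \<gamma>(1)] by blast
      then show ?thesis using f(2)[OF \<gamma>] False \<gamma>(1) Gamma_closed[OF f(1) \<gamma>(1)] by (simp add: Gamma_apply)
    qed
  qed
qed

end


section \<open>Modules over rings without identity\<close>

text \<open>The scalars enter as an additive group whose product is governed by
  \<open>left_module\<close>. In this form the locale applies to \<Gamma> and to the skew group ring
  alike.\<close>

locale nonunital_module =
  R: abelian_group R + N: abelian_group N
  for R :: "('r, 'k) ring_scheme" and N :: "('r, 'n, 'l) module_scheme" +
  assumes left_module: "left_module R N"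
begin

lemma smult_closed [simp]: "a \<in> carrier R \<Longrightarrow> u \<in> carrier N \<Longrightarrow> a \<odot>\<^bsub>N\<^esub> u \<in> carrier N"
  and smult_l_distr:
    "a \<in> carrier R \<Longrightarrow> b \<in> carrier R \<Longrightarrow> u \<in> carrier N \<Longrightarrow> (a \<oplus>\<^bsub>R\<^esub> b) \<odot>\<^bsub>N\<^esub> u = a \<odot>\<^bsub>N\<^esub> u \<oplus>\<^bsub>N\<^esub> b \<odot>\<^bsub>N\<^esub> u"
  and smult_r_distr:
    "a \<in> carrier R \<Longrightarrow> u \<in> carrier N \<Longrightarrow> v \<in> carrier N \<Longrightarrow> a \<odot>\<^bsub>N\<^esub> (u \<oplus>\<^bsub>N\<^esub> v) = a \<odot>\<^bsub>N\<^esub> u \<oplus>\<^bsub>N\<^esub> a \<odot>\<^bsub>N\<^esub> v"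
  and smult_assoc:
    "a \<in> carrier R \<Longrightarrow> b \<in> carrier R \<Longrightarrow> u \<in> carrier N \<Longrightarrow> (a \<otimes>\<^bsub>R\<^esub> b) \<odot>\<^bsub>N\<^esub> u = a \<odot>\<^bsub>N\<^esub> (b \<odot>\<^bsub>N\<^esub> u)"
  using left_module by (simp_all add: left_module_def)

lemma smult_l_null [simp]: "u \<in> carrier N \<Longrightarrow> \<zero>\<^bsub>R\<^esub> \<odot>\<^bsub>N\<^esub> u = \<zero>\<^bsub>N\<^esub>"
  using smult_l_distr[of "\<zero>\<^bsub>R\<^esub>" "\<zero>\<^bsub>R\<^esub>" u] by simp

lemma smult_r_null [simp]: "a \<in> carrier R \<Longrightarrow> a \<odot>\<^bsub>N\<^esub> \<zero>\<^bsub>N\<^esub> = \<zero>\<^bsub>N\<^esub>"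
  using smult_r_distr[of a "\<zero>\<^bsub>N\<^esub>" "\<zero>\<^bsub>N\<^esub>"] by simp

lemma smult_r_neg: "a \<in> carrier R \<Longrightarrow> u \<in> carrier N \<Longrightarrow> a \<odot>\<^bsub>N\<^esub> (\<ominus>\<^bsub>N\<^esub> u) = \<ominus>\<^bsub>N\<^esub> (a \<odot>\<^bsub>N\<^esub> u)"
  using smult_r_distr[of a "\<ominus>\<^bsub>N\<^esub> u" u] by (intro N.minus_equality[symmetric]) (simp_all add: N.l_neg)

lemma smult_l_neg: "a \<in> carrier R \<Longrightarrow> u \<in> carrier N \<Longrightarrow> (\<ominus>\<^bsub>R\<^esub> a) \<odot>\<^bsub>N\<^esub> u = \<ominus>\<^bsub>N\<^esub> (a \<odot>\<^bsub>N\<^esub> u)"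
  using smult_l_distr[of "\<ominus>\<^bsub>R\<^esub> a" a u] by (intro N.minus_equality[symmetric]) (simp_all add: R.l_neg)

lemma submoduleI:
  assumes "H \<subseteq> carrier N" "\<zero>\<^bsub>N\<^esub> \<in> H"
    and "\<And>u v. u \<in> H \<Longrightarrow> v \<in> H \<Longrightarrow> u \<oplus>\<^bsub>N\<^esub> v \<in> H"
    and "\<And>u. u \<in> H \<Longrightarrow> \<ominus>\<^bsub>N\<^esub> u \<in> H"
    and "\<And>a u. a \<in> carrier R \<Longrightarrow> u \<in> H \<Longrightarrow> a \<odot>\<^bsub>N\<^esub> u \<in> H"
  shows "submodule H R N"
  using assms by unfold_locales (auto simp: a_inv_def[symmetric])

lemma submoduleD:
  assumes "submodule H R N"
  shows "H \<subseteq> carrier N" "\<zero>\<^bsub>N\<^esub> \<in> H"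
    and "\<And>u v. u \<in> H \<Longrightarrow> v \<in> H \<Longrightarrow> u \<oplus>\<^bsub>N\<^esub> v \<in> H"
    and "\<And>a u. a \<in> carrier R \<Longrightarrow> u \<in> H \<Longrightarrow> a \<odot>\<^bsub>N\<^esub> u \<in> H"
proof -
  interpret submodule H R N by fact
  show "H \<subseteq> carrier N" "\<zero>\<^bsub>N\<^esub> \<in> H"
    "\<And>u v. u \<in> H \<Longrightarrow> v \<in> H \<Longrightarrow> u \<oplus>\<^bsub>N\<^esub> v \<in> H"
    "\<And>a u. a \<in> carrier R \<Longrightarrow> u \<in> H \<Longrightarrow> a \<odot>\<^bsub>N\<^esub> u \<in> H"
    using subset one_closed m_closed smult_closed by auto
qed

lemma simpleD:
  assumes "simple_left_module R N" "submodule H R N"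
  shows "H = {\<zero>\<^bsub>N\<^esub>} \<or> H = carrier N"
  using assms by (simp add: simple_left_module_def)

text \<open>Since \<open>R\<close> need not be unital, the multiples of \<open>u\<close> could a priori all vanish; but the
  \<open>u\<close> with this property form a submodule.\<close>

lemma simple_generated:
  assumes simple: "simple_left_module R N"
    and mult: "\<And>a b. a \<in> carrier R \<Longrightarrow> b \<in> carrier R \<Longrightarrow> a \<otimes>\<^bsub>R\<^esub> b \<in> carrier R"
    and u: "u \<in> carrier N" "u \<noteq> \<zero>\<^bsub>N\<^esub>"
  shows "(\<lambda>a. a \<odot>\<^bsub>N\<^esub> u) ` carrier R = carrier N" (is "?H = _")
proof -
  let ?A = "{u \<in> carrier N. \<forall>a\<in>carrier R. a \<odot>\<^bsub>N\<^esub> u = \<zero>\<^bsub>N\<^esub>}"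
  have "submodule ?A R N"
    by (rule submoduleI) (auto simp: smult_r_distr smult_r_neg)
  then have "?A = {\<zero>\<^bsub>N\<^esub>} \<or> ?A = carrier N" by (rule simpleD[OF simple])
  moreover have "?A \<noteq> carrier N" using simple unfolding simple_left_module_def by blast
  ultimately have "u \<notin> ?A" using u by blast
  then obtain a where a: "a \<in> carrier R" "a \<odot>\<^bsub>N\<^esub> u \<noteq> \<zero>\<^bsub>N\<^esub>" using u by blast
  have "submodule ?H R N"
  proof (rule submoduleI)
    show "\<zero>\<^bsub>N\<^esub> \<in> ?H"
      using u by (intro image_eqI[of _ _ "\<zero>\<^bsub>R\<^esub>"]) simp_all
    show "v \<oplus>\<^bsub>N\<^esub> w \<in> ?H"
      if vw: "v \<in> ?H" "w \<in> ?H" for v w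
    proof -
      obtain a b where "a \<in> carrier R" "b \<in> carrier R" "v = a \<odot>\<^bsub>N\<^esub> u" "w = b \<odot>\<^bsub>N\<^esub> u" using vw by blast
      then show ?thesis using u by (intro image_eqI[of _ _ "a \<oplus>\<^bsub>R\<^esub> b"]) (simp_all add: smult_l_distr)
    qed
    show "\<ominus>\<^bsub>N\<^esub> v \<in> ?H" if v: "v \<in> ?H" for v
    proof -
      obtain a where "a \<in> carrier R" "v = a \<odot>\<^bsub>N\<^esub> u" using v by blast
      then show ?thesis using u by (intro image_eqI[of _ _ "\<ominus>\<^bsub>R\<^esub> a"]) (simp_all add: smult_l_neg)
    qed
    show "b \<odot>\<^bsub>N\<^esub> v \<in> ?H"
      if "b \<in> carrier R" and v: "v \<in> ?H" for b v
    proof -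
      obtain a where "a \<in> carrier R" "v = a \<odot>\<^bsub>N\<^esub> u" using v by blast
      then show ?thesis using u that(1) mult by (intro image_eqI[of _ _ "b \<otimes>\<^bsub>R\<^esub> a"]) (simp_all add: smult_assoc)
    qed
  qed (use u in auto)
  then have "?H = {\<zero>\<^bsub>N\<^esub>} \<or> ?H = carrier N"
    by (rule simpleD[OF simple])
  then show ?thesis using a by auto
qed

end


section \<open>Primitivity yields a dense orbit\<close>

locale Gamma_module =
  ample_groupoid_sheaf G S + nonunital_module "Gamma_c G S" N
  for G :: "('g, 'm) top_groupoid_scheme" and S :: "('g, 'e, 'n) gsheaf_rings_scheme"
    and N :: "('g \<Rightarrow> 'e, 'p, 'l) module_scheme"
begin

text \<open>For the sheaf picture of \<open>N\<close>, these are the elements with zero germ at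
  \<open>y\<close>. Intersecting over \<open>y\<close> in \<open>T\<close> gives
  \<open>N(T)\<close>.\<close>

definition vanishing_at :: "'g \<Rightarrow> 'p set"
  where "vanishing_at y = {u \<in> carrier N. \<exists>W. openin X0 W \<and> compactin X0 W \<and>
    y \<in> W \<and> one_on W \<odot>\<^bsub>N\<^esub> u = \<zero>\<^bsub>N\<^esub>}"

text \<open>The product of \<open>one_on V\<close> with \<open>one_on W\<close> is
  \<open>one_on V\<close>, so \<open>one_on V\<close> kills whatever \<open>one_on W\<close>
  kills.\<close>

lemma one_on_antimono:
  assumes W: "openin X0 W" "compactin X0 W"
    and V: "openin X0 V" "compactin X0 V" and "V \<subseteq> W"
    and u: "u \<in> carrier N" "one_on W \<odot>\<^bsub>N\<^esub> u = \<zero>\<^bsub>N\<^esub>"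
  shows "one_on V \<odot>\<^bsub>N\<^esub> u = \<zero>\<^bsub>N\<^esub>"
proof -
  have units: "V \<subseteq> units G" "W \<subseteq> units G" using V W openin_unit_space by auto
  have "one_on V \<otimes>\<^bsub>\<Gamma>\<^esub> one_on W = one_on V"
  proof (rule Gamma_eqI)
    fix \<gamma> assume \<gamma>: "\<gamma> \<in> arrows G"
    have "\<gamma> \<in> units G \<Longrightarrow> r \<gamma> = \<gamma>" by simp
    then show "(one_on V \<otimes>\<^bsub>\<Gamma>\<^esub> one_on W) \<gamma> = one_on V \<gamma>"
      using \<gamma> units \<open>V \<subseteq> W\<close> by (auto simp: Gamma_ops one_on_convolution one_on_sections one_on_apply)
  qed (use V W in \<open>simp_all add: Gamma_mult_closed one_on_Gamma\<close>)
  then show ?thesis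
    using smult_assoc[of "one_on V" "one_on W" u] V W u by (simp add: one_on_Gamma)
qed

text \<open>The union is split into the disjoint sets \<open>V\<close> and \<open>W - V\<close>, so
  that indicators add. The difference is compact open because compact sets of units are closed, and
  \<open>one_on_antimono\<close> applies to it.\<close>

lemma one_on_Un:
  assumes W: "openin X0 W" "compactin X0 W" "one_on W \<odot>\<^bsub>N\<^esub> u = \<zero>\<^bsub>N\<^esub>"
    and V: "openin X0 V" "compactin X0 V" "one_on V \<odot>\<^bsub>N\<^esub> u = \<zero>\<^bsub>N\<^esub>"
    and u: "u \<in> carrier N"
  shows "one_on (V \<union> W) \<odot>\<^bsub>N\<^esub> u = \<zero>\<^bsub>N\<^esub>"
proof -
  have WV: "openin X0 (W - V)" "compactin X0 (W - V)"
    using W V compactin_imp_closedin_unit_space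
    by (auto intro: openin_diff closed_compactin closedin_diff)
  have VW: "openin X0 (V \<union> W)" "compactin X0 (V \<union> W)"
    using W V by (auto intro: compactin_Un)
  have "one_on (V \<union> W) = one_on V \<oplus>\<^bsub>\<Gamma>\<^esub> one_on (W - V)"
  proof (rule Gamma_eqI)
    fix \<gamma> assume \<gamma>: "\<gamma> \<in> arrows G"
    interpret R: ring "\<O> (r \<gamma>)" using \<gamma> by (rule stalk_rng)
    have "V \<union> W \<subseteq> units G" using VW(1) by (simp only: openin_unit_space)
    then have unit: "r \<gamma> = \<gamma>" if "\<gamma> \<in> V \<union> W" using that units_dom_rng by blast
    have "\<one>\<^bsub>\<O> \<gamma>\<^esub> \<in> carrier (\<O> (r \<gamma>))" if "\<gamma> \<in> V \<union> W"
      using R.one_closed unfolding unit[OF that] .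
    then show "one_on (V \<union> W) \<gamma> = (one_on V \<oplus>\<^bsub>\<Gamma>\<^esub> one_on (W - V)) \<gamma>"
      unfolding Gamma_apply(1)[OF \<gamma>] one_on_apply[OF \<gamma>]
      by (cases "\<gamma> \<in> V"; cases "\<gamma> \<in> W") simp_all
  qed (use V WV VW in \<open>simp_all add: one_on_Gamma\<close>)
  moreover have "one_on (W - V) \<odot>\<^bsub>N\<^esub> u = \<zero>\<^bsub>N\<^esub>"
    using one_on_antimono[OF W(1,2) WV _ u W(3)] by blast
  ultimately show ?thesis using V WV u by (simp add: smult_l_distr one_on_Gamma)
qed

lemma one_on_Union:
  assumes "finite \<W>" and u: "u \<in> carrier N"
    and "\<And>W. W \<in> \<W> \<Longrightarrow> openin X0 W \<and> compactin X0 W \<and> one_on W \<odot>\<^bsub>N\<^esub> u = \<zero>\<^bsub>N\<^esub>"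
  shows "openin X0 (\<Union>\<W>) \<and> compactin X0 (\<Union>\<W>) \<and> one_on (\<Union>\<W>) \<odot>\<^bsub>N\<^esub> u = \<zero>\<^bsub>N\<^esub>"
  using assms(1,3)
proof induction
  case empty
  have "one_on {} = \<zero>\<^bsub>\<Gamma>\<^esub>"
    by (rule Gamma_eqI) (simp_all add: one_on_Gamma one_on_apply Gamma_apply)
  then show ?case using u by simp
next
  case (insert W \<W>)
  then have "openin X0 (\<Union>\<W>)" "compactin X0 (\<Union>\<W>)" "one_on (\<Union>\<W>) \<odot>\<^bsub>N\<^esub> u = \<zero>\<^bsub>N\<^esub>"
    "openin X0 W" "compactin X0 W" "one_on W \<odot>\<^bsub>N\<^esub> u = \<zero>\<^bsub>N\<^esub>"
    by auto
  then show ?case using one_on_Un[of "\<Union>\<W>" u W] u by (auto intro: compactin_Un)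
qed

text \<open>Only closure under scalars is delicate. Near \<open>y\<close> the element
  \<open>f u\<close> depends on \<open>u\<close> near the domains of the finitely many arrows over
  \<open>y\<close> in the support of \<open>f\<close>; invariance puts these domains into
  \<open>T\<close>, where \<open>u\<close> vanishes locally.\<close>

lemma submodule_vanishing:
  assumes T: "T \<subseteq> units G" and inv: "\<And>\<gamma>. \<gamma> \<in> arrows G \<Longrightarrow> r \<gamma> \<in> T \<Longrightarrow> d \<gamma> \<in> T"
  shows "submodule {u \<in> carrier N. \<forall>y\<in>T. u \<in> vanishing_at y} \<Gamma> N" (is "submodule ?K \<Gamma> N")
proof (rule submoduleI)
  have nbhd: "\<exists>W. openin X0 W \<and> compactin X0 W \<and> y \<in> W" if "y \<in> T" for y
  proof -
    have "openin X0 (units G)" using openin_topspace[of X0] by simp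
    then show ?thesis by (rule compact_open_unit_nbhd[of _ y]) (use T that in auto)
  qed
  show "\<zero>\<^bsub>N\<^esub> \<in> ?K"
    using nbhd by (fastforce simp: vanishing_at_def one_on_Gamma)
  fix u assume u: "u \<in> ?K"
  show "\<ominus>\<^bsub>N\<^esub> u \<in> ?K"
  proof (intro CollectI conjI ballI)
    fix y assume "y \<in> T"
    then obtain W where "openin X0 W" "compactin X0 W" "y \<in> W" "one_on W \<odot>\<^bsub>N\<^esub> u = \<zero>\<^bsub>N\<^esub>"
      using u by (auto simp: vanishing_at_def)
    then show "\<ominus>\<^bsub>N\<^esub> u \<in> vanishing_at y"
      unfolding vanishing_at_def using u
      by (intro CollectI conjI exI[of _ W]) (simp_all add: smult_r_neg one_on_Gamma)
  qed (use u in simp)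
  show "u \<oplus>\<^bsub>N\<^esub> v \<in> ?K"
    if v: "v \<in> ?K" for v
  proof (intro CollectI conjI ballI)
    fix y assume "y \<in> T"
    then obtain W where W: "openin X0 W" "compactin X0 W" "y \<in> W" "one_on W \<odot>\<^bsub>N\<^esub> u = \<zero>\<^bsub>N\<^esub>"
      using u by (auto simp: vanishing_at_def)
    obtain V where V: "openin X0 V" "compactin X0 V" "y \<in> V" "one_on V \<odot>\<^bsub>N\<^esub> v = \<zero>\<^bsub>N\<^esub>"
      using v \<open>y \<in> T\<close> by (auto simp: vanishing_at_def)
    have WV: "openin X0 (W \<inter> V)" "compactin X0 (W \<inter> V)"
      using W V compactin_imp_closedin_unit_space by (auto intro: closed_Int_compactin)
    have "one_on (W \<inter> V) \<odot>\<^bsub>N\<^esub> u = \<zero>\<^bsub>N\<^esub>" "one_on (W \<inter> V) \<odot>\<^bsub>N\<^esub> v = \<zero>\<^bsub>N\<^esub>"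
      using one_on_antimono[OF W(1,2) WV _ _ W(4)] one_on_antimono[OF V(1,2) WV _ _ V(4)] u v by auto
    then show "u \<oplus>\<^bsub>N\<^esub> v \<in> vanishing_at y"
      unfolding vanishing_at_def using u v W(3) V(3) WV
      by (intro CollectI conjI exI[of _ "W \<inter> V"]) (simp_all add: smult_r_distr one_on_Gamma)
  qed (use u v in simp)
  show "f \<odot>\<^bsub>N\<^esub> u \<in> ?K" if f: "f \<in> carrier \<Gamma>" for f
  proof (intro CollectI conjI ballI)
    have uN: "u \<in> carrier N" using u by simp
    then show "f \<odot>\<^bsub>N\<^esub> u \<in> carrier N" using f by simp
    fix y assume y: "y \<in> T"
    let ?A = "{\<gamma> \<in> supp f. r \<gamma> = y}"
    have "\<exists>W. openin X0 W \<and> compactin X0 W \<and> d \<gamma> \<in> W \<and> one_on W \<odot>\<^bsub>N\<^esub> u = \<zero>\<^bsub>N\<^esub>"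
      if "\<gamma> \<in> ?A" for \<gamma>
    proof -
      have "d \<gamma> \<in> T" using that y inv by (auto simp: supp_def)
      then show ?thesis using u by (auto simp: vanishing_at_def)
    qed
    then obtain B where B: "\<And>\<gamma>. \<gamma> \<in> ?A \<Longrightarrow> openin X0 (B \<gamma>) \<and> compactin X0 (B \<gamma>) \<and>
        d \<gamma> \<in> B \<gamma> \<and> one_on (B \<gamma>) \<odot>\<^bsub>N\<^esub> u = \<zero>\<^bsub>N\<^esub>"
      by metis
    define W where "W = \<Union>(B ` ?A)"
    have W: "openin X0 W" "compactin X0 W" "one_on W \<odot>\<^bsub>N\<^esub> u = \<zero>\<^bsub>N\<^esub>"
      using one_on_Union[of "B ` ?A" u] finite_supp(1)[OF f] B uN unfolding W_def by auto
    have Wu: "W \<subseteq> units G" using W(1) openin_unit_space by blast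
    \<comment> \<open>Since \<open>W\<close> covers the domains of all arrows over \<open>y\<close>
      in the support of \<open>f\<close>, the part \<open>g\<close> of \<open>f\<close> agrees with
      \<open>f\<close> over \<open>y\<close>, hence over a neighbourhood of \<open>y\<close>; and
      \<open>g\<close> kills \<open>u\<close> because \<open>one_on W\<close> does.\<close>
    define g where "g = f \<otimes>\<^bsub>\<Gamma>\<^esub> one_on W"
    have g: "g \<in> carrier \<Gamma>" using f W by (simp add: g_def Gamma_mult_closed one_on_Gamma)
    have "(f \<ominus>\<^bsub>\<Gamma>\<^esub> g) \<gamma> = \<zero>\<^bsub>\<O> y\<^esub>" if \<gamma>: "\<gamma> \<in> arrows G" "r \<gamma> = y" for \<gamma>
    proof -
      interpret R: ring "\<O> y" using T y by (intro sheaf.stalk_ring) auto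
      have "\<gamma> \<in> supp f \<Longrightarrow> d \<gamma> \<in> W" using \<gamma> B unfolding W_def by blast
      moreover have "g \<gamma> = (if d \<gamma> \<in> W then f \<gamma> else \<zero>\<^bsub>\<O> y\<^esub>)"
        using convolution_one_on[OF Wu f \<gamma>(1)] \<gamma>(2) by (simp add: g_def Gamma_ops)
      ultimately have "g \<gamma> = f \<gamma>" using not_supp[OF \<gamma>(1), of f] \<gamma>(2) by (cases "\<gamma> \<in> supp f"; simp)
      then show ?thesis
        using Gamma_apply(3)[OF \<gamma>(1) g] Gamma_closed[OF f \<gamma>(1)] \<gamma>(2) by (simp add: a_minus_def R.r_neg)
    qed
    then obtain V where V: "openin X0 V" "compactin X0 V" "y \<in> V"
        "\<And>\<gamma>. \<gamma> \<in> arrows G \<Longrightarrow> r \<gamma> \<in> V \<Longrightarrow> (f \<ominus>\<^bsub>\<Gamma>\<^esub> g) \<gamma> = \<zero>\<^bsub>\<O> (r \<gamma>)\<^esub>"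
      using Gamma_vanish_near[of "f \<ominus>\<^bsub>\<Gamma>\<^esub> g" y] f g T y by auto
    have h: "f \<ominus>\<^bsub>\<Gamma>\<^esub> g \<in> carrier \<Gamma>" using f g by simp
    have "one_on V \<otimes>\<^bsub>\<Gamma>\<^esub> (f \<ominus>\<^bsub>\<Gamma>\<^esub> g) = \<zero>\<^bsub>\<Gamma>\<^esub>"
      using V(1,2) h V(4) by (rule one_on_mult_eq_zero)
    then have "one_on V \<odot>\<^bsub>N\<^esub> ((f \<ominus>\<^bsub>\<Gamma>\<^esub> g) \<odot>\<^bsub>N\<^esub> u) = \<zero>\<^bsub>N\<^esub>"
      using smult_assoc[of "one_on V" "f \<ominus>\<^bsub>\<Gamma>\<^esub> g" u] V h uN by (simp add: one_on_Gamma)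
    moreover have "g \<odot>\<^bsub>N\<^esub> u = \<zero>\<^bsub>N\<^esub>"
      using smult_assoc[of f "one_on W" u] f W uN by (simp add: g_def one_on_Gamma)
    moreover have neg_zero: "\<ominus>\<^bsub>N\<^esub> \<zero>\<^bsub>N\<^esub> = \<zero>\<^bsub>N\<^esub>" by (rule N.minus_equality) simp_all
    ultimately have "one_on V \<odot>\<^bsub>N\<^esub> (f \<odot>\<^bsub>N\<^esub> u) = \<zero>\<^bsub>N\<^esub>"
      using f g uN by (simp add: a_minus_def smult_l_distr smult_l_neg neg_zero)
    then show "f \<odot>\<^bsub>N\<^esub> u \<in> vanishing_at y"
      unfolding vanishing_at_def using V f uN by auto
  qed
qed simp

lemma simple_faithful_orbit:
  assumes simple: "simple_left_module \<Gamma> N" and faithful: "faithful_left_module \<Gamma> N"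
  shows "\<exists>x\<in>units G. orbit_detects_zero G S x"
proof -
  let ?K = "\<lambda>T. {u \<in> carrier N. \<forall>y\<in>T. u \<in> vanishing_at y}"
  obtain f0 u0 where f0: "f0 \<in> carrier \<Gamma>" and u0: "u0 \<in> carrier N" and nz: "f0 \<odot>\<^bsub>N\<^esub> u0 \<noteq> \<zero>\<^bsub>N\<^esub>"
    using simple by (auto simp: simple_left_module_def)
  \<comment> \<open>Otherwise \<open>u0\<close> is locally zero at each unit. Finitely many of the
    corresponding compact open sets cover the domains of the support of \<open>f0\<close>; their
    union gives a right unit of \<open>f0\<close> that kills \<open>u0\<close>, contradicting
    \<open>f0 u0 \<noteq> 0\<close>.\<close>
  have "?K (units G) \<noteq> carrier N"
  proof
    assume eq: "?K (units G) = carrier N"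
    obtain C where C: "compactin X0 C" "d ` supp f0 \<subseteq> C" using compact_dom_supp[OF f0] by blast
    let ?\<U> = "{W. openin X0 W \<and> compactin X0 W \<and> one_on W \<odot>\<^bsub>N\<^esub> u0 = \<zero>\<^bsub>N\<^esub>}"
    have "C \<subseteq> \<Union>?\<U>"
    proof
      fix y assume "y \<in> C"
      then have "y \<in> units G" using compactin_subset_topspace[OF C(1)] by auto
      then have "u0 \<in> vanishing_at y" using eq u0 by blast
      then show "y \<in> \<Union>?\<U>" by (auto simp: vanishing_at_def)
    qed
    then obtain \<F> where \<F>: "finite \<F>" "\<F> \<subseteq> ?\<U>" "C \<subseteq> \<Union>\<F>"
      using compactinD[OF C(1), of ?\<U>] by auto
    let ?W = "\<Union>\<F>"
    have W: "openin X0 ?W" "compactin X0 ?W" "one_on ?W \<odot>\<^bsub>N\<^esub> u0 = \<zero>\<^bsub>N\<^esub>"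
      using one_on_Union[OF \<F>(1) u0] \<F>(2) by auto
    have Wu: "?W \<subseteq> units G" using W(1) by (simp only: openin_unit_space)
    have "f0 \<otimes>\<^bsub>\<Gamma>\<^esub> one_on ?W = f0"
    proof (rule Gamma_eqI)
      fix \<gamma> assume \<gamma>: "\<gamma> \<in> arrows G"
      have "\<gamma> \<in> supp f0 \<Longrightarrow> d \<gamma> \<in> ?W" using C(2) \<F>(3) by blast
      then show "(f0 \<otimes>\<^bsub>\<Gamma>\<^esub> one_on ?W) \<gamma> = f0 \<gamma>"
        using convolution_one_on[OF Wu f0 \<gamma>] not_supp[OF \<gamma>, of f0]
          by (cases "\<gamma> \<in> supp f0"; simp add: Gamma_ops(3))
    qed (use f0 W in \<open>simp_all add: Gamma_mult_closed one_on_Gamma\<close>)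
    then have "f0 \<odot>\<^bsub>N\<^esub> u0 = f0 \<odot>\<^bsub>N\<^esub> (one_on ?W \<odot>\<^bsub>N\<^esub> u0)"
      using smult_assoc[of f0 "one_on ?W" u0] f0 u0 W by (simp add: one_on_Gamma)
    then show False using nz W f0 by simp
  qed
  moreover have "submodule (?K (units G)) \<Gamma> N" by (rule submodule_vanishing) auto
  ultimately have "?K (units G) = {\<zero>\<^bsub>N\<^esub>}" using simpleD[OF simple] by blast
  moreover have "f0 \<odot>\<^bsub>N\<^esub> u0 \<in> carrier N" using f0 u0 by simp
  \<comment> \<open>The orbit is found here: a nonzero element is not locally zero everywhere, and
    any unit at which it fails to be so will do.\<close>
  ultimately obtain x where x: "x \<in> units G" "f0 \<odot>\<^bsub>N\<^esub> u0 \<notin> vanishing_at x" using nz by blast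
  have "submodule (?K (orbit G x)) \<Gamma> N"
    by (rule submodule_vanishing) (use orbit_units orbit_invariant in auto)
  moreover have "?K (orbit G x) \<noteq> carrier N"
    using x orbit_self[OF x(1)] \<open>f0 \<odot>\<^bsub>N\<^esub> u0 \<in> carrier N\<close> by blast
  ultimately have K: "?K (orbit G x) = {\<zero>\<^bsub>N\<^esub>}" using simpleD[OF simple] by blast
  have "orbit_detects_zero G S x"
    unfolding orbit_detects_zero_def
  proof (intro ballI impI)
    fix f assume f: "f \<in> carrier \<Gamma>"
      and zero: "\<forall>\<gamma>\<in>arrows G. d \<gamma> \<in> orbit G x \<longrightarrow> f \<gamma> = \<zero>\<^bsub>\<O> (r \<gamma>)\<^esub>"
    have "f \<odot>\<^bsub>N\<^esub> u = \<zero>\<^bsub>N\<^esub>" if u: "u \<in> carrier N" for u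
    proof -
      have "f \<odot>\<^bsub>N\<^esub> u \<in> vanishing_at y" if y: "y \<in> orbit G x" for y
      proof -
        \<comment> \<open>Orbits are invariant, so vanishing on arrows with domain in the orbit is
          the same as vanishing on arrows with range in it. Thus \<open>f\<close> is zero on all of
          \<open>r\<^sup>-\<^sup>1(y)\<close> and \<open>Gamma_vanish_near\<close> applies.\<close>
        have "f \<gamma> = \<zero>\<^bsub>\<O> y\<^esub>" if "\<gamma> \<in> arrows G" "r \<gamma> = y" for \<gamma>
          using zero that y orbit_invariant[OF that(1), of x] by auto
        then obtain W where W: "openin X0 W" "compactin X0 W" "y \<in> W"
            "\<And>\<gamma>. \<gamma> \<in> arrows G \<Longrightarrow> r \<gamma> \<in> W \<Longrightarrow> f \<gamma> = \<zero>\<^bsub>\<O> (r \<gamma>)\<^esub>"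
          using Gamma_vanish_near[OF f orbit_units[OF y]] by auto
        have "one_on W \<otimes>\<^bsub>\<Gamma>\<^esub> f = \<zero>\<^bsub>\<Gamma>\<^esub>"
          using W(1,2) f W(4) by (rule one_on_mult_eq_zero)
        then have "one_on W \<odot>\<^bsub>N\<^esub> (f \<odot>\<^bsub>N\<^esub> u) = \<zero>\<^bsub>N\<^esub>"
          using smult_assoc[of "one_on W" f u] W f u by (simp add: one_on_Gamma)
        then show ?thesis unfolding vanishing_at_def using W f u by auto
      qed
      then have "f \<odot>\<^bsub>N\<^esub> u \<in> ?K (orbit G x)" using f u by simp
      then show ?thesis unfolding K by simp
    qed
    then show "f = \<zero>\<^bsub>\<Gamma>\<^esub>" using faithful f by (simp add: faithful_left_module_def)
  qed
  then show ?thesis using x(1) by blast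
qed

end

section \<open>Induction from the isotropy group\<close>

locale isotropy_sheaf = ample_groupoid_sheaf G S
  for G :: "('g, 'm) top_groupoid_scheme" and S :: "('g, 'e, 'n) gsheaf_rings_scheme" +
  fixes x :: 'g
  assumes x: "x \<in> units G"
begin

abbreviation Gx :: "'g set"
  where "Gx \<equiv> isotropy G x"

abbreviation Orb :: "'g set"
  where "Orb \<equiv> orbit G x"

abbreviation B :: "('g \<Rightarrow> 'e) ring"
  where "B \<equiv> skew_group_ring G S x"

sublocale Ox: ring "\<O> x"
  using x by (rule sheaf.stalk_ring)

lemma isotropy_iff: "\<delta> \<in> Gx \<longleftrightarrow> \<delta> \<in> arrows G \<and> d \<delta> = x \<and> r \<delta> = x"
  by (simp add: isotropy_def)

lemma B_carrier: "a \<in> carrier B \<longleftrightarrow> a \<in> Gx \<rightarrow>\<^sub>E carrier (\<O> x) \<and>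
    finite {\<delta> \<in> Gx. a \<delta> \<noteq> \<zero>\<^bsub>\<O> x\<^esub>}"
  by (simp add: skew_group_ring_def)

lemma B_closed: "a \<in> carrier B \<Longrightarrow> \<delta> \<in> Gx \<Longrightarrow> a \<delta> \<in> carrier (\<O> x)"
  by (auto simp: B_carrier)

lemma B_eqI: "a \<in> carrier B \<Longrightarrow> b \<in> carrier B \<Longrightarrow> (\<And>\<delta>. \<delta> \<in> Gx \<Longrightarrow> a \<delta> = b \<delta>) \<Longrightarrow> a = b"
  by (auto simp: B_carrier intro: PiE_ext)

lemma B_apply:
  "\<delta> \<in> Gx \<Longrightarrow> (a \<oplus>\<^bsub>B\<^esub> b) \<delta> = a \<delta> \<oplus>\<^bsub>\<O> x\<^esub> b \<delta>"
  "\<delta> \<in> Gx \<Longrightarrow> \<zero>\<^bsub>B\<^esub> \<delta> = \<zero>\<^bsub>\<O> x\<^esub>"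
  by (simp_all add: skew_group_ring_def)

lemma B_abelian_group: "abelian_group B"
  by (rule finitely_supported_abelian_group[OF Ox.abelian_group_axioms]) (simp_all add: skew_group_ring_def)

sublocale B: abelian_group B
  by (rule B_abelian_group)

lemma B_term_closed:
  assumes "a \<in> carrier B" "b \<in> carrier B" "\<delta> \<in> Gx" "\<eta> \<in> Gx"
  shows "a \<delta> \<otimes>\<^bsub>\<O> x\<^esub> act S \<delta> (b \<eta>) \<in> carrier (\<O> x)"
  using assms B_closed act_closed[of \<delta> "b \<eta>"] by (simp add: isotropy_iff)

text \<open>As for \<open>convolution_apply\<close>, the left factor determines the right one. The
  terms added when passing from the pairs of nonzero coefficients to all of \<open>A\<close> are
  zero.\<close>

lemma B_mult_apply:
  assumes a: "a \<in> carrier B" and b: "b \<in> carrier B" and \<epsilon>: "\<epsilon> \<in> Gx"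
    and A: "finite A" "A \<subseteq> Gx" "\<And>\<delta>. \<delta> \<in> Gx \<Longrightarrow> a \<delta> \<noteq> \<zero>\<^bsub>\<O> x\<^esub> \<Longrightarrow> \<delta> \<in> A"
  shows "(a \<otimes>\<^bsub>B\<^esub> b) \<epsilon> = finsum (\<O> x) (\<lambda>\<delta>. a \<delta> \<otimes>\<^bsub>\<O> x\<^esub> act S \<delta> (b (ldiv \<delta> \<epsilon>))) A"
proof -
  let ?R = "\<O> x"
  let ?h = "\<lambda>\<delta>. (\<delta>, ldiv \<delta> \<epsilon>)"
  let ?u = "\<lambda>(\<delta>, \<eta>). a \<delta> \<otimes>\<^bsub>?R\<^esub> act S \<delta> (b \<eta>)"
  let ?N = "{\<delta> \<in> A. a \<delta> \<noteq> \<zero>\<^bsub>?R\<^esub> \<and> b (ldiv \<delta> \<epsilon>) \<noteq> \<zero>\<^bsub>?R\<^esub>}"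
  have iso: "ldiv \<delta> \<epsilon> \<in> Gx" if "\<delta> \<in> Gx" for \<delta>
    using that \<epsilon> by (simp add: isotropy_iff)
  have eq: "{(\<delta>, \<eta>) \<in> Gx \<times> Gx. gmult G \<delta> \<eta> = \<epsilon> \<and>
      a \<delta> \<noteq> \<zero>\<^bsub>?R\<^esub> \<and> b \<eta> \<noteq> \<zero>\<^bsub>?R\<^esub>} = ?h ` ?N" (is "?I = _")
  proof (intro equalityI subsetI)
    fix p assume "p \<in> ?I"
    then obtain \<delta> \<eta> where p: "p = (\<delta>, \<eta>)" "\<delta> \<in> Gx" "\<eta> \<in> Gx" "gmult G \<delta> \<eta> = \<epsilon>"
        "a \<delta> \<noteq> \<zero>\<^bsub>?R\<^esub>" "b \<eta> \<noteq> \<zero>\<^bsub>?R\<^esub>" by auto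
    then have "ldiv \<delta> \<epsilon> = \<eta>" using inv_mult_cancel[of \<delta> \<eta>] by (simp add: isotropy_iff)
    then show "p \<in> ?h ` ?N" using p A(3) by (intro image_eqI[of _ _ \<delta>]) simp_all
  next
    fix p assume "p \<in> ?h ` ?N"
    then obtain \<delta> where \<delta>: "p = ?h \<delta>" "\<delta> \<in> A" "a \<delta> \<noteq> \<zero>\<^bsub>?R\<^esub>" "b (ldiv \<delta> \<epsilon>) \<noteq> \<zero>\<^bsub>?R\<^esub>" by auto
    then have "\<delta> \<in> Gx" using A(2) by auto
    moreover from this have "gmult G \<delta> (ldiv \<delta> \<epsilon>) = \<epsilon>" using \<epsilon> by (simp add: isotropy_iff)
    ultimately show "p \<in> ?I" using \<delta> iso by simp
  qed
  have closed: "a \<delta> \<otimes>\<^bsub>?R\<^esub> act S \<delta> (b (ldiv \<delta> \<epsilon>)) \<in> carrier ?R" if "\<delta> \<in> A" for \<delta>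
    using that A(2) iso by (intro B_term_closed[OF a b]) auto
  have "(a \<otimes>\<^bsub>B\<^esub> b) \<epsilon> = finsum ?R ?u ?I" using \<epsilon> by (simp add: skew_group_ring_def)
  also have "\<dots> = finsum ?R ?u (?h ` ?N)" by (rule arg_cong[OF eq])
  also have "\<dots> = finsum ?R (\<lambda>\<delta>. ?u (?h \<delta>)) ?N"
    using closed by (intro Ox.finsum_reindex) (auto simp: inj_on_def)
  also have "\<dots> = finsum ?R (\<lambda>\<delta>. ?u (?h \<delta>)) A"
  proof (rule Ox.finsum_superset)
    fix \<delta> assume \<delta>: "\<delta> \<in> A - ?N"
    then have \<delta>I: "\<delta> \<in> Gx" using A(2) by auto
    then have \<delta>x: "\<delta> \<in> arrows G" "d \<delta> = x" "r \<delta> = x" by (simp_all add: isotropy_iff)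
    have "act S \<delta> \<zero>\<^bsub>?R\<^esub> = \<zero>\<^bsub>?R\<^esub>" using act_zero[OF \<delta>x(1)] \<delta>x by simp
    moreover have "act S \<delta> (b (ldiv \<delta> \<epsilon>)) \<in> carrier ?R"
      using act_closed[OF \<delta>x(1)] \<delta>x B_closed[OF b iso[OF \<delta>I]] by simp
    ultimately show "?u (?h \<delta>) = \<zero>\<^bsub>?R\<^esub>" using \<delta> B_closed[OF a \<delta>I] by auto
  qed (use A(1) closed in auto)
  finally show ?thesis by simp
qed

lemma B_mult_closed:
  assumes a: "a \<in> carrier B" and b: "b \<in> carrier B"
  shows "a \<otimes>\<^bsub>B\<^esub> b \<in> carrier B"
proof -
  let ?R = "\<O> x"
  let ?A = "{\<delta> \<in> Gx. a \<delta> \<noteq> \<zero>\<^bsub>?R\<^esub>}" and ?C = "{\<delta> \<in> Gx. b \<delta> \<noteq> \<zero>\<^bsub>?R\<^esub>}"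
  have fin: "finite ?A" "finite ?C" using a b by (auto simp: B_carrier)
  have iso: "ldiv \<delta> \<epsilon> \<in> Gx" if "\<delta> \<in> Gx" "\<epsilon> \<in> Gx" for \<delta> \<epsilon>
    using that by (simp add: isotropy_iff)
  have eq: "(a \<otimes>\<^bsub>B\<^esub> b) \<epsilon> = finsum ?R (\<lambda>\<delta>. a \<delta> \<otimes>\<^bsub>?R\<^esub> act S \<delta> (b (ldiv \<delta> \<epsilon>))) ?A"
    if "\<epsilon> \<in> Gx" for \<epsilon>
    using that fin by (intro B_mult_apply[OF a b]) auto
  have "(a \<otimes>\<^bsub>B\<^esub> b) \<epsilon> \<in> carrier ?R" if "\<epsilon> \<in> Gx" for \<epsilon>
    unfolding eq[OF that] using B_term_closed[OF a b] iso that by (intro Ox.finsum_closed) auto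
  moreover have "a \<otimes>\<^bsub>B\<^esub> b \<in> extensional Gx" by (simp add: skew_group_ring_def)
  moreover have "{\<epsilon> \<in> Gx. (a \<otimes>\<^bsub>B\<^esub> b) \<epsilon> \<noteq> \<zero>\<^bsub>?R\<^esub>} \<subseteq> (\<lambda>(\<delta>, \<eta>). gmult G \<delta> \<eta>) ` (?A \<times> ?C)"
  proof
    fix \<epsilon> assume "\<epsilon> \<in> {\<epsilon> \<in> Gx. (a \<otimes>\<^bsub>B\<^esub> b) \<epsilon> \<noteq> \<zero>\<^bsub>?R\<^esub>}"
    then have \<epsilon>: "\<epsilon> \<in> Gx" and nz: "(a \<otimes>\<^bsub>B\<^esub> b) \<epsilon> \<noteq> \<zero>\<^bsub>?R\<^esub>" by auto
    show "\<epsilon> \<in> (\<lambda>(\<delta>, \<eta>). gmult G \<delta> \<eta>) ` (?A \<times> ?C)"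
    proof (rule ccontr)
      assume out: "\<epsilon> \<notin> (\<lambda>(\<delta>, \<eta>). gmult G \<delta> \<eta>) ` (?A \<times> ?C)"
      have "a \<delta> \<otimes>\<^bsub>?R\<^esub> act S \<delta> (b (ldiv \<delta> \<epsilon>)) = \<zero>\<^bsub>?R\<^esub>" if \<delta>: "\<delta> \<in> ?A" for \<delta>
      proof -
        let ?\<eta> = "ldiv \<delta> \<epsilon>"
        have \<delta>x: "\<delta> \<in> arrows G" "d \<delta> = x" "r \<delta> = x" using \<delta> by (simp_all add: isotropy_iff)
        have \<eta>: "?\<eta> \<in> Gx" using \<delta> \<epsilon> iso by simp
        have prod: "\<epsilon> = gmult G \<delta> ?\<eta>" using \<delta>x \<epsilon> by (simp add: isotropy_iff)
        have "b ?\<eta> = \<zero>\<^bsub>?R\<^esub>"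
        proof (rule ccontr)
          assume "b ?\<eta> \<noteq> \<zero>\<^bsub>?R\<^esub>"
          then have "(\<delta>, ?\<eta>) \<in> ?A \<times> ?C" using \<delta> \<eta> by simp
          then show False using out prod by (metis (no_types, lifting) case_prod_conv image_eqI)
        qed
        moreover have "act S \<delta> \<zero>\<^bsub>?R\<^esub> = \<zero>\<^bsub>?R\<^esub>" using act_zero[OF \<delta>x(1)] \<delta>x by simp
        ultimately show ?thesis using B_closed[OF a, of \<delta>] \<delta> by simp
      qed
      then have "(a \<otimes>\<^bsub>B\<^esub> b) \<epsilon> = \<zero>\<^bsub>?R\<^esub>" unfolding eq[OF \<epsilon>] by (rule Ox.add.finprod_one_eqI)
      then show False using nz by simp
    qed
  qed
  then have "finite {\<epsilon> \<in> Gx. (a \<otimes>\<^bsub>B\<^esub> b) \<epsilon> \<noteq> \<zero>\<^bsub>?R\<^esub>}"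
    by (rule finite_subset) (use fin in simp)
  ultimately show ?thesis by (auto simp: B_carrier PiE_iff)
qed

text \<open>The arrows \<open>\<tau> y : x \<rightarrow> y\<close> identify \<open>{\<gamma>. d \<gamma> = y \<and> r \<gamma> = z}\<close> with the isotropy group at \<open>x\<close>.\<close>

definition \<tau> :: "'g \<Rightarrow> 'g"
  where "\<tau> y = (SOME \<gamma>. \<gamma> \<in> arrows G \<and> d \<gamma> = x \<and> r \<gamma> = y)"

lemma \<tau>: "y \<in> Orb \<Longrightarrow> \<tau> y \<in> arrows G" "y \<in> Orb \<Longrightarrow> d (\<tau> y) = x"
  "y \<in> Orb \<Longrightarrow> r (\<tau> y) = y"
proof -
  assume "y \<in> Orb"
  then have "\<exists>\<gamma>. \<gamma> \<in> arrows G \<and> d \<gamma> = x \<and> r \<gamma> = y" by (auto simp: orbit_eq)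
  then have "\<tau> y \<in> arrows G \<and> d (\<tau> y) = x \<and> r (\<tau> y) = y" unfolding \<tau>_def by (rule someI_ex)
  then show "\<tau> y \<in> arrows G" "d (\<tau> y) = x" "r (\<tau> y) = y" by simp_all
qed

definition push :: "'g \<Rightarrow> 'g \<Rightarrow> 'g \<Rightarrow> 'g"
  where "push z y \<delta> = gmult G (\<tau> z) (gmult G \<delta> (ginv G (\<tau> y)))"

definition pull :: "'g \<Rightarrow> 'g \<Rightarrow> 'g \<Rightarrow> 'g"
  where "pull z y \<gamma> = ldiv (\<tau> z) (gmult G \<gamma> (\<tau> y))"

lemma push:
  assumes "y \<in> Orb" "z \<in> Orb" "\<delta> \<in> Gx"
  shows "push z y \<delta> \<in> arrows G" "d (push z y \<delta>) = y" "r (push z y \<delta>) = z"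
    and "pull z y (push z y \<delta>) = \<delta>"
proof -
  note t = \<tau>[OF assms(1)] \<tau>[OF assms(2)]
  have \<delta>: "\<delta> \<in> arrows G" "d \<delta> = x" "r \<delta> = x" using assms(3) by (simp_all add: isotropy_iff)
  show "push z y \<delta> \<in> arrows G" "d (push z y \<delta>) = y" "r (push z y \<delta>) = z"
    using t \<delta> by (simp_all add: push_def)
  have "gmult G (push z y \<delta>) (\<tau> y) = gmult G (\<tau> z) \<delta>"
    using t \<delta> mult_unit[of \<delta> x] by (simp add: push_def mult_assoc inv_mult_self)
  then show "pull z y (push z y \<delta>) = \<delta>" using t \<delta> by (simp add: pull_def)
qed

lemma pull:
  assumes "y \<in> Orb" "z \<in> Orb" "\<gamma> \<in> arrows G" "d \<gamma> = y" "r \<gamma> = z"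
  shows "pull z y \<gamma> \<in> Gx" "push z y (pull z y \<gamma>) = \<gamma>"
    and "gmult G (pull z y \<gamma>) (ginv G (\<tau> y)) = ldiv (\<tau> z) \<gamma>"
proof -
  note t = \<tau>[OF assms(1)] \<tau>[OF assms(2)]
  show "pull z y \<gamma> \<in> Gx" using t assms(3-5) by (simp add: pull_def isotropy_iff)
  show eq: "gmult G (pull z y \<gamma>) (ginv G (\<tau> y)) = ldiv (\<tau> z) \<gamma>"
    using t assms(3-5) mult_unit[of \<gamma> y] by (simp add: pull_def mult_assoc mult_inv_self)
  show "push z y (pull z y \<gamma>) = \<gamma>" unfolding push_def eq using t assms(3-5) by simp
qed

text \<open>The inner factors \<open>ginv G (\<tau> w)\<close> and \<open>\<tau> w\<close> cancel.
  This is what makes the passage to matrices multiplicative despite the arbitrary choice of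
  \<tau>.\<close>

lemma pull_mult:
  assumes "y \<in> Orb" "w \<in> Orb" "z \<in> Orb"
    and "\<beta> \<in> arrows G" "d \<beta> = w" "r \<beta> = z" "\<rho> \<in> arrows G" "d \<rho> = y" "r \<rho> = w"
  shows "gmult G (pull z w \<beta>) (pull w y \<rho>) = pull z y (gmult G \<beta> \<rho>)"
proof -
  note t = \<tau>[OF assms(1)] \<tau>[OF assms(2)] \<tau>[OF assms(3)]
  have "gmult G (pull z w \<beta>) (pull w y \<rho>) = gmult G (gmult G (pull z w \<beta>) (ginv G (\<tau> w))) (gmult G \<rho> (\<tau> y))"
    using t assms(4-9) by (simp add: pull_def mult_assoc)
  also have "\<dots> = pull z y (gmult G \<beta> \<rho>)"
    unfolding pull(3)[OF assms(2,3,4,5,6)] using t assms(4-9) by (simp add: pull_def mult_assoc)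
  finally show ?thesis .
qed

text \<open>The matrix over \<open>B\<close>, with rows and columns indexed by the orbit, by which \<open>f\<close> acts on the
  module induced from a \<open>B\<close>-module.\<close>

definition mat :: "('g \<Rightarrow> 'e) \<Rightarrow> 'g \<Rightarrow> 'g \<Rightarrow> 'g \<Rightarrow> 'e"
  where "mat f z y = (\<lambda>\<delta>\<in>Gx. act S (ginv G (\<tau> z)) (f (push z y \<delta>)))"

lemma mat_closed:
  assumes f: "f \<in> carrier \<Gamma>" and y: "y \<in> Orb" and z: "z \<in> Orb"
  shows "mat f z y \<in> carrier B"
proof -
  note t = \<tau>[OF y] \<tau>[OF z]
  have "mat f z y \<delta> \<in> carrier (\<O> x)" if \<delta>: "\<delta> \<in> Gx" for \<delta>
    using act_closed[of "ginv G (\<tau> z)" "f (push z y \<delta>)"] Gamma_closed[OF f push(1)[OF y z \<delta>]] push[OF y z \<delta>] t \<delta>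
    by (simp add: mat_def)
  moreover have "finite {\<delta> \<in> Gx. mat f z y \<delta> \<noteq> \<zero>\<^bsub>\<O> x\<^esub>}"
  proof (rule inj_on_finite[OF _ _ finite_supp(1)[OF f, of z]])
    show "inj_on (push z y) {\<delta> \<in> Gx. mat f z y \<delta> \<noteq> \<zero>\<^bsub>\<O> x\<^esub>}"
      by (rule inj_on_inverseI[of _ "pull z y"]) (use push(4)[OF y z] in simp)
    show "push z y ` {\<delta> \<in> Gx. mat f z y \<delta> \<noteq> \<zero>\<^bsub>\<O> x\<^esub>} \<subseteq> {\<gamma> \<in> supp f. r \<gamma> = z}"
    proof
      fix \<gamma> assume "\<gamma> \<in> push z y ` {\<delta> \<in> Gx. mat f z y \<delta> \<noteq> \<zero>\<^bsub>\<O> x\<^esub>}"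
      then obtain \<delta> where \<delta>: "\<gamma> = push z y \<delta>" "\<delta> \<in> Gx" "mat f z y \<delta> \<noteq> \<zero>\<^bsub>\<O> x\<^esub>" by auto
      note p = push[OF y z \<delta>(2)]
      have "\<gamma> \<in> supp f"
      proof (rule ccontr)
        assume "\<gamma> \<notin> supp f"
        then have "f \<gamma> = \<zero>\<^bsub>\<O> z\<^esub>" using not_supp[of \<gamma> f] p \<delta>(1) by simp
        then show False using \<delta> act_zero[of "ginv G (\<tau> z)"] t by (simp add: mat_def)
      qed
      then show "\<gamma> \<in> {\<gamma> \<in> supp f. r \<gamma> = z}" using p \<delta>(1) by simp
    qed
  qed
  ultimately show ?thesis by (auto simp: B_carrier mat_def)
qed

lemma mat_eq_zero:
  assumes "y \<in> Orb" "z \<in> Orb"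
    and "\<And>\<gamma>. \<gamma> \<in> arrows G \<Longrightarrow> d \<gamma> = y \<Longrightarrow> r \<gamma> = z \<Longrightarrow> f \<gamma> = \<zero>\<^bsub>\<O> z\<^esub>"
  shows "mat f z y = \<zero>\<^bsub>B\<^esub>"
proof -
  have "act S (ginv G (\<tau> z)) (f (push z y \<delta>)) = \<zero>\<^bsub>\<O> x\<^esub>" if "\<delta> \<in> Gx" for \<delta>
    using assms(3)[OF push(1-3)[OF assms(1,2) that]] act_zero[of "ginv G (\<tau> z)"] \<tau>[OF assms(2)] by simp
  then show ?thesis by (auto simp: mat_def skew_group_ring_def restrict_def)
qed

lemma mat_eq_zeroD:
  assumes f: "f \<in> carrier \<Gamma>" and zero: "mat f z y = \<zero>\<^bsub>B\<^esub>" and y: "y \<in> Orb" and z: "z \<in> Orb"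
    and \<gamma>: "\<gamma> \<in> arrows G" "d \<gamma> = y" "r \<gamma> = z"
  shows "f \<gamma> = \<zero>\<^bsub>\<O> z\<^esub>"
proof -
  note p = pull[OF y z \<gamma>] and t = \<tau>[OF z]
  have "act S (ginv G (\<tau> z)) (f \<gamma>) = mat f z y (pull z y \<gamma>)" using p by (simp add: mat_def)
  also have "\<dots> = \<zero>\<^bsub>\<O> x\<^esub>" using p(1) by (simp add: zero B_apply)
  finally have "act S (\<tau> z) (act S (ginv G (\<tau> z)) (f \<gamma>)) = \<zero>\<^bsub>\<O> z\<^esub>" using act_zero[of "\<tau> z"] t by simp
  then show ?thesis using act_act_inv[of "\<tau> z" "f \<gamma>"] Gamma_closed[OF f \<gamma>(1)] t \<gamma>(3) by simp
qed

lemma mat_add: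
  assumes f: "f \<in> carrier \<Gamma>" and g: "g \<in> carrier \<Gamma>" and y: "y \<in> Orb" and z: "z \<in> Orb"
  shows "mat (f \<oplus>\<^bsub>\<Gamma>\<^esub> g) z y = mat f z y \<oplus>\<^bsub>B\<^esub> mat g z y"
proof (rule B_eqI)
  fix \<delta> assume \<delta>: "\<delta> \<in> Gx"
  note p = push[OF y z \<delta>]
  show "mat (f \<oplus>\<^bsub>\<Gamma>\<^esub> g) z y \<delta> = (mat f z y \<oplus>\<^bsub>B\<^esub> mat g z y) \<delta>"
    using act_add[of "ginv G (\<tau> z)" "f (push z y \<delta>)" "g (push z y \<delta>)"] Gamma_closed[OF f p(1)] Gamma_closed[OF g p(1)]
      p \<tau>[OF z] \<delta> by (simp add: mat_def B_apply Gamma_apply)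
qed (use assms in \<open>simp_all add: mat_closed\<close>)

text \<open>Factorizations of an arrow from \<open>y\<close> to \<open>z\<close> are grouped by the
  intermediate unit \<open>w\<close>; those through a fixed \<open>w\<close> make up one product in
  the skew group ring. The set \<open>W\<close> may be larger than the support of the row, as the
  module action requires.\<close>

lemma mat_mult:
  assumes f: "f \<in> carrier \<Gamma>" and g: "g \<in> carrier \<Gamma>" and y: "y \<in> Orb" and z: "z \<in> Orb"
    and W: "finite W" "W \<subseteq> Orb" "\<And>\<gamma>. \<gamma> \<in> supp f \<Longrightarrow> r \<gamma> = z \<Longrightarrow> d \<gamma> \<in> W"
  shows "mat (f \<otimes>\<^bsub>\<Gamma>\<^esub> g) z y = finsum B (\<lambda>w. mat f z w \<otimes>\<^bsub>B\<^esub> mat g w y) W"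
proof (rule B_eqI)
  have Wo: "w \<in> Orb" if "w \<in> W" for w using that W(2) by auto
  have closed: "mat f z w \<otimes>\<^bsub>B\<^esub> mat g w y \<in> carrier B" if "w \<in> W" for w
    using f g y z Wo[OF that] by (intro B_mult_closed mat_closed)
  show "mat (f \<otimes>\<^bsub>\<Gamma>\<^esub> g) z y \<in> carrier B" using f g y z by (intro mat_closed Gamma_mult_closed)
  show "finsum B (\<lambda>w. mat f z w \<otimes>\<^bsub>B\<^esub> mat g w y) W \<in> carrier B" using closed by (intro B.finsum_closed) auto
  fix \<epsilon> assume \<epsilon>: "\<epsilon> \<in> Gx"
  let ?R = "\<O> x" and ?i = "ginv G (\<tau> z)"
  define \<gamma> where "\<gamma> = push z y \<epsilon>"
  have \<gamma>: "\<gamma> \<in> arrows G" "d \<gamma> = y" "r \<gamma> = z" "pull z y \<gamma> = \<epsilon>" using push[OF y z \<epsilon>] by (simp_all add: \<gamma>_def)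
  note t = \<tau>[OF z]
  interpret Oz: ring "\<O> z" using orbit_units[OF z] by (rule sheaf.stalk_ring)
  let ?A = "{\<beta> \<in> supp f. r \<beta> = z}" and ?\<rho> = "\<lambda>\<beta>. ldiv \<beta> \<gamma>"
  \<comment> \<open>The convolution term carried to the stalk at \<open>x\<close> along the inverse
    of \<open>\<tau> z\<close>. Both sides of the identity are reduced to sums of these
    terms.\<close>
  let ?t = "\<lambda>\<beta>. act S ?i (f \<beta>) \<otimes>\<^bsub>?R\<^esub> act S (gmult G ?i \<beta>) (g (?\<rho> \<beta>))"
  have A: "finite ?A" using f by (rule finite_supp(1))
  have \<beta>: "\<beta> \<in> arrows G" "r \<beta> = z" "d \<beta> \<in> W" "d \<beta> \<in> Orb" "f \<beta> \<in> carrier (\<O> z)"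
    "?\<rho> \<beta> \<in> arrows G" "d (?\<rho> \<beta>) = y" "r (?\<rho> \<beta>) = d \<beta>"
    "g (?\<rho> \<beta>) \<in> carrier (\<O> (d \<beta>))"
    if "\<beta> \<in> ?A" for \<beta>
  proof -
    show b: "\<beta> \<in> arrows G" "r \<beta> = z" using that by (auto simp: supp_def)
    show w: "d \<beta> \<in> W" using that W(3) by simp
    then show "d \<beta> \<in> Orb" by (rule Wo)
    show "f \<beta> \<in> carrier (\<O> z)" using Gamma_closed[OF f b(1)] b by simp
    show r: "?\<rho> \<beta> \<in> arrows G" "d (?\<rho> \<beta>) = y" "r (?\<rho> \<beta>) = d \<beta>" using b \<gamma> by simp_all
    show "g (?\<rho> \<beta>) \<in> carrier (\<O> (d \<beta>))" using Gamma_closed[OF g r(1)] r by simp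
  qed
  have act_i: "act S ?i e \<in> carrier ?R" if "e \<in> carrier (\<O> z)" for e
    using act_closed[of ?i e] t that by simp
  have act_\<beta>: "act S \<beta> (g (?\<rho> \<beta>)) \<in> carrier (\<O> z)" if "\<beta> \<in> ?A" for \<beta>
    using act_closed[of \<beta> "g (?\<rho> \<beta>)"] \<beta>[OF that] by simp
  have act_i\<beta>: "act S ?i (act S \<beta> (g (?\<rho> \<beta>))) = act S (gmult G ?i \<beta>) (g (?\<rho> \<beta>))" if "\<beta> \<in> ?A" for \<beta>
    using act_comp[of ?i \<beta> "g (?\<rho> \<beta>)"] \<beta>[OF that] t by simp
  have t_closed: "?t \<beta> \<in> carrier ?R" if "\<beta> \<in> ?A" for \<beta>
    using act_i[OF \<beta>(5)[OF that]] act_i[OF act_\<beta>[OF that]] act_i\<beta>[OF that] by simp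
  have "mat (f \<otimes>\<^bsub>\<Gamma>\<^esub> g) z y \<epsilon> = act S ?i (conv f g \<gamma>)"
    using \<epsilon> by (simp add: mat_def \<gamma>_def Gamma_ops(3))
  also have "conv f g \<gamma> = finsum (\<O> z) (\<lambda>\<beta>. f \<beta> \<otimes>\<^bsub>\<O> z\<^esub> act S \<beta> (g (?\<rho> \<beta>))) ?A"
    using convolution_apply_Gamma[OF f Gamma_sections[OF g] \<gamma>(1)] \<gamma>(3) by simp
  also have "act S ?i \<dots> = finsum ?R (\<lambda>\<beta>. act S ?i (f \<beta> \<otimes>\<^bsub>\<O> z\<^esub> act S \<beta> (g (?\<rho> \<beta>)))) ?A"
  proof (rule finsum_hom)
    show "abelian_monoid (\<O> z)" "abelian_monoid ?R" by unfold_locales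
    show "act S ?i \<zero>\<^bsub>\<O> z\<^esub> = \<zero>\<^bsub>?R\<^esub>" using act_zero[of ?i] t by simp
    show "act S ?i (a \<oplus>\<^bsub>\<O> z\<^esub> b) = act S ?i a \<oplus>\<^bsub>?R\<^esub> act S ?i b"
      if "a \<in> carrier (\<O> z)" "b \<in> carrier (\<O> z)" for a b
      using act_add[of ?i a b] t that by simp
    show "f \<beta> \<otimes>\<^bsub>\<O> z\<^esub> act S \<beta> (g (?\<rho> \<beta>)) \<in> carrier (\<O> z)" if "\<beta> \<in> ?A" for \<beta>
      using \<beta>(5)[OF that] act_\<beta>[OF that] by simp
  qed (use A act_i in auto)
  also have "\<dots> = finsum ?R ?t ?A"
  proof (rule Ox.finsum_cong'[OF refl])
    show "act S ?i (f \<beta> \<otimes>\<^bsub>\<O> z\<^esub> act S \<beta> (g (?\<rho> \<beta>))) = ?t \<beta>" if "\<beta> \<in> ?A" for \<beta>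
      using act_mult[of ?i "f \<beta>" "act S \<beta> (g (?\<rho> \<beta>))"] \<beta>(5)[OF that] act_\<beta>[OF that] act_i\<beta>[OF that] t by simp
  qed (use t_closed in blast)
  \<comment> \<open>From here on the left factors are sorted by their domain \<open>w\<close>, the
    column index of the first matrix.\<close>
  also have "\<dots> = finsum ?R ?t (\<Union>w\<in>W. {\<beta> \<in> ?A. d \<beta> = w})"
    using \<beta>(3) by (intro arg_cong[of _ _ "finsum ?R ?t"]) blast
  also have "\<dots> = finsum ?R (\<lambda>w. finsum ?R ?t {\<beta> \<in> ?A. d \<beta> = w}) W"
  proof (rule Ox.add.finprod_UN_disjoint[OF W(1)])
    show "finite {\<beta> \<in> ?A. d \<beta> = w}" for w by (rule finite_subset[OF _ A]) auto
    show "pairwise (\<lambda>v w. disjnt {\<beta> \<in> ?A. d \<beta> = v} {\<beta> \<in> ?A. d \<beta> = w}) W"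
      by (auto simp: pairwise_def disjnt_def)
  qed (use t_closed in blast)
  also have "\<dots> = finsum ?R (\<lambda>w. (mat f z w \<otimes>\<^bsub>B\<^esub> mat g w y) \<epsilon>) W"
  proof (rule Ox.finsum_cong'[OF refl])
    show "(\<lambda>w. (mat f z w \<otimes>\<^bsub>B\<^esub> mat g w y) \<epsilon>) \<in> W \<rightarrow> carrier ?R" using closed B_closed \<epsilon> by blast
    fix w assume w: "w \<in> W"
    note wo = Wo[OF w]
    let ?Aw = "{\<beta> \<in> ?A. d \<beta> = w}"
    have Aw: "\<beta> \<in> ?A" "d \<beta> = w" "pull z w \<beta> \<in> Gx" "push z w (pull z w \<beta>) = \<beta>"
      "gmult G (pull z w \<beta>) (ginv G (\<tau> w)) = gmult G ?i \<beta>"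
      if "\<beta> \<in> ?Aw" for \<beta>
      using that pull[OF wo z, of \<beta>] \<beta>[of \<beta>] by simp_all
    have mf: "mat f z w \<in> carrier B" and mg: "mat g w y \<in> carrier B" using f g y z wo by (simp_all add: mat_closed)
    have inj: "inj_on (pull z w) ?Aw" by (rule inj_on_inverseI[of _ "push z w"]) (rule Aw(4))
    have "(mat f z w \<otimes>\<^bsub>B\<^esub> mat g w y) \<epsilon> = finsum ?R
        (\<lambda>\<delta>. mat f z w \<delta> \<otimes>\<^bsub>?R\<^esub> act S \<delta> (mat g w y (ldiv \<delta> \<epsilon>))) (pull z w ` ?Aw)"
    proof (rule B_mult_apply[OF mf mg \<epsilon>])
      show "finite (pull z w ` ?Aw)" by (rule finite_imageI, rule finite_subset[OF _ A]) auto
      show "pull z w ` ?Aw \<subseteq> Gx" using Aw(3) by blast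
      fix \<delta> assume \<delta>: "\<delta> \<in> Gx" "mat f z w \<delta> \<noteq> \<zero>\<^bsub>?R\<^esub>"
      note p = push[OF wo z \<delta>(1)]
      have "push z w \<delta> \<in> supp f"
      proof (rule ccontr)
        assume "push z w \<delta> \<notin> supp f"
        then have "f (push z w \<delta>) = \<zero>\<^bsub>\<O> z\<^esub>" using not_supp[of "push z w \<delta>" f] p by simp
        then show False using \<delta> act_zero[of ?i] t by (simp add: mat_def)
      qed
      then have "push z w \<delta> \<in> ?Aw" using p by simp
      then show "\<delta> \<in> pull z w ` ?Aw" by (rule rev_image_eqI) (rule p(4)[symmetric])
    qed
    also have "\<dots> = finsum ?R (\<lambda>\<beta>. mat f z w (pull z w \<beta>) \<otimes>\<^bsub>?R\<^esub>
        act S (pull z w \<beta>) (mat g w y (ldiv (pull z w \<beta>) \<epsilon>))) ?Aw"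
    proof (rule Ox.finsum_reindex[OF _ inj], rule Pi_I)
      fix \<delta> assume "\<delta> \<in> pull z w ` ?Aw"
      then have \<delta>: "\<delta> \<in> Gx" using Aw(3) by blast
      then have "ldiv \<delta> \<epsilon> \<in> Gx" using \<epsilon> by (simp add: isotropy_iff)
      then show "mat f z w \<delta> \<otimes>\<^bsub>?R\<^esub> act S \<delta> (mat g w y (ldiv \<delta> \<epsilon>)) \<in> carrier ?R"
        using \<delta> by (intro B_term_closed[OF mf mg])
    qed
    also have "\<dots> = finsum ?R ?t ?Aw"
    proof (rule Ox.finsum_cong'[OF refl])
      show "?t \<in> ?Aw \<rightarrow> carrier ?R" using t_closed by blast
      fix \<beta> assume "\<beta> \<in> ?Aw"
      note a = Aw[OF this]
      note b = \<beta>[OF a(1)]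
      have \<rho>: "pull w y (?\<rho> \<beta>) \<in> Gx" "push w y (pull w y (?\<rho> \<beta>)) = ?\<rho> \<beta>"
        using pull[OF y wo b(6,7)] b(8) a(2) by simp_all
      \<comment> \<open>Factorizations of the arrow correspond to factorizations of \<epsilon> in
        the isotropy group, which identifies the quotient needed for the second matrix
        entry.\<close>
      have "gmult G (pull z w \<beta>) (pull w y (?\<rho> \<beta>)) = \<epsilon>"
        using pull_mult[OF y wo z b(1) a(2) b(2) b(6,7)] b a(2) \<gamma> by simp
      then have inv: "ldiv (pull z w \<beta>) \<epsilon> = pull w y (?\<rho> \<beta>)"
        using inv_mult_cancel[of "pull z w \<beta>" "pull w y (?\<rho> \<beta>)"] a(3) \<rho>(1) by (simp add: isotropy_iff)
      have "mat g w y (pull w y (?\<rho> \<beta>)) = act S (ginv G (\<tau> w)) (g (?\<rho> \<beta>))" using \<rho> by (simp add: mat_def)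
      moreover have "act S (pull z w \<beta>) (act S (ginv G (\<tau> w)) (g (?\<rho> \<beta>))) = act S (gmult G ?i \<beta>) (g (?\<rho> \<beta>))"
        using act_comp[of "pull z w \<beta>" "ginv G (\<tau> w)" "g (?\<rho> \<beta>)"] a(2,3,5) b(9) \<tau>[OF wo] by (simp add: isotropy_iff)
      moreover have "mat f z w (pull z w \<beta>) = act S ?i (f \<beta>)" using a(3,4) by (simp add: mat_def)
      ultimately show "mat f z w (pull z w \<beta>) \<otimes>\<^bsub>?R\<^esub>
          act S (pull z w \<beta>) (mat g w y (ldiv (pull z w \<beta>) \<epsilon>)) = ?t \<beta>"
        unfolding inv by simp
    qed
    finally show "finsum ?R ?t ?Aw = (mat f z w \<otimes>\<^bsub>B\<^esub> mat g w y) \<epsilon>" by simp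
  qed
  \<comment> \<open>Evaluation at \<epsilon> is additive and therefore commutes with the sum in the
    skew group ring.\<close>
  also have "\<dots> = finsum B (\<lambda>w. mat f z w \<otimes>\<^bsub>B\<^esub> mat g w y) W \<epsilon>"
  proof (rule finsum_hom[symmetric, where h = "\<lambda>a. a \<epsilon>"])
    show "abelian_monoid B" "abelian_monoid ?R" by unfold_locales
  qed (use W(1) closed \<epsilon> in \<open>auto simp: B_closed B_apply\<close>)
  finally show "mat (f \<otimes>\<^bsub>\<Gamma>\<^esub> g) z y \<epsilon> = finsum B (\<lambda>w. mat f z w \<otimes>\<^bsub>B\<^esub> mat g w y) W \<epsilon>" .
qed

text \<open>The finitely many nonzero coefficients of \<open>b\<close> are transported to arrows
  from \<open>y\<close> to \<open>z\<close> and fed to \<open>interpolation\<close>. Since that also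
  prescribes zero at all other arrows over \<open>F\<close>, every other entry in the columns
  indexed by \<open>F\<close> vanishes, in all rows.\<close>

lemma mat_interpolation:
  assumes F: "finite F" "F \<subseteq> Orb" and y: "y \<in> F" and z: "z \<in> Orb" and b: "b \<in> carrier B"
  obtains f where "f \<in> carrier \<Gamma>" "mat f z y = b"
    "\<And>w v. w \<in> Orb \<Longrightarrow> v \<in> F \<Longrightarrow> (w, v) \<noteq> (z, y) \<Longrightarrow> mat f w v = \<zero>\<^bsub>B\<^esub>"
proof -
  have yo: "y \<in> Orb" using F y by auto
  let ?D = "push z y ` {\<delta> \<in> Gx. b \<delta> \<noteq> \<zero>\<^bsub>\<O> x\<^esub>}"
  let ?c = "\<lambda>\<gamma>. act S (\<tau> z) (b (pull z y \<gamma>))"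
  note p = push[OF yo z]
  have c: "?c (push z y \<delta>) \<in> carrier (\<O> z)" if "\<delta> \<in> Gx" for \<delta>
    using act_closed[of "\<tau> z" "b \<delta>"] B_closed[OF b that] \<tau>[OF z] p(4)[OF that] by simp
  have "\<exists>f\<in>carrier \<Gamma>. \<forall>\<gamma>\<in>arrows G. d \<gamma> \<in> F \<longrightarrow>
      f \<gamma> = (if \<gamma> \<in> ?D then ?c \<gamma> else \<zero>\<^bsub>\<O> (r \<gamma>)\<^esub>)"
  proof (rule interpolation)
    show "F \<subseteq> units G" using F(2) orbit_units by auto
    show "finite ?D" using b by (simp add: B_carrier)
    show "?D \<subseteq> {\<gamma> \<in> arrows G. d \<gamma> \<in> F}" using p y by auto
    show "?c \<gamma> \<in> carrier (\<O> (r \<gamma>))" if "\<gamma> \<in> ?D" for \<gamma> using that c p(3) by auto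
  qed (rule F(1))
  then obtain f where f: "f \<in> carrier \<Gamma>"
    "\<And>\<gamma>. \<gamma> \<in> arrows G \<Longrightarrow> d \<gamma> \<in> F \<Longrightarrow> f \<gamma> = (if \<gamma> \<in> ?D then ?c \<gamma> else \<zero>\<^bsub>\<O> (r \<gamma>)\<^esub>)"
    by blast
  have "mat f z y = b"
  proof (rule B_eqI[OF mat_closed[OF f(1) yo z] b])
    fix \<delta> assume \<delta>: "\<delta> \<in> Gx"
    have inD: "push z y \<delta> \<in> ?D \<longleftrightarrow> b \<delta> \<noteq> \<zero>\<^bsub>\<O> x\<^esub>"
    proof
      assume "push z y \<delta> \<in> ?D"
      then obtain \<delta>' where \<delta>': "\<delta>' \<in> Gx" "b \<delta>' \<noteq> \<zero>\<^bsub>\<O> x\<^esub>" "push z y \<delta> = push z y \<delta>'" by blast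
      have "pull z y (push z y \<delta>) = pull z y (push z y \<delta>')" using \<delta>'(3) by (rule arg_cong)
      then have "\<delta> = \<delta>'" unfolding p(4)[OF \<delta>] p(4)[OF \<delta>'(1)] .
      then show "b \<delta> \<noteq> \<zero>\<^bsub>\<O> x\<^esub>" using \<delta>'(2) by simp
    qed (use \<delta> in simp)
    have "f (push z y \<delta>) = act S (\<tau> z) (b \<delta>)"
      using f(2)[OF p(1)[OF \<delta>]] p(2,3,4)[OF \<delta>] y act_zero[of "\<tau> z"] \<tau>[OF z] inD by auto
    then show "mat f z y \<delta> = b \<delta>"
      using act_inv_act[of "\<tau> z" "b \<delta>"] B_closed[OF b \<delta>] \<tau>[OF z] \<delta> by (simp add: mat_def)
  qed
  moreover have "mat f w v = \<zero>\<^bsub>B\<^esub>" if wv: "w \<in> Orb" "v \<in> F" "(w, v) \<noteq> (z, y)" for w v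
  proof (rule mat_eq_zero)
    show "v \<in> Orb" using wv F by auto
    fix \<gamma> assume \<gamma>: "\<gamma> \<in> arrows G" "d \<gamma> = v" "r \<gamma> = w"
    have "\<gamma> \<notin> ?D"
    proof
      assume "\<gamma> \<in> ?D"
      then obtain \<delta> where "\<delta> \<in> Gx" "\<gamma> = push z y \<delta>" by auto
      then show False using p(2,3)[of \<delta>] \<gamma> wv(3) by simp
    qed
    then show "f \<gamma> = \<zero>\<^bsub>\<O> w\<^esub>" using f(2)[OF \<gamma>(1)] \<gamma> wv(2) by simp
  qed (rule wv(1))
  ultimately show ?thesis using that f(1) by blast
qed

end

section \<open>The induced module\<close>

locale induction_module =
  isotropy_sheaf G S x + M: nonunital_module "skew_group_ring G S x" M
  for G :: "('g, 'm) top_groupoid_scheme" and S :: "('g, 'e, 'n) gsheaf_rings_scheme"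
    and x :: 'g and M :: "('g \<Rightarrow> 'e, 'p, 'l) module_scheme"
begin

text \<open>Matrix times column vector. The sum is cut down to the support of \<open>n\<close>
  because \<open>finsum\<close> is zero over infinite index sets; \<open>mult\<close> and
  \<open>one\<close> are dummies, ignored by \<open>left_module\<close>.\<close>

definition Ind :: "('g \<Rightarrow> 'e, 'g \<Rightarrow> 'p) module" where
  "Ind =
     \<lparr>carrier = {n \<in> Orb \<rightarrow>\<^sub>E carrier M. finite {y \<in> Orb. n y \<noteq> \<zero>\<^bsub>M\<^esub>}},
      mult = undefined, one = undefined,
      zero = (\<lambda>y\<in>Orb. \<zero>\<^bsub>M\<^esub>),
      add = (\<lambda>m n. \<lambda>y\<in>Orb. m y \<oplus>\<^bsub>M\<^esub> n y),
      smult = (\<lambda>f n. \<lambda>z\<in>Orb.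
        finsum M (\<lambda>y. mat f z y \<odot>\<^bsub>M\<^esub> n y) {y \<in> Orb. n y \<noteq> \<zero>\<^bsub>M\<^esub>})\<rparr>"

abbreviation msupp :: "('g \<Rightarrow> 'p) \<Rightarrow> 'g set"
  where "msupp n \<equiv> {y \<in> Orb. n y \<noteq> \<zero>\<^bsub>M\<^esub>}"

lemma induced_carrier:
  "n \<in> carrier Ind \<longleftrightarrow> n \<in> Orb \<rightarrow>\<^sub>E carrier M \<and> finite (msupp n)"
  by (simp add: Ind_def)

lemma induced_closed: "n \<in> carrier Ind \<Longrightarrow> y \<in> Orb \<Longrightarrow> n y \<in> carrier M"
  by (auto simp: induced_carrier)

lemma induced_eqI:
  "m \<in> carrier Ind \<Longrightarrow> n \<in> carrier Ind \<Longrightarrow> (\<And>y. y \<in> Orb \<Longrightarrow> m y = n y) \<Longrightarrow> m = n"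
  by (auto simp: induced_carrier intro: PiE_ext)

lemma induced_apply:
  "y \<in> Orb \<Longrightarrow> (m \<oplus>\<^bsub>Ind\<^esub> n) y = m y \<oplus>\<^bsub>M\<^esub> n y"
  "y \<in> Orb \<Longrightarrow> \<zero>\<^bsub>Ind\<^esub> y = \<zero>\<^bsub>M\<^esub>"
  by (simp_all add: Ind_def)

lemma induced_abelian_group: "abelian_group Ind"
  by (rule finitely_supported_abelian_group[OF M.N.abelian_group_axioms]) (simp_all add: Ind_def)

lemma mat_smult_closed:
  "f \<in> carrier \<Gamma> \<Longrightarrow> n \<in> carrier Ind \<Longrightarrow> y \<in> Orb \<Longrightarrow> z \<in> Orb \<Longrightarrow>
    mat f z y \<odot>\<^bsub>M\<^esub> n y \<in> carrier M"
  by (simp add: mat_closed induced_closed)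

lemma induced_smult_apply:
  assumes f: "f \<in> carrier \<Gamma>" and n: "n \<in> carrier Ind" and z: "z \<in> Orb"
    and F: "finite F" "F \<subseteq> Orb" "msupp n \<subseteq> F"
  shows "(f \<odot>\<^bsub>Ind\<^esub> n) z = finsum M (\<lambda>y. mat f z y \<odot>\<^bsub>M\<^esub> n y) F"
proof -
  have Fo: "y \<in> Orb" if "y \<in> F" for y using that F(2) by auto
  have "(f \<odot>\<^bsub>Ind\<^esub> n) z = finsum M (\<lambda>y. mat f z y \<odot>\<^bsub>M\<^esub> n y) (msupp n)"
    using z by (simp add: Ind_def)
  also have "\<dots> = finsum M (\<lambda>y. mat f z y \<odot>\<^bsub>M\<^esub> n y) F"
  proof (rule M.N.finsum_superset[OF F(1,3)])
    show "mat f z y \<odot>\<^bsub>M\<^esub> n y \<in> carrier M" if "y \<in> F" for y using f n Fo[OF that] z by (rule mat_smult_closed)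
    fix y assume "y \<in> F - msupp n"
    then have "y \<in> Orb" "n y = \<zero>\<^bsub>M\<^esub>" using Fo by auto
    then show "mat f z y \<odot>\<^bsub>M\<^esub> n y = \<zero>\<^bsub>M\<^esub>" using f z by (simp add: mat_closed)
  qed
  finally show ?thesis .
qed

text \<open>Column finiteness is used here: for each of the finitely many \<open>y\<close> in the
  support of \<open>n\<close>, only finitely many arrows in the support of \<open>f\<close> start at
  \<open>y\<close>, and the result is supported on their ranges.\<close>

lemma induced_smult_closed:
  assumes f: "f \<in> carrier \<Gamma>" and n: "n \<in> carrier Ind"
  shows "f \<odot>\<^bsub>Ind\<^esub> n \<in> carrier Ind"
proof -
  have fin: "finite (msupp n)" using n by (simp add: induced_carrier)
  have eq: "(f \<odot>\<^bsub>Ind\<^esub> n) z = finsum M (\<lambda>y. mat f z y \<odot>\<^bsub>M\<^esub> n y) (msupp n)" if "z \<in> Orb" for z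
    using fin that by (intro induced_smult_apply[OF f n]) auto
  have "(f \<odot>\<^bsub>Ind\<^esub> n) z \<in> carrier M" if "z \<in> Orb" for z
    unfolding eq[OF that] using f n that by (intro M.N.finsum_closed) (auto intro: mat_smult_closed)
  moreover have "f \<odot>\<^bsub>Ind\<^esub> n \<in> extensional Orb" by (simp add: Ind_def)
  moreover have "msupp (f \<odot>\<^bsub>Ind\<^esub> n) \<subseteq> (\<Union>y\<in>msupp n. r ` {\<gamma> \<in> supp f. d \<gamma> = y})"
  proof
    fix z assume z: "z \<in> msupp (f \<odot>\<^bsub>Ind\<^esub> n)"
    show "z \<in> (\<Union>y\<in>msupp n. r ` {\<gamma> \<in> supp f. d \<gamma> = y})"
    proof (rule ccontr)
      assume out: "z \<notin> (\<Union>y\<in>msupp n. r ` {\<gamma> \<in> supp f. d \<gamma> = y})"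
      have "mat f z y \<odot>\<^bsub>M\<^esub> n y = \<zero>\<^bsub>M\<^esub>" if y: "y \<in> msupp n" for y
      proof -
        have "mat f z y = \<zero>\<^bsub>B\<^esub>"
        proof (rule mat_eq_zero)
          fix \<gamma> assume \<gamma>: "\<gamma> \<in> arrows G" "d \<gamma> = y" "r \<gamma> = z"
          then have "\<gamma> \<notin> supp f" using out y by blast
          then show "f \<gamma> = \<zero>\<^bsub>\<O> z\<^esub>" using not_supp[OF \<gamma>(1), of f] \<gamma>(3) by simp
        qed (use y z in auto)
        then show ?thesis using y n by (simp add: induced_closed)
      qed
      then have "finsum M (\<lambda>y. mat f z y \<odot>\<^bsub>M\<^esub> n y) (msupp n) = \<zero>\<^bsub>M\<^esub>" by (rule M.N.add.finprod_one_eqI)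
      then show False using z eq[of z] by simp
    qed
  qed
  then have "finite (msupp (f \<odot>\<^bsub>Ind\<^esub> n))"
    by (rule finite_subset) (use fin finite_supp(2)[OF f] in auto)
  ultimately show ?thesis by (auto simp: induced_carrier PiE_iff)
qed

lemma induced_left_module: "left_module \<Gamma> Ind"
  unfolding left_module_def
proof (intro conjI ballI)
  show "abelian_group Ind" by (rule induced_abelian_group)
  interpret N: abelian_group Ind by (rule induced_abelian_group)
  fix f n assume f: "f \<in> carrier \<Gamma>" and n: "n \<in> carrier Ind"
  show "f \<odot>\<^bsub>Ind\<^esub> n \<in> carrier Ind" using f n by (rule induced_smult_closed)
  have fin: "finite (msupp n)" using n by (simp add: induced_carrier)
  show "(f \<oplus>\<^bsub>\<Gamma>\<^esub> g) \<odot>\<^bsub>Ind\<^esub> n = f \<odot>\<^bsub>Ind\<^esub> n \<oplus>\<^bsub>Ind\<^esub> g \<odot>\<^bsub>Ind\<^esub> n"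
    if g: "g \<in> carrier \<Gamma>" for g
  proof (rule induced_eqI)
    fix z assume z: "z \<in> Orb"
    have eq: "(h \<odot>\<^bsub>Ind\<^esub> n) z = finsum M (\<lambda>y. mat h z y \<odot>\<^bsub>M\<^esub> n y) (msupp n)" if "h \<in> carrier \<Gamma>" for h
      using fin z by (intro induced_smult_apply[OF that n]) auto
    have "((f \<oplus>\<^bsub>\<Gamma>\<^esub> g) \<odot>\<^bsub>Ind\<^esub> n) z = finsum M (\<lambda>y. mat (f \<oplus>\<^bsub>\<Gamma>\<^esub> g) z y \<odot>\<^bsub>M\<^esub> n y) (msupp n)"
      using f g by (intro eq) simp
    also have "\<dots> = finsum M (\<lambda>y. mat f z y \<odot>\<^bsub>M\<^esub> n y \<oplus>\<^bsub>M\<^esub> mat g z y \<odot>\<^bsub>M\<^esub> n y) (msupp n)"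
      using f g n z
      by (intro M.N.finsum_cong') (auto simp: mat_add M.smult_l_distr mat_closed induced_closed)
    also have "\<dots> = (f \<odot>\<^bsub>Ind\<^esub> n) z \<oplus>\<^bsub>M\<^esub> (g \<odot>\<^bsub>Ind\<^esub> n) z"
      unfolding eq[OF f] eq[OF g] using f g n z by (intro M.N.finsum_addf) (auto simp: mat_smult_closed)
    finally show "((f \<oplus>\<^bsub>\<Gamma>\<^esub> g) \<odot>\<^bsub>Ind\<^esub> n) z = (f \<odot>\<^bsub>Ind\<^esub> n \<oplus>\<^bsub>Ind\<^esub> g \<odot>\<^bsub>Ind\<^esub> n) z"
      using z by (simp add: induced_apply)
  qed (use f g n in \<open>auto intro!: induced_smult_closed N.a_closed\<close>)
  show "f \<odot>\<^bsub>Ind\<^esub> (n \<oplus>\<^bsub>Ind\<^esub> m) = f \<odot>\<^bsub>Ind\<^esub> n \<oplus>\<^bsub>Ind\<^esub> f \<odot>\<^bsub>Ind\<^esub> m"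
    if m: "m \<in> carrier Ind" for m
  proof (rule induced_eqI)
    fix z assume z: "z \<in> Orb"
    let ?F = "msupp n \<union> msupp m"
    have F: "finite ?F" "?F \<subseteq> Orb" using n m by (auto simp: induced_carrier)
    have Fo: "y \<in> Orb" if "y \<in> ?F" for y using that by auto
    have nm: "n \<oplus>\<^bsub>Ind\<^esub> m \<in> carrier Ind" using n m by simp
    have "(f \<odot>\<^bsub>Ind\<^esub> (n \<oplus>\<^bsub>Ind\<^esub> m)) z = finsum M (\<lambda>y. mat f z y \<odot>\<^bsub>M\<^esub> (n \<oplus>\<^bsub>Ind\<^esub> m) y) ?F"
      by (rule induced_smult_apply[OF f nm z F]) (auto simp: induced_apply)
    also have "\<dots> = finsum M (\<lambda>y. mat f z y \<odot>\<^bsub>M\<^esub> n y \<oplus>\<^bsub>M\<^esub> mat f z y \<odot>\<^bsub>M\<^esub> m y) ?F"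
    proof (rule M.N.finsum_cong'[OF refl])
      show "mat f z y \<odot>\<^bsub>M\<^esub> (n \<oplus>\<^bsub>Ind\<^esub> m) y = mat f z y \<odot>\<^bsub>M\<^esub> n y \<oplus>\<^bsub>M\<^esub> mat f z y \<odot>\<^bsub>M\<^esub> m y"
        if "y \<in> ?F" for y
        using Fo[OF that] f n m z by (simp add: induced_apply M.smult_r_distr mat_closed induced_closed)
    qed (use f n m z in \<open>auto simp: mat_smult_closed\<close>)
    also have "\<dots> = (f \<odot>\<^bsub>Ind\<^esub> n) z \<oplus>\<^bsub>M\<^esub> (f \<odot>\<^bsub>Ind\<^esub> m) z"
      unfolding induced_smult_apply[OF f n z F Un_upper1] induced_smult_apply[OF f m z F Un_upper2]
      using f n m z by (intro M.N.finsum_addf) (auto simp: mat_smult_closed)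
    finally show "(f \<odot>\<^bsub>Ind\<^esub> (n \<oplus>\<^bsub>Ind\<^esub> m)) z = (f \<odot>\<^bsub>Ind\<^esub> n \<oplus>\<^bsub>Ind\<^esub> f \<odot>\<^bsub>Ind\<^esub> m) z"
      using z by (simp add: induced_apply)
  qed (use f n m in \<open>auto intro!: induced_smult_closed N.a_closed\<close>)
  show "(f \<otimes>\<^bsub>\<Gamma>\<^esub> g) \<odot>\<^bsub>Ind\<^esub> n = f \<odot>\<^bsub>Ind\<^esub> (g \<odot>\<^bsub>Ind\<^esub> n)" if g: "g \<in> carrier \<Gamma>" for g
  proof (rule induced_eqI)
    fix z assume z: "z \<in> Orb"
    have gn: "g \<odot>\<^bsub>Ind\<^esub> n \<in> carrier Ind" using g n by (rule induced_smult_closed)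
    \<comment> \<open>The index set must contain the support of \<open>g n\<close>, to evaluate
      \<open>f\<close> on it, and the nonzero columns of row \<open>z\<close> of \<open>f\<close>,
      to apply \<open>mat_mult\<close>.\<close>
    let ?W = "msupp (g \<odot>\<^bsub>Ind\<^esub> n) \<union> d ` {\<gamma> \<in> supp f. r \<gamma> = z}"
    have W: "finite ?W" using gn finite_supp(1)[OF f] by (simp add: induced_carrier)
    have Wo: "?W \<subseteq> Orb" using z orbit_invariant[of _ x] by (auto simp: supp_def)
    have Wo': "w \<in> Orb" if "w \<in> ?W" for w using that Wo by blast
    have closed: "mat f z w \<odot>\<^bsub>M\<^esub> (mat g w y \<odot>\<^bsub>M\<^esub> n y) \<in> carrier M" if "w \<in> ?W" "y \<in> msupp n" for w y
      using that(2) Wo'[OF that(1)] f g n z by (simp add: mat_closed induced_closed)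
    have "((f \<otimes>\<^bsub>\<Gamma>\<^esub> g) \<odot>\<^bsub>Ind\<^esub> n) z = finsum M (\<lambda>y. mat (f \<otimes>\<^bsub>\<Gamma>\<^esub> g) z y \<odot>\<^bsub>M\<^esub> n y) (msupp n)"
      using f g fin z by (intro induced_smult_apply[OF _ n]) (auto intro: Gamma_mult_closed)
    also have "\<dots> = finsum M (\<lambda>y. finsum M (\<lambda>w. mat f z w \<odot>\<^bsub>M\<^esub> (mat g w y \<odot>\<^bsub>M\<^esub> n y)) ?W) (msupp n)"
    proof (rule M.N.finsum_cong'[OF refl])
      show "(\<lambda>y. finsum M (\<lambda>w. mat f z w \<odot>\<^bsub>M\<^esub> (mat g w y \<odot>\<^bsub>M\<^esub> n y)) ?W) \<in> msupp n \<rightarrow> carrier M"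
        using closed by (intro Pi_I M.N.finsum_closed) blast
      fix y assume y: "y \<in> msupp n"
      then have yo: "y \<in> Orb" and ny: "n y \<in> carrier M" using n by (auto intro: induced_closed)
      have mm: "mat f z w \<otimes>\<^bsub>B\<^esub> mat g w y \<in> carrier B" if "w \<in> ?W" for w
        using f g z yo Wo'[OF that] by (intro B_mult_closed mat_closed)
      have "mat (f \<otimes>\<^bsub>\<Gamma>\<^esub> g) z y \<odot>\<^bsub>M\<^esub> n y = finsum B (\<lambda>w. mat f z w \<otimes>\<^bsub>B\<^esub> mat g w y) ?W \<odot>\<^bsub>M\<^esub> n y"
        by (subst mat_mult[OF f g yo z W Wo]) auto
      also have "\<dots> = finsum M (\<lambda>w. (mat f z w \<otimes>\<^bsub>B\<^esub> mat g w y) \<odot>\<^bsub>M\<^esub> n y) ?W"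
      proof (rule finsum_hom[where h = "\<lambda>b. b \<odot>\<^bsub>M\<^esub> n y"])
        show "abelian_monoid B" "abelian_monoid M" by unfold_locales
      qed (use W mm ny in \<open>auto simp: M.smult_l_distr\<close>)
      also have "\<dots> = finsum M (\<lambda>w. mat f z w \<odot>\<^bsub>M\<^esub> (mat g w y \<odot>\<^bsub>M\<^esub> n y)) ?W"
      proof (rule M.N.finsum_cong'[OF refl])
        show "(\<lambda>w. mat f z w \<odot>\<^bsub>M\<^esub> (mat g w y \<odot>\<^bsub>M\<^esub> n y)) \<in> ?W \<rightarrow> carrier M" using closed y by blast
        show "(mat f z w \<otimes>\<^bsub>B\<^esub> mat g w y) \<odot>\<^bsub>M\<^esub> n y = mat f z w \<odot>\<^bsub>M\<^esub> (mat g w y \<odot>\<^bsub>M\<^esub> n y)" if "w \<in> ?W" for w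
          using Wo'[OF that] f g z yo ny by (intro M.smult_assoc mat_closed)
      qed
      finally show "mat (f \<otimes>\<^bsub>\<Gamma>\<^esub> g) z y \<odot>\<^bsub>M\<^esub> n y = finsum M (\<lambda>w. mat f z w \<odot>\<^bsub>M\<^esub> (mat g w y \<odot>\<^bsub>M\<^esub> n y)) ?W" .
    qed
    also have "\<dots> = finsum M (\<lambda>w. finsum M (\<lambda>y. mat f z w \<odot>\<^bsub>M\<^esub> (mat g w y \<odot>\<^bsub>M\<^esub> n y)) (msupp n)) ?W"
      using fin W closed by (rule M.N.finsum_swap)
    also have "\<dots> = finsum M (\<lambda>w. mat f z w \<odot>\<^bsub>M\<^esub> (g \<odot>\<^bsub>Ind\<^esub> n) w) ?W"
    proof (rule M.N.finsum_cong'[OF refl])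
      show "(\<lambda>w. mat f z w \<odot>\<^bsub>M\<^esub> (g \<odot>\<^bsub>Ind\<^esub> n) w) \<in> ?W \<rightarrow> carrier M"
        using mat_smult_closed[OF f gn _ z] Wo' by blast
      fix w assume w: "w \<in> ?W"
      note wo = Wo'[OF w]
      have "(g \<odot>\<^bsub>Ind\<^esub> n) w = finsum M (\<lambda>y. mat g w y \<odot>\<^bsub>M\<^esub> n y) (msupp n)"
        using fin wo by (intro induced_smult_apply[OF g n]) auto
      moreover have "mat f z w \<odot>\<^bsub>M\<^esub> finsum M (\<lambda>y. mat g w y \<odot>\<^bsub>M\<^esub> n y) (msupp n)
          = finsum M (\<lambda>y. mat f z w \<odot>\<^bsub>M\<^esub> (mat g w y \<odot>\<^bsub>M\<^esub> n y)) (msupp n)"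
      proof (rule finsum_hom[where h = "\<lambda>m. mat f z w \<odot>\<^bsub>M\<^esub> m"])
        show "abelian_monoid M" "abelian_monoid M" by unfold_locales
      qed (use fin g n wo mat_closed[OF f wo z] in \<open>auto simp: M.smult_r_distr mat_smult_closed\<close>)
      ultimately show "finsum M (\<lambda>y. mat f z w \<odot>\<^bsub>M\<^esub> (mat g w y \<odot>\<^bsub>M\<^esub> n y)) (msupp n)
          = mat f z w \<odot>\<^bsub>M\<^esub> (g \<odot>\<^bsub>Ind\<^esub> n) w" by simp
    qed
    also have "\<dots> = (f \<odot>\<^bsub>Ind\<^esub> (g \<odot>\<^bsub>Ind\<^esub> n)) z"
      by (rule induced_smult_apply[OF f gn z W Wo, symmetric]) blast
    finally show "((f \<otimes>\<^bsub>\<Gamma>\<^esub> g) \<odot>\<^bsub>Ind\<^esub> n) z = (f \<odot>\<^bsub>Ind\<^esub> (g \<odot>\<^bsub>Ind\<^esub> n)) z" .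
  qed (use f g n in \<open>auto intro!: induced_smult_closed Gamma_mult_closed\<close>)
qed

sublocale ind: nonunital_module \<Gamma> Ind
  using Gamma_abelian_group induced_abelian_group induced_left_module
  by (intro nonunital_module.intro nonunital_module_axioms.intro)

section \<open>Simplicity and faithfulness of the induced module\<close>

definition single :: "'g \<Rightarrow> 'p \<Rightarrow> 'g \<Rightarrow> 'p"
  where "single z m = (\<lambda>y\<in>Orb. if y = z then m else \<zero>\<^bsub>M\<^esub>)"

lemma single_closed: "m \<in> carrier M \<Longrightarrow> single z m \<in> carrier Ind"
proof -
  assume "m \<in> carrier M"
  moreover have "finite (msupp (single z m))"
    by (rule finite_subset[of _ "{z}"]) (auto simp: single_def)
  ultimately show ?thesis by (auto simp: induced_carrier single_def)
qed

lemma smult_single: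
  assumes f: "f \<in> carrier \<Gamma>" and m: "m \<in> carrier M" and y: "y \<in> Orb" and z: "z \<in> Orb"
  shows "(f \<odot>\<^bsub>Ind\<^esub> single y m) z = mat f z y \<odot>\<^bsub>M\<^esub> m"
proof -
  have "(f \<odot>\<^bsub>Ind\<^esub> single y m) z = finsum M (\<lambda>v. mat f z v \<odot>\<^bsub>M\<^esub> single y m v) {y}"
    using y by (intro induced_smult_apply[OF f single_closed[OF m] z]) (auto simp: single_def)
  then show ?thesis using mat_closed[OF f y z] m y by (simp add: M.N.finsum_insert single_def)
qed

text \<open>Pick \<open>y\<close> with \<open>n y \<noteq> 0\<close>. Simplicity of \<open>M\<close>
  gives \<open>b\<close> carrying \<open>n y\<close> to \<open>m\<close>, and some \<open>f\<close>
  has entry \<open>b\<close> at \<open>(z, y)\<close> and no other nonzero entry in the columns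
  where \<open>n\<close> lives. Then \<open>f n\<close> is the required vector.\<close>

lemma submodule_contains_single:
  assumes simple: "simple_left_module B M" and H: "submodule H \<Gamma> Ind"
    and n: "n \<in> H" "n \<noteq> \<zero>\<^bsub>Ind\<^esub>" and m: "m \<in> carrier M" and z: "z \<in> Orb"
  shows "single z m \<in> H"
proof -
  have nN: "n \<in> carrier Ind" using ind.submoduleD(1)[OF H] n(1) by auto
  have "\<exists>y\<in>Orb. n y \<noteq> \<zero>\<^bsub>M\<^esub>"
  proof (rule ccontr)
    assume "\<not> (\<exists>y\<in>Orb. n y \<noteq> \<zero>\<^bsub>M\<^esub>)"
    then have "n = \<zero>\<^bsub>Ind\<^esub>" using nN by (intro induced_eqI) (auto simp: induced_apply)
    then show False using n(2) by simp
  qed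
  then obtain y where y: "y \<in> Orb" "n y \<noteq> \<zero>\<^bsub>M\<^esub>" by blast
  have ny: "n y \<in> carrier M" using nN y(1) by (rule induced_closed)
  have "m \<in> (\<lambda>b. b \<odot>\<^bsub>M\<^esub> n y) ` carrier B"
    using M.simple_generated[OF simple B_mult_closed ny y(2)] m by simp
  then obtain b where b: "b \<in> carrier B" "m = b \<odot>\<^bsub>M\<^esub> n y" by blast
  have fin: "finite (msupp n)" using nN by (simp add: induced_carrier)
  obtain f where f: "f \<in> carrier \<Gamma>" "mat f z y = b"
    "\<And>w v. w \<in> Orb \<Longrightarrow> v \<in> msupp n \<Longrightarrow> (w, v) \<noteq> (z, y) \<Longrightarrow> mat f w v = \<zero>\<^bsub>B\<^esub>"
    by (rule mat_interpolation[OF fin _ _ z b(1), of y]) (use y in auto)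
  have "f \<odot>\<^bsub>Ind\<^esub> n = single z m"
  proof (rule induced_eqI)
    fix w assume w: "w \<in> Orb"
    have "(f \<odot>\<^bsub>Ind\<^esub> n) w = finsum M (\<lambda>v. mat f w v \<odot>\<^bsub>M\<^esub> n v) (msupp n)"
      using fin w by (intro induced_smult_apply[OF f(1) nN]) auto
    also have "\<dots> = finsum M (\<lambda>v. mat f w v \<odot>\<^bsub>M\<^esub> n v) {y}"
    proof (rule M.N.finsum_superset[OF fin, symmetric])
      show "mat f w v \<odot>\<^bsub>M\<^esub> n v \<in> carrier M" if "v \<in> msupp n" for v
        using that by (intro mat_smult_closed[OF f(1) nN _ w]) simp
      show "mat f w v \<odot>\<^bsub>M\<^esub> n v = \<zero>\<^bsub>M\<^esub>" if "v \<in> msupp n - {y}" for v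
        using that f(3)[OF w, of v] induced_closed[OF nN, of v] by simp
    qed (use y in simp)
    also have "\<dots> = mat f w y \<odot>\<^bsub>M\<^esub> n y"
      using mat_smult_closed[OF f(1) nN y(1) w] by (simp add: M.N.finsum_insert)
    also have "\<dots> = single z m w"
      using f(2,3) b(2) w y ny by (auto simp: single_def)
    finally show "(f \<odot>\<^bsub>Ind\<^esub> n) w = single z m w" .
  qed (use f(1) nN m in \<open>auto intro: induced_smult_closed single_closed\<close>)
  then show ?thesis using ind.submoduleD(4)[OF H f(1) n(1)] by simp
qed

text \<open>Every element is a finite sum of vectors supported at one point; these are split off by
  induction on a finite set containing the support.\<close>

lemma submodule_eq_carrier:
  assumes H: "submodule H \<Gamma> Ind"
    and single: "\<And>z m. z \<in> Orb \<Longrightarrow> m \<in> carrier M \<Longrightarrow> single z m \<in> H"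
  shows "H = carrier Ind"
proof
  show "H \<subseteq> carrier Ind" using H by (rule ind.submoduleD)
  have "n \<in> H" if "finite D" "n \<in> carrier Ind" "msupp n \<subseteq> D" for D n
    using that
  proof (induction D arbitrary: n)
    case empty
    then have "n = \<zero>\<^bsub>Ind\<^esub>" by (intro induced_eqI) (auto simp: induced_apply)
    then show ?case using ind.submoduleD(2)[OF H] by simp
  next
    case (insert z D)
    show ?case
    proof (cases "z \<in> Orb")
      case False
      then show ?thesis using insert by blast
    next
      case True
      let ?n = "n(z := \<zero>\<^bsub>M\<^esub>)"
      have nz: "n z \<in> carrier M" using insert.prems(1) True by (rule induced_closed)
      have sub: "msupp ?n \<subseteq> msupp n" by auto
      have n': "?n \<in> carrier Ind"
        using insert.prems(1) True finite_subset[OF sub] by (auto simp: induced_carrier PiE_iff extensional_def)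
      have "?n \<in> H" by (rule insert.IH[OF n']) (use insert.prems(2) in auto)
      then have "?n \<oplus>\<^bsub>Ind\<^esub> single z (n z) \<in> H"
        using single[OF True nz] by (rule ind.submoduleD(3)[OF H])
      moreover have "?n \<oplus>\<^bsub>Ind\<^esub> single z (n z) = n"
      proof (rule induced_eqI)
        show "(?n \<oplus>\<^bsub>Ind\<^esub> single z (n z)) y = n y" if "y \<in> Orb" for y
          using that nz induced_closed[OF insert.prems(1) that] by (simp add: induced_apply single_def)
      qed (use n' nz single_closed insert.prems(1) in auto)
      ultimately show ?thesis by simp
    qed
  qed
  then show "carrier Ind \<subseteq> H" by (auto simp: induced_carrier)
qed

lemma induced_simple:
  assumes simple: "simple_left_module B M"
  shows "simple_left_module \<Gamma> Ind"
  unfolding simple_left_module_def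
proof (intro conjI allI impI)
  show "left_module \<Gamma> Ind" by (rule induced_left_module)
  have xo: "x \<in> Orb" using x by (rule orbit_self)
  obtain b u where b: "b \<in> carrier B" and u: "u \<in> carrier M" and nz: "b \<odot>\<^bsub>M\<^esub> u \<noteq> \<zero>\<^bsub>M\<^esub>"
    using simple unfolding simple_left_module_def by blast
  \<comment> \<open>A nonzero action on \<open>M\<close> is realized in the diagonal entry at
    \<open>x\<close>, so the action of \<Gamma> is nonzero as well.\<close>
  obtain f where f: "f \<in> carrier \<Gamma>" "mat f x x = b"
    by (rule mat_interpolation[of "{x}" x x b]) (use xo b in auto)
  have "(f \<odot>\<^bsub>Ind\<^esub> single x u) x \<noteq> \<zero>\<^bsub>Ind\<^esub> x"
    using smult_single[OF f(1) u xo xo] f(2) nz xo by (simp add: induced_apply)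
  then show "\<exists>f\<in>carrier \<Gamma>. \<exists>n\<in>carrier Ind. f \<odot>\<^bsub>Ind\<^esub> n \<noteq> \<zero>\<^bsub>Ind\<^esub>"
    using f(1) single_closed[OF u] by metis
next
  fix H assume H: "submodule H \<Gamma> Ind"
  show "H = {\<zero>\<^bsub>Ind\<^esub>} \<or> H = carrier Ind"
  proof (rule disjCI)
    assume "H \<noteq> carrier Ind"
    then have "\<not> (\<exists>n\<in>H. n \<noteq> \<zero>\<^bsub>Ind\<^esub>)"
      using submodule_eq_carrier[OF H] submodule_contains_single[OF simple H] by blast
    then show "H = {\<zero>\<^bsub>Ind\<^esub>}" using ind.submoduleD(2)[OF H] by blast
  qed
qed

text \<open>Vectors supported at one point read off single matrix entries. An annihilating
  \<open>f\<close> thus has entries that annihilate \<open>M\<close>, hence are zero, and zero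
  entries mean that \<open>f\<close> vanishes on the arrows over the orbit.\<close>

lemma induced_faithful:
  assumes faithful: "faithful_left_module B M" and dense: "orbit_detects_zero G S x"
  shows "faithful_left_module \<Gamma> Ind"
  unfolding faithful_left_module_def
proof (intro conjI ballI impI)
  show "left_module \<Gamma> Ind" by (rule induced_left_module)
  fix f assume f: "f \<in> carrier \<Gamma>" and ann: "\<forall>n\<in>carrier Ind. f \<odot>\<^bsub>Ind\<^esub> n = \<zero>\<^bsub>Ind\<^esub>"
  have "f \<gamma> = \<zero>\<^bsub>\<O> (r \<gamma>)\<^esub>" if \<gamma>: "\<gamma> \<in> arrows G" "d \<gamma> \<in> Orb" for \<gamma>
  proof -
    have z: "r \<gamma> \<in> Orb" using \<gamma> orbit_invariant by blast
    have "mat f (r \<gamma>) (d \<gamma>) \<odot>\<^bsub>M\<^esub> m = \<zero>\<^bsub>M\<^esub>" if m: "m \<in> carrier M" for m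
      using smult_single[OF f m \<gamma>(2) z] ann single_closed[OF m] z by (simp add: induced_apply)
    then have "mat f (r \<gamma>) (d \<gamma>) = \<zero>\<^bsub>B\<^esub>"
      using faithful mat_closed[OF f \<gamma>(2) z] by (simp add: faithful_left_module_def)
    then show ?thesis by (rule mat_eq_zeroD[OF f _ \<gamma>(2) z \<gamma>(1) refl refl])
  qed
  then show "f = \<zero>\<^bsub>\<Gamma>\<^esub>" using dense f by (simp add: orbit_detects_zero_def)
qed

end

theorem theorem4p18:
  fixes G :: "'g top_groupoid" and S :: "('g, 'e) gsheaf_rings"
  assumes "ample_groupoid G" and "groupoid_sheaf_of_rings G S"
  shows "(left_primitive (Gamma_c G S) \<longrightarrow> (\<exists>x\<in>units G. orbit_detects_zero G S x)) \<and>
    ((\<exists>x\<in>units G. left_primitive (skew_group_ring G S x) \<and> orbit_detects_zero G S x) \<longrightarrow>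
      left_primitive (Gamma_c G S))"
proof (intro conjI impI)
  interpret ample_groupoid_sheaf G S using assms by (rule ample_groupoid_sheaf.intro)
  show "\<exists>x\<in>units G. orbit_detects_zero G S x" if prim: "left_primitive \<Gamma>"
  proof -
    obtain N :: "('g \<Rightarrow> 'e, ('g \<Rightarrow> 'e) set) module"
      where N: "simple_left_module \<Gamma> N" "faithful_left_module \<Gamma> N"
      using prim unfolding left_primitive_def by blast
    then have "left_module \<Gamma> N" "abelian_group N" by (simp_all add: simple_left_module_def left_module_def)
    then interpret Gamma_module G S N
      using Gamma_abelian_group
      by (intro Gamma_module.intro nonunital_module.intro nonunital_module_axioms.intro ample_groupoid_sheaf_axioms)
    show ?thesis using N by (rule simple_faithful_orbit)
  qed
  assume "\<exists>x\<in>units G. left_primitive (skew_group_ring G S x) \<and> orbit_detects_zero G S x"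
  then obtain x where x: "x \<in> units G" and dense: "orbit_detects_zero G S x"
    and prim: "left_primitive (skew_group_ring G S x)" by blast
  interpret isotropy_sheaf G S x by unfold_locales (rule x)
  obtain M :: "('g \<Rightarrow> 'e, ('g \<Rightarrow> 'e) set) module"
    where M: "simple_left_module B M" "faithful_left_module B M"
    using prim unfolding left_primitive_def by blast
  then have "left_module B M" "abelian_group M" by (simp_all add: simple_left_module_def left_module_def)
  then interpret induction_module G S x M
    using B_abelian_group
    by (intro induction_module.intro nonunital_module.intro nonunital_module_axioms.intro isotropy_sheaf_axioms)
  show "left_primitive \<Gamma>"
    \<comment> \<open>The elements of \<open>Ind\<close> are functions on the orbit, not sets of
      elements of \<Gamma> as \<open>left_primitive\<close> asks for, so the criterion with
      arbitrary carrier type is used.\<close>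
    using Gamma_abelian_group Gamma_mult_closed induced_simple[OF M(1)] induced_faithful[OF M(2) dense]
    by (rule left_primitiveI)
qed

end
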